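(* Let $k\ge1$ be a natural number. For real $\alpha,\beta>0$ satisfying $\alpha\beta=\pi^2$, \begin{align*} &\sum_{n=1}^{\infty}\frac{d_k(n)}{n}\Psi_{(2\alpha)^k,k}(n)-\sum_{n=1}^{\infty}\frac{d_k(n)}{n}\Psi_{(2\beta)^k,k}(n)\\ &=\frac{(-1)^k2^{k}}{(2k-1)!}\frac{d^{2k-1}}{ds^{2k-1}}\left(\Gamma^k(1+s)\Gamma^k(1-s)\zeta^k(s)\zeta^k(-s)\cos^{2k-1}\left(\frac{\pi s}{2}\right)\left(\frac{\alpha}{\beta}\right)^{-\frac{ks}{2}}\right)\bigg|_{s=0}+2\,\frac{(-1)^{k+1}\pi^{k-1}}{24^k}\left(\beta^k-\alpha^k\right). \end{align*}
   Context: $\zeta$ is the (analytically continued) Riemann zeta function, $\Gamma$ the Gamma function, and $f^k(s)$ denotes $(f(s))^k$. $d_k(n)$ is the Piltz divisor function: the number of ordered $k$-tuples of positive integers with product $n$ (so $\sum_{n\ge1} d_k(n)n^{-s}=\zeta^k(s)$ for $\mathrm{Re}(s)>1$). For $\rho>0$, $x>0$ and a natural number $k$, $$\Psi_{\rho,k}(x):=\frac{\pi^{k/2-1}}{2^{k-1}}\sum_{j=1}^\infty d_k(j)\,G^{k+1,0}_{0,2k}\left(\begin{matrix}\text{---}\\ (0)_k,\tfrac12;(\tfrac12)_{k-1}\end{matrix}\ \bigg|\ \frac{\rho^2j^2x^2}{2^{2k}}\right),$$ where $(a)_r$ means the parameter $a$ repeated $r$ times and the Meijer $G$-function occurring here is,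 for $z>0$ and any $\mu<0$, $$G^{k+1,0}_{0,2k}\left(\begin{matrix}\text{---}\\ (0)_k,\tfrac12;(\tfrac12)_{k-1}\end{matrix}\ \bigg|\ z\right)=\frac{1}{2\pi i}\int_{\mu-i\infty}^{\mu+i\infty}\frac{\Gamma(-s)^k\,\Gamma(\tfrac12-s)}{\Gamma(\tfrac12+s)^{k-1}}\,z^s\,ds.$$ *)

theory Defs
  imports "HOL-Complex_Analysis.Complex_Analysis"
begin

text \<open>
  The Riemann zeta function as the analytic continuation of the Dirichlet series to the plane
  punctured at 1. The conditions determine it everywhere except at the pole 1, where its value
  is unspecified.
\<close>

definition zeta :: "complex \<Rightarrow> complex" where
  "zeta = (SOME f. f holomorphic_on (- {1}) \<and>
     (\<forall>s. Re s > 1 \<longrightarrow> (\<lambda>n. 1 / of_nat (Suc n) powr s) sums f s))"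

definition piltz_d :: "nat \<Rightarrow> nat \<Rightarrow> nat" where
  "piltz_d k n = card {xs :: nat list. length xs = k \<and> (\<forall>x\<in>set xs. x > 0) \<and> prod_list xs = n}"

text \<open>
  The Meijer function $G^{k+1,0}_{0,2k}$ with parameters $(0)_k, 1/2; (1/2)_{k-1}$ at a positive
  real argument \<open>z\<close>, as a Mellin-Barnes integral along the upward line \<open>Re s = \<mu>\<close>, parametrised
  by \<open>s = \<mu> + i t\<close>. For \<open>\<mu> < 0\<close> the integral converges absolutely and does not depend on \<open>\<mu>\<close>;
  the abscissa is kept as an explicit argument instead of fixing one. HOL's conventions
  \<open>Gamma s = 0\<close> at the poles and \<open>x / 0 = 0\<close> agree with the zeros of the reciprocal Gamma function.
\<close>

definition meijer_G_integrand :: "nat \<Rightarrow> real \<Rightarrow> complex \<Rightarrow> complex" where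
  "meijer_G_integrand k z s =
     Gamma (- s) ^ k * Gamma (1 / 2 - s) / Gamma (1 / 2 + s) ^ (k - 1) * of_real z powr s"

definition meijer_G :: "real \<Rightarrow> nat \<Rightarrow> real \<Rightarrow> complex" where
  "meijer_G \<mu> k z =
     1 / (2 * of_real pi * \<i>) * (LINT t|lborel. meijer_G_integrand k z (Complex \<mu> t) * \<i>)"

definition Psi :: "real \<Rightarrow> real \<Rightarrow> nat \<Rightarrow> real \<Rightarrow> complex" where
  "Psi \<mu> \<rho> k x =
     of_real (pi powr (real k / 2 - 1) / 2 ^ (k - 1)) *
     (\<Sum>j. of_nat (piltz_d k (Suc j)) *
           meijer_G \<mu> k (\<rho>\<^sup>2 * (real (Suc j))\<^sup>2 * x\<^sup>2 / 2 ^ (2 * k)))"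

end

theory Submission
  imports Defs "HOL-Probability.Sinc_Integral"
begin

text \<open>
  The duplication and reflection formulas turn the Mellin--Barnes integrand of the G-function, after
  the substitution \<open>w = -2s\<close>, into \<open>\<Gamma>(w)\<^sup>k cos(\<pi>w/2)\<^bsup>k-1\<^esup> (\<rho>jx)\<^bsup>-w\<^esup>\<close>. On a line with \<open>Re w > 1\<close>
  both sums over the divisor function may be taken under the integral; they produce \<open>\<zeta>(w)\<^sup>k\<close> and
  \<open>\<zeta>(1+w)\<^sup>k\<close>. Hence the series belonging to \<open>\<alpha>\<close> is
  \<open>(1/2\<pi>i) \<integral> (\<Gamma>(w) \<zeta>(w) \<zeta>(1+w))\<^sup>k cos(\<pi>w/2)\<^bsup>k-1\<^esup> (2\<alpha>)\<^bsup>-kw\<^esup> dw\<close> over \<open>Re w = 3/2\<close>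
  (\<open>Psi_sums_line_integral\<close>). The functional equation of \<open>\<zeta>\<close> replaces \<open>\<Gamma>(w) \<zeta>(w)\<close> by \<open>\<zeta>(1-w)\<close>, and
  the integrand becomes \<open>2\<^bsup>-k\<^esup> H(w) (\<pi>/\<alpha>)\<^bsup>kw\<^esup>\<close> with
  \<open>H(w) = (\<zeta>(1-w) \<zeta>(1+w))\<^sup>k / cos(\<pi>w/2)\<close> (\<open>mellin_integrand_eq_even_kernel\<close>).

  The point is that \<open>H\<close> is even. Since \<open>\<alpha>\<beta> = \<pi>\<^sup>2\<close> makes \<open>\<pi>/\<alpha>\<close> and \<open>\<pi>/\<beta>\<close> reciprocal, the reflection
  \<open>w \<mapsto> -w\<close> identifies the series belonging to \<open>\<beta>\<close> with the integral of the \<^emph>\<open>same\<close> function over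
  \<open>Re w = -3/2\<close>. The difference of the two series is therefore the sum of the residues in between
  (\<open>even_kernel_line_shift\<close>). The simple zeros of the cosine at \<open>\<plusminus>1\<close> contribute the two powers, through
  \<open>\<zeta>(0) \<zeta>(2) = -\<pi>\<^sup>2/12\<close>; at \<open>0\<close> there is a pole of order \<open>2k\<close>, whose residue is the derivative of order
  \<open>2k-1\<close>, and the functional equation used backwards gives the function that is differentiated.

  Three analytic inputs are built on the way. The continuation of \<open>\<zeta>\<close> to \<open>Re s > -1\<close> is the error
  series of the trapezoidal rule for \<open>x\<^bsup>-s\<^esup>\<close>, which at once bounds \<open>\<zeta>\<close> by a quadratic polynomial on vertical
  strips. The functional equation is first proved for \<open>-1 < s < 0\<close>: there \<open>\<Gamma>(s) \<zeta>(s)\<close> is the Mellin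
  transform of \<open>1/(e\<^sup>y-1) + 1/2 - 1/y\<close>, and integrating the partial fractions of this function term by
  term gives \<open>\<zeta>(1-s)\<close>. Finally \<open>\<Gamma>\<close> decays like \<open>e\<^bsup>-\<pi>|t|/2\<^esup>\<close> on vertical strips, because
  \<open>|\<Gamma>(\<sigma>+it)|/\<Gamma>(\<sigma>)\<close> increases with \<open>\<sigma>\<close> and is explicit on half-integer lines; this decay beats the
  \<open>k-1\<close> cosines of the kernel and leaves one factor \<open>e\<^bsup>-\<pi>|t|/2\<^esup>\<close> to spare for every \<open>k\<close>.
\<close>

section \<open>Continuation of the zeta function by the trapezoidal rule\<close>

text \<open>
  The difference between the trapezoidal rule and the integral of \<open>x\<^bsup>-s\<^esup>\<close> over \<open>[n, n+1]\<close>. As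
  \<open>0 powr s = 0\<close>, the case \<open>n = 0\<close> has the right value for \<open>Re s < 0\<close>.
\<close>

definition trapezoid_error :: "nat \<Rightarrow> complex \<Rightarrow> complex" where
  "trapezoid_error n s =
     (of_nat n powr (-s) + of_nat (Suc n) powr (-s)) / 2
     - (of_nat (Suc n) powr (1 - s) - of_nat n powr (1 - s)) / (1 - s)"

text \<open>
  Adding up trapezoidal rules counts every term of the Dirichlet series fully except the first, which
  is counted half, and the integrals add up to \<open>1/(s-1)\<close>. So this is \<open>\<zeta>(s)\<close> for \<open>Re s > 1\<close>, while the error
  terms remain summable down to \<open>Re s > -1\<close>.
\<close>

definition zeta_cont :: "complex \<Rightarrow> complex" where
  "zeta_cont s = 1 / (s - 1) + 1 / 2 + (\<Sum>n. trapezoid_error (Suc n) s)"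

text \<open>
  The error of the trapezoidal rule for \<open>f\<close> is \<open>\<integral> (x-n)(n+1-x)/2 f''(x) dx\<close>, and \<open>f''\<close> is
  \<open>s(s+1) x\<^bsup>-s-2\<^esup>\<close>. The explicit primitive \<open>Q\<close> of this integrand replaces the integral: its increment is
  the error, and its derivative is bounded by the claim because \<open>(x-n)(n+1-x) \<le> 1/4\<close>.
\<close>

lemma trapezoid_error_bound:
  assumes n: "n > 0" and s: "Re s \<ge> -2" "s \<noteq> 1"
  shows "norm (trapezoid_error n s) \<le> norm (s * (s + 1)) / 8 * real n powr (- Re s - 2)"
proof -
  define Q where "Q = (\<lambda>w::complex. (w - of_nat n) * (of_nat n + 1 - w) / 2 * (-s * w powr (-s-1))
      - (2 * of_nat n + 1 - 2 * w) / 2 * w powr (-s) - w powr (1 - s) / (1 - s))"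
  define Q' where "Q' = (\<lambda>w::complex. (w - of_nat n) * (of_nat n + 1 - w) / 2 * (s * (s + 1) * w powr (-s-2)))"
  define S where "S = closed_segment (of_nat n :: complex) (of_nat (Suc n))"
  have S: "\<exists>x. w = complex_of_real x \<and> real n \<le> x \<and> x \<le> real n + 1" if "w \<in> S" for w
  proof -
    have "S = complex_of_real ` closed_segment (real n) (real (Suc n))"
      using closed_segment_of_real[of "real n" "real (Suc n)"] by (simp only: S_def of_real_of_nat_eq)
    thus ?thesis using that by (auto simp: closed_segment_eq_real_ivl)
  qed
  have deriv: "(Q has_field_derivative Q' w) (at w within S)" if w: "w \<in> S" for w
  proof -
    obtain x where x: "w = complex_of_real x" "real n \<le> x" using S[OF w] by blast
    with n have w0: "w \<notin> \<real>\<^sub>\<le>\<^sub>0" by auto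
    have w1: "w \<noteq> 0" using w0 by auto
    define p where "p = w powr (-s-2)"
    have p: "w powr (-s-1) = w * p" "w powr (-s) = w * (w * p)"
      using w1 by (simp_all add: p_def powr_diff field_simps power2_eq_square)
    have d: "((\<lambda>w. w powr a) has_field_derivative a * w powr (a - 1)) (at w within S)" for a
      using has_field_derivative_powr[OF w0, of a] by (rule DERIV_subset) auto
    have d2: "((\<lambda>w. w powr (1 - s) / (1 - s)) has_field_derivative w * (w * p)) (at w within S)"
      using DERIV_cdivide[OF d[of "1 - s"], of "1 - s"] s(2) by (simp add: p)
    have d1: "((\<lambda>w. w powr (-s)) has_field_derivative -s * (w * p)) (at w within S)"
      using d[of "-s"] by (simp add: p)
    have d0: "((\<lambda>w. w powr (-s-1)) has_field_derivative (-s-1) * p) (at w within S)"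
    proof -
      have "-s - 1 - 1 = -s - 2" by simp
      thus ?thesis using d[of "-s-1"] by (simp only: p_def)
    qed
    have q: "((\<lambda>w. (w - of_nat n) * (of_nat n + 1 - w) / 2) has_field_derivative (2 * of_nat n + 1 - 2 * w) / 2) (at w within S)"
      by (auto intro!: derivative_eq_intros simp: field_simps)
    have l: "((\<lambda>w. (2 * of_nat n + 1 - 2 * w) / 2) has_field_derivative -1) (at w within S)"
      by (auto intro!: derivative_eq_intros)
    have "(Q has_field_derivative
       ((w - of_nat n) * (of_nat n + 1 - w) / 2 * (-s * ((-s-1) * p)) + (2 * of_nat n + 1 - 2 * w) / 2 * (-s * w powr (-s-1))
       - ((2 * of_nat n + 1 - 2 * w) / 2 * (-s * (w * p)) + -1 * w powr (-s)) - w * (w * p))) (at w within S)"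
      unfolding Q_def by (intro DERIV_diff DERIV_mult' DERIV_cmult q l d0 d1 d2)
    moreover have "(w - of_nat n) * (of_nat n + 1 - w) / 2 * (-s * ((-s-1) * p)) + (2 * of_nat n + 1 - 2 * w) / 2 * (-s * w powr (-s-1))
       - ((2 * of_nat n + 1 - 2 * w) / 2 * (-s * (w * p)) + -1 * w powr (-s)) - w * (w * p) = Q' w"
      unfolding Q'_def p p_def[symmetric] by (simp add: algebra_simps)
    ultimately show ?thesis by simp
  qed
  have bound: "norm (Q' w) \<le> norm (s * (s + 1)) / 8 * real n powr (- Re s - 2)" if w: "w \<in> S" for w
  proof -
    obtain x where x: "w = complex_of_real x" "real n \<le> x" "x \<le> real n + 1" using S[OF w] by blast
    have x0: "x > 0" using x n by auto
    have p: "(x - n) * (n + 1 - x) \<le> 1 / 4"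
      using zero_le_power2[of "2 * (x - n) - 1"] by (simp add: power2_eq_square algebra_simps)
    have p0: "(x - n) * (n + 1 - x) \<ge> 0" using x by simp
    have 1: "norm (w powr (-s-2)) = x powr (- Re s - 2)"
      using x0 by (simp add: x norm_powr_real_powr)
    have 2: "x powr (- Re s - 2) \<le> real n powr (- Re s - 2)"
      using s n x by (intro powr_mono2') auto
    have 3: "norm ((w - of_nat n) * (of_nat n + 1 - w)) = (x - n) * (n + 1 - x)"
    proof -
      have "(w - of_nat n) * (of_nat n + 1 - w) = of_real ((x - n) * (n + 1 - x))" by (simp add: x)
      thus ?thesis using p0 by (simp only: norm_of_real abs_of_nonneg)
    qed
    have "norm (Q' w) = (x - n) * (n + 1 - x) / 2 * (norm (s * (s + 1)) * x powr (- Re s - 2))"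
      unfolding Q'_def norm_mult norm_divide 3[unfolded norm_mult] 1 by simp
    also have "\<dots> \<le> (1 / 4) / 2 * (norm (s * (s + 1)) * real n powr (- Re s - 2))"
      using p p0 2 by (intro mult_mono divide_right_mono mult_left_mono) auto
    finally show ?thesis by simp
  qed
  have "norm (Q (of_nat (Suc n)) - Q (of_nat n)) \<le>
     norm (s * (s + 1)) / 8 * real n powr (- Re s - 2) * norm (of_nat (Suc n) - of_nat n :: complex)"
    by (rule field_differentiable_bound[OF _ deriv bound]) (auto simp: S_def)
  also have "Q (of_nat (Suc n)) - Q (of_nat n) = trapezoid_error n s"
    by (simp add: Q_def trapezoid_error_def diff_divide_distrib add_divide_distrib)
  finally show ?thesis by simp
qed

lemma summable_Suc_powr:
  fixes a :: real assumes "a > 1" shows "summable (\<lambda>n. real (Suc n) powr (-a))"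
  using assms summable_real_powr_iff[of "-a"] by (subst summable_Suc_iff) simp

lemma trapezoid_error_bound':
  assumes s: "Re s \<ge> -c" "c < 1" "s \<noteq> 1"
  shows "norm (trapezoid_error (Suc n) s) \<le> norm (s * (s + 1)) / 8 * real (Suc n) powr (-(2-c))"
proof -
  have "norm (trapezoid_error (Suc n) s) \<le> norm (s * (s + 1)) / 8 * real (Suc n) powr (- Re s - 2)"
    using s by (intro trapezoid_error_bound) auto
  also have "\<dots> \<le> norm (s * (s + 1)) / 8 * real (Suc n) powr (-(2-c))"
    using s by (intro mult_left_mono powr_mono) auto
  finally show ?thesis .
qed

lemma summable_trapezoid_error:
  assumes s: "Re s > -1" "s \<noteq> 1"
  shows "summable (\<lambda>n. trapezoid_error (Suc n) s)"
proof (rule summable_comparison_test', rule summable_mult)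
  define c where "c = - Re s"
  show "summable (\<lambda>n. real (Suc n) powr (-(2-c)))" by (rule summable_Suc_powr) (use s in \<open>auto simp: c_def\<close>)
  show "norm (trapezoid_error (Suc n) s) \<le> norm (s * (s + 1)) / 8 * real (Suc n) powr (-(2-c))" for n
    by (rule trapezoid_error_bound') (use s in \<open>auto simp: c_def\<close>)
qed

text \<open>
  Polynomial growth in every half-plane \<open>Re s \<ge> -c\<close> with \<open>c < 1\<close>; this is what makes the integrals over
  horizontal segments vanish later.
\<close>

lemma zeta_cont_bound:
  assumes c: "c < 1"
  shows "\<exists>C. \<forall>s. Re s \<ge> -c \<longrightarrow> s \<noteq> 1 \<longrightarrow> norm (zeta_cont s - 1 / (s - 1)) \<le> 1 / 2 + C * norm (s * (s + 1))"
proof (intro exI allI impI)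
  fix s assume s: "Re s \<ge> -c" "s \<noteq> 1"
  have sm: "summable (\<lambda>n. norm (s * (s + 1)) / 8 * real (Suc n) powr (-(2-c)))"
    by (intro summable_mult summable_Suc_powr) (use c in auto)
  have "norm (\<Sum>n. trapezoid_error (Suc n) s) \<le> (\<Sum>n. norm (s * (s + 1)) / 8 * real (Suc n) powr (-(2-c)))"
    by (rule norm_suminf_le[OF trapezoid_error_bound' sm]) (use s c in auto)
  also have "\<dots> = norm (s * (s + 1)) / 8 * (\<Sum>n. real (Suc n) powr (-(2-c)))"
    by (rule suminf_mult) (use summable_Suc_powr[of "2-c"] c in auto)
  finally have "norm (\<Sum>n. trapezoid_error (Suc n) s) \<le> (\<Sum>n. real (Suc n) powr (-(2-c))) / 8 * norm (s * (s + 1))"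
    by (simp add: field_simps)
  moreover have "zeta_cont s - 1 / (s - 1) = 1 / 2 + (\<Sum>n. trapezoid_error (Suc n) s)" by (simp add: zeta_cont_def)
  moreover have "norm (1 / 2 + (\<Sum>n. trapezoid_error (Suc n) s)) \<le> norm (1/2 :: complex) + norm (\<Sum>n. trapezoid_error (Suc n) s)"
    by (rule norm_triangle_ineq)
  ultimately show "norm (zeta_cont s - 1 / (s - 1)) \<le> 1 / 2 + (\<Sum>n. real (Suc n) powr (-(2-c))) / 8 * norm (s * (s + 1))"
    by simp
qed

lemma holomorphic_zeta_cont: "zeta_cont holomorphic_on {s. Re s > -1} - {1}"
proof -
  let ?S = "{s. Re s > -1} - {1 :: complex}"
  have op: "open ?S" by (intro open_Diff open_halfspace_Re_gt) auto
  have "(\<lambda>s. \<Sum>n. trapezoid_error (Suc n) s) holomorphic_on ?S"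
  proof (rule holomorphic_uniform_sequence[OF op])
    show "(\<lambda>s. \<Sum>n<N. trapezoid_error (Suc n) s) holomorphic_on ?S" for N
      unfolding trapezoid_error_def by (intro holomorphic_intros) auto
  next
    fix x assume x: "x \<in> ?S"
    obtain d where d: "d > 0" "cball x d \<subseteq> ?S" using op x by (meson open_contains_cball)
    have "compact (Re ` cball x d)" by (intro compact_continuous_image continuous_intros) auto
    then obtain m where m: "m \<in> Re ` cball x d" "\<And>y. y \<in> Re ` cball x d \<Longrightarrow> m \<le> y"
      using compact_attains_inf[of "Re ` cball x d"] d by force
    have m1: "m > -1" using m(1) d by auto
    have "compact ((\<lambda>s. norm (s * (s + 1))) ` cball x d)" by (intro compact_continuous_image continuous_intros) auto
    then obtain B where B: "\<And>s. s \<in> cball x d \<Longrightarrow> norm (s * (s + 1)) \<le> B"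
      by (meson bounded_imp_bdd_above bdd_above.E compact_imp_bounded imageI)
    have "uniform_limit (cball x d) (\<lambda>N s. \<Sum>n<N. trapezoid_error (Suc n) s) (\<lambda>s. \<Sum>n. trapezoid_error (Suc n) s) sequentially"
    proof (rule Weierstrass_m_test)
      show "summable (\<lambda>n. B / 8 * real (Suc n) powr (-(2-(-m))))" by (intro summable_mult summable_Suc_powr) (use m1 in auto)
      fix n s assume s: "s \<in> cball x d"
      have "norm (trapezoid_error (Suc n) s) \<le> norm (s * (s + 1)) / 8 * real (Suc n) powr (-(2-(-m)))"
        by (rule trapezoid_error_bound') (use m s d m1 in auto)
      also have "\<dots> \<le> B / 8 * real (Suc n) powr (-(2-(-m)))"
        by (intro mult_right_mono divide_right_mono B s) auto
      finally show "norm (trapezoid_error (Suc n) s) \<le> B / 8 * real (Suc n) powr (-(2-(-m)))" .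
    qed
    thus "\<exists>d. 0 < d \<and> cball x d \<subseteq> ?S \<and> uniform_limit (cball x d) (\<lambda>N s. \<Sum>n<N. trapezoid_error (Suc n) s)
            (\<lambda>s. \<Sum>n. trapezoid_error (Suc n) s) sequentially"
      using d by blast
  qed
  thus ?thesis unfolding zeta_cont_def by (intro holomorphic_intros) auto
qed

lemma zeta_cont_sums:
  assumes s: "Re s > 1"
  shows "(\<lambda>n. 1 / of_nat (Suc n) powr s) sums zeta_cont s"
proof -
  have s1: "s \<noteq> 1" using s by auto
  define a where "a = (\<lambda>n. of_nat (Suc n) powr (-s) :: complex)"
  have "summable a" unfolding a_def
  proof (rule summable_norm_cancel)
    show "summable (\<lambda>n. norm (of_nat (Suc n) powr (-s) :: complex))"
      using summable_Suc_powr[OF s] by (simp add: norm_powr_real_powr del: of_nat_Suc)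
  qed
  then obtain A where A: "a sums A" by blast
  have a0: "a 0 = 1" by (simp add: a_def)
  have A1: "(\<lambda>n. a (Suc n)) sums (A - 1)" using A a0 sums_Suc_iff[of a "A-1"] by simp
  have lim: "(\<lambda>n. of_nat (Suc n) powr (1 - s) / (1 - s)) \<longlonglongrightarrow> (0::complex)"
  proof -
    have "(\<lambda>n. real (Suc n) powr (1 - Re s)) \<longlonglongrightarrow> 0"
      by (rule tendsto_neg_powr[OF _ filterlim_compose[OF filterlim_real_sequentially filterlim_Suc]])
         (use s in auto)
    hence "(\<lambda>n. norm (of_nat (Suc n) powr (1 - s) :: complex)) \<longlonglongrightarrow> 0"
      by (simp add: norm_powr_real_powr del: of_nat_Suc)
    hence "(\<lambda>n. of_nat (Suc n) powr (1 - s) :: complex) \<longlonglongrightarrow> 0" by (rule tendsto_norm_zero_cancel)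
    thus ?thesis using tendsto_divide[of _ 0 _ "\<lambda>_. 1 - s" "1 - s"] s1 by simp
  qed
  have tel: "(\<lambda>n. of_nat (Suc (Suc n)) powr (1 - s) / (1 - s) - of_nat (Suc n) powr (1 - s) / (1 - s)) sums (0 - of_nat (Suc 0) powr (1 - s) / (1 - s))"
    by (rule telescope_sums[OF lim])
  have "(\<lambda>n. (a n + a (Suc n)) / 2 - (of_nat (Suc (Suc n)) powr (1 - s) / (1 - s) - of_nat (Suc n) powr (1 - s) / (1 - s))) sums
     ((A + (A - 1)) / 2 - (0 - of_nat (Suc 0) powr (1 - s) / (1 - s)))"
    by (intro sums_diff sums_divide sums_add A A1 tel)
  hence "(\<lambda>n. trapezoid_error (Suc n) s) sums ((A + (A - 1)) / 2 - (0 - of_nat (Suc 0) powr (1 - s) / (1 - s)))"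
    by (simp add: trapezoid_error_def a_def diff_divide_distrib)
  hence "zeta_cont s = 1 / (s - 1) + 1 / 2 + ((A + (A - 1)) / 2 - (0 - of_nat (Suc 0) powr (1 - s) / (1 - s)))"
    unfolding zeta_cont_def by (simp only: sums_unique[symmetric])
  also have "\<dots> = A" using s1 by (simp add: divide_simps) (simp add: algebra_simps)?
  finally show ?thesis using A by (simp add: a_def powr_minus_divide)
qed

lemma zeta_cont_0: "zeta_cont 0 = - 1 / 2"
  by (simp add: zeta_cont_def trapezoid_error_def del: of_nat_Suc) simp

section \<open>Partial fractions of the cotangent\<close>

text \<open>
  The logarithmic derivative of the reflection formula \<open>sin(\<pi>z) = \<pi> / (\<Gamma>(z) \<Gamma>(1-z))\<close> expresses the
  cotangent by digamma values; the partial fractions are then the difference of two digamma series.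
\<close>

lemma cot_partial_fractions:
  fixes z :: complex
  assumes z: "z \<notin> \<int>"
  shows "(\<lambda>k. 2 * z / ((of_nat k + 1)\<^sup>2 - z\<^sup>2)) sums (1 / z - of_real pi * cos (of_real pi * z) / sin (of_real pi * z))"
proof -
  have z0: "z \<noteq> 0" using z by auto
  have z1: "z \<notin> \<int>\<^sub>\<le>\<^sub>0" "1 - z \<notin> \<int>\<^sub>\<le>\<^sub>0" "1 + z \<noteq> 0" "1 - z \<noteq> 0"
  proof -
    show "z \<notin> \<int>\<^sub>\<le>\<^sub>0" using z by (auto elim!: nonpos_Ints_cases)
    show "1 - z \<notin> \<int>\<^sub>\<le>\<^sub>0"
    proof
      assume "1 - z \<in> \<int>\<^sub>\<le>\<^sub>0"
      hence "1 - (1 - z) \<in> \<int>" by (intro Ints_diff) (auto dest: nonpos_Ints_Int)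
      thus False using z by simp
    qed
    show "1 + z \<noteq> 0" using z by (metis Ints_1 Ints_minus add.commute add_eq_0_iff)
    show "1 - z \<noteq> 0" using z by auto
  qed
  have ne: "of_nat k + 1 + z \<noteq> 0" "of_nat k + 1 - z \<noteq> 0" for k :: nat
  proof -
    show "of_nat k + 1 + z \<noteq> 0"
    proof
      assume "of_nat k + 1 + z = 0"
      hence "z = - of_nat (Suc k)" by (simp add: add_eq_0_iff)
      thus False using z by simp
    qed
    show "of_nat k + 1 - z \<noteq> 0"
    proof
      assume "of_nat k + 1 - z = 0"
      hence "z = of_nat (Suc k)" by (simp add: add.commute)
      thus False using z by (metis Ints_of_nat)
    qed
  qed
  have sin: "sin (of_real pi * z) = of_real pi * (rGamma z * rGamma (1 - z))"
    by (simp add: rGamma_reflection_complex)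
  have "rGamma z \<noteq> 0" "rGamma (1 - z) \<noteq> 0" using z1 by (auto simp: rGamma_eq_zero_iff)
  hence sin0: "sin (of_real pi * z) \<noteq> 0" using sin by simp
  have "((\<lambda>z. sin (of_real pi * z)) has_field_derivative of_real pi * cos (of_real pi * z)) (at z)"
    by (auto intro!: derivative_eq_intros)
  moreover have "((\<lambda>z. of_real pi * (rGamma z * rGamma (1 - z))) has_field_derivative
     of_real pi * (rGamma z * (- rGamma (1 - z) * Digamma (1 - z) * (0 - 1)) + (- rGamma z * Digamma z) * rGamma (1 - z))) (at z)"
  proof (intro DERIV_cmult DERIV_mult' DERIV_chain2[where f = rGamma and g = "\<lambda>z. 1 - z"] DERIV_diff DERIV_const DERIV_ident)
    show "(rGamma has_field_derivative - rGamma (1 - z) * Digamma (1 - z)) (at (1 - z))"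
      by (rule has_field_derivative_rGamma_no_nonpos_int) fact
    show "(rGamma has_field_derivative - rGamma z * Digamma z) (at z)"
      by (rule has_field_derivative_rGamma_no_nonpos_int) fact
  qed
  hence "((\<lambda>z. sin (of_real pi * z)) has_field_derivative
     of_real pi * (rGamma z * (- rGamma (1 - z) * Digamma (1 - z) * (0 - 1)) + (- rGamma z * Digamma z) * rGamma (1 - z))) (at z)"
    by (simp only: rGamma_reflection_complex) simp
  ultimately have "of_real pi * cos (of_real pi * z) =
     of_real pi * (rGamma z * (- rGamma (1 - z) * Digamma (1 - z) * (0 - 1)) + (- rGamma z * Digamma z) * rGamma (1 - z))"
    by (rule DERIV_unique)
  also have "\<dots> = sin (of_real pi * z) * (Digamma (1 - z) - Digamma z)"
    unfolding sin by (simp add: algebra_simps)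
  finally have cot: "of_real pi * cos (of_real pi * z) / sin (of_real pi * z) = Digamma (1 - z) - Digamma z"
    using sin0 by (simp add: field_simps)
  have D: "(\<lambda>k. inverse (of_nat (Suc k)) - inverse (w + of_nat k)) sums (Digamma w + euler_mascheroni)" if "w \<noteq> 0" for w :: complex
    using summable_sums[OF summable_Digamma[OF that]] by (simp add: Digamma_def)
  have "(\<lambda>k. (inverse (of_nat (Suc k)) - inverse (1 + z + of_nat k)) - (inverse (of_nat (Suc k)) - inverse (1 - z + of_nat k))) sums
     ((Digamma (1 + z) + euler_mascheroni) - (Digamma (1 - z) + euler_mascheroni))"
    by (intro sums_diff D z1)
  also have "(\<lambda>k. (inverse (of_nat (Suc k)) - inverse (1 + z + of_nat k)) - (inverse (of_nat (Suc k)) - inverse (1 - z + of_nat k))) =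
     (\<lambda>k. 2 * z / ((of_nat k + 1)\<^sup>2 - z\<^sup>2))" (is "?l = ?r")
  proof
    fix k :: nat
    define A where "A = of_nat k + 1 + z"
    define B where "B = of_nat k + 1 - z"
    have AB: "A \<noteq> 0" "B \<noteq> 0" using ne[of k] by (auto simp: A_def B_def)
    have "?l k = 1 / B - 1 / A" by (simp add: A_def B_def inverse_eq_divide algebra_simps)
    also have "\<dots> = (A - B) / (A * B)" using AB by (simp add: field_simps)
    also have "A - B = 2 * z" by (simp add: A_def B_def)
    also have "A * B = (of_nat k + 1)\<^sup>2 - z\<^sup>2" by (simp add: A_def B_def power2_eq_square algebra_simps)
    finally show "?l k = ?r k" .
  qed
  also have "((Digamma (1 + z) + euler_mascheroni) - (Digamma (1 - z) + euler_mascheroni)) = 1 / z - (Digamma (1 - z) - Digamma z)"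
    using Digamma_plus1[OF z0] by (simp add: add.commute)
  finally show ?thesis by (simp add: cot)
qed

text \<open>
  The cotangent expansion at the imaginary point \<open>z = iy/2\<pi>\<close>, where the cotangent becomes
  \<open>1 + 2/(e\<^sup>y-1)\<close> up to a constant factor.
\<close>

lemma coth_partial_fractions:
  fixes y :: real assumes y: "y > 0"
  shows "(\<lambda>m. 2 / (y\<^sup>2 + (2 * pi * real (Suc m))\<^sup>2)) sums ((1 / (exp y - 1) + 1 / 2 - 1 / y) / y)"
proof -
  define z where "z = \<i> * of_real (y / (2 * pi))"
  have zI: "z \<notin> \<int>"
  proof
    assume "z \<in> \<int>"
    hence "Im z = 0" by (auto elim: Ints_cases)
    thus False using y by (simp add: z_def)
  qed
  have ey: "exp y > 1" using y by simp
  let ?E = "exp (complex_of_real y)"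
  have E1: "?E \<noteq> 1" 
  proof
    assume "?E = 1" hence "complex_of_real (exp y) = of_real 1" by (simp add: exp_of_real)
    thus False using ey by (simp only: of_real_eq_iff)
  qed
  have ipz: "\<i> * (of_real pi * z) = - of_real (y / 2)" by (simp add: z_def)
  have h: "?E = exp (of_real (y/2)) * exp (of_real (y/2))" by (simp flip: exp_add)
  define e where "e = exp (complex_of_real (y / 2))"
  have e0: "e \<noteq> 0" by (simp add: e_def)
  have Ee: "?E = e * e" by (simp add: h e_def)
  define q where "q = ?E"
  have q: "q = e * e" "q \<noteq> 1" using Ee E1 by (simp_all add: q_def)
  have ex: "exp (\<i> * (of_real pi * z)) = 1 / e" "exp (- (\<i> * (of_real pi * z))) = e"
    unfolding ipz e_def by (simp_all add: exp_minus field_simps)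
  have "sin (of_real pi * z) = (1 - q) / (2 * \<i> * e)"
    unfolding sin_exp_eq ex q using e0 by (simp add: field_simps)
  moreover have "cos (of_real pi * z) = (1 + q) / (2 * e)"
    unfolding cos_exp_eq ex q using e0 by (simp add: field_simps)
  ultimately have "of_real pi * cos (of_real pi * z) / sin (of_real pi * z) =
      of_real pi * ((1 + q) / (2 * e)) / ((1 - q) / (2 * \<i> * e))" by simp
  also have "\<dots> = - \<i> * of_real pi * (1 + 2 / (q - 1))"
    using e0 q(2) by (simp add: divide_simps) (simp add: algebra_simps)
  finally have cot: "of_real pi * cos (of_real pi * z) / sin (of_real pi * z) = - \<i> * of_real pi * (1 + 2 / (?E - 1))"
    unfolding q_def .
  have "(\<lambda>k. 2 * z / ((of_nat k + 1)\<^sup>2 - z\<^sup>2) * (\<i> / (2 * of_real pi * of_real y))) sums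
     ((1 / z - of_real pi * cos (of_real pi * z) / sin (of_real pi * z)) * (\<i> / (2 * of_real pi * of_real y)))"
    by (intro sums_mult2 cot_partial_fractions zI)
  hence "(\<lambda>k. - (2 * z / ((of_nat k + 1)\<^sup>2 - z\<^sup>2) * (\<i> / (2 * of_real pi * of_real y)))) sums
     - ((1 / z - of_real pi * cos (of_real pi * z) / sin (of_real pi * z)) * (\<i> / (2 * of_real pi * of_real y)))"
    by (rule sums_minus)
  also have "(\<lambda>k. - (2 * z / ((of_nat k + 1)\<^sup>2 - z\<^sup>2) * (\<i> / (2 * of_real pi * of_real y)))) =
      (\<lambda>m. complex_of_real (2 / (y\<^sup>2 + (2 * pi * real (Suc m))\<^sup>2)))"
  proof
    fix k :: nat
    have "(of_nat k + 1)\<^sup>2 - z\<^sup>2 = complex_of_real ((y\<^sup>2 + (2 * pi * real (Suc k))\<^sup>2) / (4 * pi\<^sup>2))"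
      by (simp add: z_def power2_eq_square) (simp add: field_simps)
    hence "- (2 * z / ((of_nat k + 1)\<^sup>2 - z\<^sup>2) * (\<i> / (2 * of_real pi * of_real y))) = 
       complex_of_real (2 * (y / (2 * pi)) / ((y\<^sup>2 + (2 * pi * real (Suc k))\<^sup>2) / (4 * pi\<^sup>2)) / (2 * pi * y))"
      by (simp add: z_def)
    also have "2 * (y / (2 * pi)) / ((y\<^sup>2 + (2 * pi * real (Suc k))\<^sup>2) / (4 * pi\<^sup>2)) / (2 * pi * y) = 2 / (y\<^sup>2 + (2 * pi * real (Suc k))\<^sup>2)"
    proof -
      define D where "D = y\<^sup>2 + (2 * pi * real (Suc k))\<^sup>2"
      have "D > 0" unfolding D_def using y by (intro add_pos_nonneg) auto
      thus ?thesis unfolding D_def[symmetric] using y by (simp add: field_simps power2_eq_square)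
    qed
    finally show "- (2 * z / ((of_nat k + 1)\<^sup>2 - z\<^sup>2) * (\<i> / (2 * of_real pi * of_real y))) = complex_of_real (2 / (y\<^sup>2 + (2 * pi * real (Suc k))\<^sup>2))" .
  qed
  also have "- ((1 / z - of_real pi * cos (of_real pi * z) / sin (of_real pi * z)) * (\<i> / (2 * of_real pi * of_real y))) =
     complex_of_real ((1 / (exp y - 1) + 1 / 2 - 1 / y) / y)"
  proof -
    have 1: "1 / z = - \<i> * of_real (2 * pi / y)" using y by (simp add: z_def field_simps)
    have "- ((1 / z - of_real pi * cos (of_real pi * z) / sin (of_real pi * z)) * (\<i> / (2 * of_real pi * of_real y))) =
       ((1 / (?E - 1) + 1 / 2 - 1 / of_real y) / of_real y)"
      unfolding cot 1 using y E1 by (simp add: divide_simps) (simp add: algebra_simps)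
    thus ?thesis by (simp add: exp_of_real)
  qed
  finally show ?thesis by (simp only: sums_of_real_iff)
qed

section \<open>The functional equation of the zeta function\<close>

lemma Gamma_scaled_nn_integral:
  fixes a x :: real assumes a: "a > 0" and x: "x > 0"
  shows "(\<integral>\<^sup>+y. ennreal (indicator {0<..} y * (y powr (a - 1) * exp (- (x * y)))) \<partial>lborel) = ennreal (Gamma a * x powr (-a))"
proof -
  have "(\<integral>\<^sup>+y. ennreal (indicator {0<..} y * (y powr (a - 1) * exp (- (x * y)))) \<partial>lborel) =
     ennreal \<bar>1/x\<bar> * (\<integral>\<^sup>+y. ennreal (indicator {0<..} (0 + (1/x) * y) * ((0 + (1/x) * y) powr (a - 1) * exp (- (x * (0 + (1/x) * y))))) \<partial>lborel)"
    by (rule nn_integral_real_affine) (use x in auto)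
  also have "(\<integral>\<^sup>+y. ennreal (indicator {0<..} (0 + (1/x) * y) * ((0 + (1/x) * y) powr (a - 1) * exp (- (x * (0 + (1/x) * y))))) \<partial>lborel)
    = (\<integral>\<^sup>+y. ennreal (x powr (1 - a)) * ennreal (indicator {0..} y * y powr (a - 1) / exp y) \<partial>lborel)"
  proof (intro nn_integral_cong)
    fix y :: real
    have "indicator {0<..} (0 + (1/x) * y) * ((0 + (1/x) * y) powr (a - 1) * exp (- (x * (0 + (1/x) * y))))
       = x powr (1 - a) * (indicator {0..} y * y powr (a - 1) / exp y)"
    proof (cases "y > 0")
      case True
      have "(y / x) powr (a - 1) = y powr (a - 1) * x powr (1 - a)"
        using True x by (simp add: powr_divide powr_diff field_simps)
      thus ?thesis using True x by (simp add: exp_minus field_simps)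
    next
      case False
      hence "y = 0 \<or> y < 0" by auto
      thus ?thesis using x by (auto simp: indicator_def zero_less_divide_iff)
    qed
    thus "ennreal (indicator {0<..} (0 + (1/x) * y) * ((0 + (1/x) * y) powr (a - 1) * exp (- (x * (0 + (1/x) * y))))) =
       ennreal (x powr (1 - a)) * ennreal (indicator {0..} y * y powr (a - 1) / exp y)"
      by (simp only:) (rule ennreal_mult, auto)
  qed
  also have "\<dots> = ennreal (x powr (1 - a)) * ennreal (Gamma a)"
    by (subst nn_integral_cmult) (simp_all add: Gamma_conv_nn_integral_real[OF a])
  also have "ennreal \<bar>1/x\<bar> * (ennreal (x powr (1 - a)) * ennreal (Gamma a)) = ennreal (Gamma a * x powr (-a))"
  proof -
    have "1 / x * (x powr (1 - a) * Gamma a) = Gamma a * x powr (-a)"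
      using x by (simp add: powr_diff powr_minus field_simps)
    thus ?thesis using x a by (simp flip: ennreal_mult add: Gamma_real_nonneg)
  qed
  finally show ?thesis .
qed

text \<open>
  The Peano kernel form of the error of the trapezoidal rule on \<open>[c, c+1]\<close>, by integrating by parts
  twice. At the end points \<open>f'\<close> may be singular as long as \<open>(x-c)(c+1-x) f'(x)\<close> stays continuous; the
  function \<open>x\<^bsup>a-1\<^esup>\<close> at \<open>0\<close> needs this.
\<close>

lemma trapezoid_rule_has_integral:
  fixes f f' f'' F :: "real \<Rightarrow> real" and c :: real
  assumes F: "continuous_on {c..c+1} F" "\<And>x. x \<in> {c<..<c+1} \<Longrightarrow> (F has_real_derivative f x) (at x)"
    and f: "continuous_on {c..c+1} f" "\<And>x. x \<in> {c<..<c+1} \<Longrightarrow> (f has_real_derivative f' x) (at x)"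
    and f': "continuous_on {c..c+1} (\<lambda>x. (x - c) * (c + 1 - x) * f' x)" "\<And>x. x \<in> {c<..<c+1} \<Longrightarrow> (f' has_real_derivative f'' x) (at x)"
  shows "((\<lambda>x. (x - c) * (c + 1 - x) / 2 * f'' x) has_integral
           (f c + f (c + 1)) / 2 - (F (c + 1) - F c)) {c..c+1}"
proof -
  define Q where "Q = (\<lambda>x. (x - c) * (c + 1 - x) * f' x / 2 - (2 * c + 1 - 2 * x) / 2 * f x - F x)"
  have "((\<lambda>x. (x - c) * (c + 1 - x) / 2 * f'' x) has_integral Q (c + 1) - Q c) {c..c+1}"
  proof (rule fundamental_theorem_of_calculus_interior)
    show "continuous_on {c..c+1} Q" unfolding Q_def by (intro continuous_intros F f f') auto
    fix x assume x: "x \<in> {c<..<c+1}"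
    have "(Q has_real_derivative
        ((((x - c) * (c + 1 - x)) * f'' x + (2 * c + 1 - 2 * x) * f' x) / 2
        - ((2 * c + 1 - 2 * x) / 2 * f' x + -1 * f x) - f x)) (at x)"
      unfolding Q_def
      by (intro DERIV_diff DERIV_cdivide DERIV_mult' F f f' x) (auto intro!: derivative_eq_intros)
    also have "((((x - c) * (c + 1 - x)) * f'' x + (2 * c + 1 - 2 * x) * f' x) / 2
        - ((2 * c + 1 - 2 * x) / 2 * f' x + -1 * f x) - f x) = (x - c) * (c + 1 - x) / 2 * f'' x" by (simp add: field_simps)
    finally show "(Q has_vector_derivative (x - c) * (c + 1 - x) / 2 * f'' x) (at x)"
      by (simp add: has_real_derivative_iff_has_vector_derivative)
  qed simp
  also have "Q (c + 1) - Q c = (f c + f (c + 1)) / 2 - (F (c + 1) - F c)" by (simp add: Q_def field_simps)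
  finally show ?thesis .
qed

text \<open>
  The trapezoidal rule error on \<open>[n, n+1]\<close> of \<open>e\<^bsup>-xy\<^esup> / y\<^sup>2\<close>, whose second derivative is \<open>e\<^bsup>-xy\<^esup>\<close>.
\<close>

definition exp_trapezoid_error :: "nat \<Rightarrow> real \<Rightarrow> real" where
  "exp_trapezoid_error n y = ((exp (- (real n * y)) + exp (- (real (Suc n) * y))) / 2 - (exp (- (real n * y)) - exp (- (real (Suc n) * y))) / y) / y\<^sup>2"

text \<open>
  The trapezoidal rule error on \<open>[n, n+1]\<close> of \<open>x\<^sup>a / (a(a-1))\<close>, whose second derivative is \<open>x\<^bsup>a-2\<^esup>\<close>. It is
  \<open>trapezoid_error n (-a)\<close> up to the negative factor \<open>-a(1-a)\<close>; this normalisation makes it nonnegative,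
  so that sums and integrals can be interchanged in \<open>[0, \<infinity>]\<close>.
\<close>

definition powr_trapezoid_error :: "nat \<Rightarrow> real \<Rightarrow> real" where
  "powr_trapezoid_error n a = ((real (Suc n) powr (a + 1) - real n powr (a + 1)) / (a + 1) - (real n powr a + real (Suc n) powr a) / 2) / (a * (1 - a))"

lemma exp_trapezoid_error_has_integral:
  assumes y: "y > 0"
  shows "((\<lambda>x. (x - real n) * (real n + 1 - x) / 2 * exp (- (x * y))) has_integral exp_trapezoid_error n y) {real n..real n + 1}"
proof -
  have "((\<lambda>x. (x - real n) * (real n + 1 - x) / 2 * exp (- (x * y))) has_integral
    ((exp (- (real n * y)) / y\<^sup>2 + exp (- ((real n + 1) * y)) / y\<^sup>2) / 2 - (- exp (- ((real n + 1) * y)) / y^3 - - exp (- (real n * y)) / y^3))) {real n..real n + 1}"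
    by (rule trapezoid_rule_has_integral[where F = "\<lambda>x. - exp (- (x * y)) / y^3" and f = "\<lambda>x. exp (- (x * y)) / y\<^sup>2" and f' = "\<lambda>x. - exp (- (x * y)) / y"])
       (use y in \<open>auto intro!: derivative_eq_intros continuous_intros simp: field_simps power2_eq_square power3_eq_cube\<close>)
  also have "(exp (- (real n * y)) / y\<^sup>2 + exp (- ((real n + 1) * y)) / y\<^sup>2) / 2 - (- exp (- ((real n + 1) * y)) / y^3 - - exp (- (real n * y)) / y^3) = exp_trapezoid_error n y"
    using y by (simp add: exp_trapezoid_error_def field_simps power2_eq_square power3_eq_cube)
  finally show ?thesis .
qed

lemma powr_trapezoid_error_has_integral:
  assumes a: "0 < a" "a < 1"
  shows "((\<lambda>x. (x - real n) * (real n + 1 - x) / 2 * x powr (a - 2)) has_integral powr_trapezoid_error n a) {real n..real n + 1}"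
proof -
  let ?f' = "\<lambda>x. x powr (a - 1) / (a - 1)"
  have cont: "continuous_on {real n..real n + 1} (\<lambda>x. (x - real n) * (real n + 1 - x) * (x powr (a - 1) / (a - 1)))"
  proof (cases "n = 0")
    case False
    thus ?thesis using a by (intro continuous_intros) auto
  next
    case True
    have "continuous_on {real n..real n + 1} (\<lambda>x. (1 - x) * (x powr a / (a - 1)))"
      using a True by (intro continuous_intros continuous_on_powr') auto
    also have "?this \<longleftrightarrow> ?thesis"
    proof (rule continuous_on_cong, rule refl)
      fix x assume "x \<in> {real n..real n + 1}"
      hence "x = 0 \<or> x > 0" using True by auto
      thus "(1 - x) * (x powr a / (a - 1)) = (x - real n) * (real n + 1 - x) * (x powr (a - 1) / (a - 1))"
        using True by (auto simp: powr_diff)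
    qed
    finally show ?thesis .
  qed
  have d: "((\<lambda>x. x powr b) has_real_derivative b * x powr (b - 1)) (at x)" if "x > 0" for x b :: real
    using that by (rule has_real_derivative_powr)
  have "((\<lambda>x. (x - real n) * (real n + 1 - x) / 2 * x powr (a - 2)) has_integral
    ((real n powr a / (a * (a - 1)) + (real n + 1) powr a / (a * (a - 1))) / 2
      - ((real n + 1) powr (a + 1) / ((a + 1) * (a * (a - 1))) - real n powr (a + 1) / ((a + 1) * (a * (a - 1)))))) {real n..real n + 1}"
  proof (rule trapezoid_rule_has_integral[where F = "\<lambda>x. x powr (a + 1) / ((a + 1) * (a * (a - 1)))"
       and f = "\<lambda>x. x powr a / (a * (a - 1))" and f' = "\<lambda>x. x powr (a - 1) / (a - 1)"], goal_cases)
    case (2 x)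
    hence "x > 0" by (auto intro: le_less_trans[of 0 "real n"])
    from DERIV_cdivide[OF d[OF this, of "a + 1"], of "(a + 1) * (a * (a - 1))"] a
    show ?case by simp
  next
    case (4 x)
    hence "x > 0" by (auto intro: le_less_trans[of 0 "real n"])
    from DERIV_cdivide[OF d[OF this, of "a"], of "a * (a - 1)"] a
    show ?case by simp
  next
    case 5 show ?case using cont .
  next
    case (6 x)
    hence "x > 0" by (auto intro: le_less_trans[of 0 "real n"])
    from DERIV_cdivide[OF d[OF this, of "a - 1"], of "a - 1"] a
    show ?case by simp
  qed (use a in \<open>auto intro!: continuous_intros continuous_on_powr'\<close>)
  also have "((real n powr a / (a * (a - 1)) + (real n + 1) powr a / (a * (a - 1))) / 2
      - ((real n + 1) powr (a + 1) / ((a + 1) * (a * (a - 1))) - real n powr (a + 1) / ((a + 1) * (a * (a - 1))))) = powr_trapezoid_error n a"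
  proof -
    define A where "A = real n powr a" define B where "B = real (Suc n) powr a"
    define C where "C = real n powr (a + 1)" define D where "D = real (Suc n) powr (a + 1)"
    have S: "real n + 1 = real (Suc n)" by simp
    show ?thesis unfolding powr_trapezoid_error_def S A_def[symmetric] B_def[symmetric] C_def[symmetric] D_def[symmetric]
      using a by (simp add: divide_simps) (simp add: algebra_simps)
  qed
  finally show ?thesis .
qed

lemma exp_trapezoid_error_nonneg: "y > 0 \<Longrightarrow> exp_trapezoid_error n y \<ge> 0"
  by (rule has_integral_nonneg[OF exp_trapezoid_error_has_integral]) auto

lemma powr_trapezoid_error_nonneg: "0 < a \<Longrightarrow> a < 1 \<Longrightarrow> powr_trapezoid_error n a \<ge> 0"
  by (rule has_integral_nonneg[OF powr_trapezoid_error_has_integral]) auto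

text \<open>
  Writing \<open>\<Gamma>(2-a) x\<^bsup>a-2\<^esup>\<close> as the Laplace integral \<open>\<integral> y\<^bsup>1-a\<^esup> e\<^bsup>-xy\<^esup> dy\<close> reduces the error for a power to the
  errors for exponentials, which can be summed in closed form.
\<close>

lemma Gamma_powr_trapezoid_error:
  assumes a: "0 < a" "a < 1"
  shows "ennreal (Gamma (2 - a)) * ennreal (powr_trapezoid_error n a) =
    (\<integral>\<^sup>+y. ennreal (indicator {0<..} y * y powr (1 - a)) * ennreal (exp_trapezoid_error n y) \<partial>lborel)"
proof -
  let ?w = "\<lambda>x::real. indicator {real n..real n + 1} x * ((x - real n) * (real n + 1 - x) / 2)"
  let ?h = "\<lambda>x y. ennreal (?w x) * ennreal (indicator {0<..} y * (y powr (1 - a) * exp (- (x * y))))"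
  have G: "Gamma (2 - a) > 0" using a by auto
  have w: "?w x \<ge> 0" for x :: real by (auto simp: indicator_def)
  have "ennreal (Gamma (2 - a)) * ennreal (powr_trapezoid_error n a) =
     (\<integral>\<^sup>+x. ennreal (Gamma (2 - a)) * ennreal (indicator {real n..real n + 1} x * ((x - real n) * (real n + 1 - x) / 2 * x powr (a - 2))) \<partial>lborel)"
    using nn_integral_has_integral_lebesgue[OF _ powr_trapezoid_error_has_integral[OF a, of n]]
    by (subst nn_integral_cmult) auto
  also have "\<dots> = (\<integral>\<^sup>+x. (\<integral>\<^sup>+y. ?h x y \<partial>lborel) \<partial>lborel)"
  proof (intro nn_integral_cong)
    fix x :: real
    show "ennreal (Gamma (2 - a)) * ennreal (indicator {real n..real n + 1} x * ((x - real n) * (real n + 1 - x) / 2 * x powr (a - 2))) =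
       (\<integral>\<^sup>+y. ?h x y \<partial>lborel)"
    proof (cases "x > 0")
      case True
      have "(\<integral>\<^sup>+y. ?h x y \<partial>lborel) = ennreal (?w x) * (\<integral>\<^sup>+y. ennreal (indicator {0<..} y * (y powr (1 - a) * exp (- (x * y)))) \<partial>lborel)"
        by (rule nn_integral_cmult) simp
      also have "\<dots> = ennreal (?w x) * ennreal (Gamma (2 - a) * x powr (a - 2))"
        using Gamma_scaled_nn_integral[of "2 - a" x] True a by simp
      also have "\<dots> = ennreal (?w x * (Gamma (2 - a) * x powr (a - 2)))"
        by (rule ennreal_mult[symmetric]) (use w[of x] G in auto)
      also have "?w x * (Gamma (2 - a) * x powr (a - 2)) = Gamma (2 - a) * (?w x * x powr (a - 2))" by simp
      also have "ennreal (Gamma (2 - a) * (?w x * x powr (a - 2))) = ennreal (Gamma (2 - a)) * ennreal (?w x * x powr (a - 2))"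
        by (rule ennreal_mult) (use w[of x] G in \<open>auto intro!: mult_nonneg_nonneg\<close>)
      finally show ?thesis by (simp only: mult_ac)
    next
      case False
      hence "?w x = 0" by (auto simp: indicator_def)
      thus ?thesis by (auto simp: indicator_def)
    qed
  qed
  also have "\<dots> = (\<integral>\<^sup>+y. (\<integral>\<^sup>+x. ?h x y \<partial>lborel) \<partial>lborel)"
    by (rule lborel_pair.Fubini'[symmetric]) simp
  also have "\<dots> = (\<integral>\<^sup>+y. ennreal (indicator {0<..} y * y powr (1 - a)) * ennreal (exp_trapezoid_error n y) \<partial>lborel)"
  proof (intro nn_integral_cong)
    fix y :: real
    show "(\<integral>\<^sup>+x. ?h x y \<partial>lborel) = ennreal (indicator {0<..} y * y powr (1 - a)) * ennreal (exp_trapezoid_error n y)"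
    proof (cases "y > 0")
      case True
      have "(\<integral>\<^sup>+x. ?h x y \<partial>lborel) = (\<integral>\<^sup>+x. ennreal (indicator {0<..} y * y powr (1 - a)) *
         ennreal (indicator {real n..real n + 1} x * ((x - real n) * (real n + 1 - x) / 2 * exp (- (x * y)))) \<partial>lborel)"
      proof (intro nn_integral_cong)
        fix x :: real
        have "?h x y = ennreal (?w x * (indicator {0<..} y * (y powr (1 - a) * exp (- (x * y)))))"
          by (rule ennreal_mult[symmetric]) (use w in auto)
        also have "\<dots> = ennreal ((indicator {0<..} y * y powr (1 - a)) * (?w x * exp (- (x * y))))"
          by (simp only: mult_ac)
        also have "\<dots> = ennreal (indicator {0<..} y * y powr (1 - a)) * ennreal (?w x * exp (- (x * y)))"
          by (rule ennreal_mult) (use w[of x] in \<open>auto intro!: mult_nonneg_nonneg\<close>)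
        finally show "?h x y = ennreal (indicator {0<..} y * y powr (1 - a)) *
         ennreal (indicator {real n..real n + 1} x * ((x - real n) * (real n + 1 - x) / 2 * exp (- (x * y))))"
          by (simp only: mult_ac)
      qed
      also have "\<dots> = ennreal (indicator {0<..} y * y powr (1 - a)) * ennreal (exp_trapezoid_error n y)"
        using nn_integral_has_integral_lebesgue[OF _ exp_trapezoid_error_has_integral[OF True, of n]]
        by (subst nn_integral_cmult) auto
      finally show ?thesis .
    qed simp
  qed
  finally show ?thesis .
qed

text \<open>
  The sum includes the interval \<open>[0,1]\<close>; this is where the kernel \<open>1/(e\<^sup>y-1) + 1/2 - 1/y\<close> of the Mellin
  transform comes from.
\<close>

lemma exp_trapezoid_error_sums:
  assumes y: "y > 0"
  shows "(\<lambda>n. exp_trapezoid_error n y) sums ((1 / (exp y - 1) + 1 / 2 - 1 / y) / y\<^sup>2)"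
proof -
  define q where "q = exp (-y)"
  have q: "norm q < 1" "q > 0" using y by (auto simp: q_def)
  have e: "exp (- (real n * y)) = q ^ n" for n by (simp add: q_def exp_of_nat_mult[symmetric])
  have "(\<lambda>n. ((q ^ n + q * q ^ n) / 2 - (q ^ n - q * q ^ n) / y) / y\<^sup>2) sums
     (((1 / (1 - q) + q * (1 / (1 - q))) / 2 - (1 / (1 - q) - q * (1 / (1 - q))) / y) / y\<^sup>2)"
    by (intro sums_divide sums_diff sums_add sums_mult geometric_sums q)
  also have "(\<lambda>n. ((q ^ n + q * q ^ n) / 2 - (q ^ n - q * q ^ n) / y) / y\<^sup>2) = (\<lambda>n. exp_trapezoid_error n y)"
    unfolding exp_trapezoid_error_def e by simp
  also have "((1 / (1 - q) + q * (1 / (1 - q))) / 2 - (1 / (1 - q) - q * (1 / (1 - q))) / y) = 1 / (exp y - 1) + 1 / 2 - 1 / y"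
  proof -
    have "exp y = 1 / q" by (simp add: q_def exp_minus field_simps)
    thus ?thesis using y q by (simp add: divide_simps) (simp add: algebra_simps)
  qed
  finally show ?thesis .
qed

text \<open>
  The substitution \<open>t = y\<^sup>2/(y\<^sup>2+c\<^sup>2)\<close> reduces this to the Beta integral \<open>B(b, 1-b) = \<pi>/sin(\<pi>b)\<close> with
  \<open>b = (1-a)/2\<close>.
\<close>

lemma nn_integral_powr_over_quadratic:
  fixes a c :: real assumes a: "0 < a" "a < 1" and c: "c > 0"
  shows "(\<integral>\<^sup>+y. ennreal (indicator {0<..} y * (y powr (-a) * (2 / (y\<^sup>2 + c\<^sup>2)))) \<partial>lborel) =
    ennreal (pi / cos (pi * a / 2) * c powr (-(1 + a)))"
proof -
  define b where "b = (1 - a) / 2"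
  have b: "b > 0" "1 - b > 0" "2 * b = 1 - a" using a by (auto simp: b_def field_simps)
  have Beta: "Beta b (1 - b) = pi / cos (pi * a / 2)"
  proof -
    have "complex_of_real (Beta b (1 - b)) = Gamma (of_real b) * Gamma (1 - of_real b)"
    proof -
      have "Beta b (1 - b) = Gamma b * Gamma (1 - b)" by (simp add: Beta_def)
      thus ?thesis using Gamma_complex_of_real[of "1 - b"] by (simp add: Gamma_complex_of_real)
    qed
    also have "\<dots> = of_real pi / sin (of_real pi * of_real b)" by (rule Gamma_reflection_complex)
    also have "\<dots> = of_real (pi / sin (pi * b))" by (simp only: of_real_mult[symmetric] sin_of_real of_real_divide)
    also have "sin (pi * b) = cos (pi * a / 2)"
      by (simp add: b_def sin_cos_eq) (simp add: field_simps)
    finally show ?thesis by (simp only: of_real_eq_iff)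
  qed
  let ?f = "\<lambda>t. t powr (b - 1) * (1 - t) powr (1 - b - 1)"
  let ?g = "\<lambda>y. y\<^sup>2 / (y\<^sup>2 + c\<^sup>2) :: real"
  let ?h = "\<lambda>y. 2 * y * c\<^sup>2 / (y\<^sup>2 + c\<^sup>2)\<^sup>2 :: real"
  have D: "y\<^sup>2 + c\<^sup>2 > 0" for y using c by (intro add_nonneg_pos) auto
  have img: "?g ` {0<..} = {0<..<1}"
  proof safe
    fix y :: real assume "y > 0"
    thus "?g y \<in> {0<..<1}" using D[of y] c by auto
  next
    fix t :: real assume t: "t \<in> {0<..<1}"
    show "t \<in> ?g ` {0<..}"
    proof (rule image_eqI[of _ _ "c * sqrt (t / (1 - t))"])
      show "t = ?g (c * sqrt (t / (1 - t)))" using t c by (simp add: power_mult_distrib field_simps)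
      show "c * sqrt (t / (1 - t)) \<in> {0<..}" using t c by auto
    qed
  qed
  have inj: "inj_on ?g {0<..}"
  proof (rule inj_onI)
    fix x y :: real assume xy: "x \<in> {0<..}" "y \<in> {0<..}" "?g x = ?g y"
    hence "x\<^sup>2 * (y\<^sup>2 + c\<^sup>2) = y\<^sup>2 * (x\<^sup>2 + c\<^sup>2)" using D[of x] D[of y] by (simp add: field_simps)
    hence "x\<^sup>2 = y\<^sup>2" using c by (simp add: algebra_simps)
    thus "x = y" using xy by (simp add: power2_eq_iff_nonneg)
  qed
  have der: "(?g has_field_derivative ?h y) (at y within {0<..})" if "y \<in> {0<..}" for y
    using D[of y] by (auto intro!: derivative_eq_intros simp: field_simps power2_eq_square)
  have fI: "(?f has_integral Beta b (1 - b)) {0<..<1}"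
    using has_integral_Beta_real[OF b(1,2)] by (simp add: has_integral_Icc_iff_Ioo)
  hence "?f absolutely_integrable_on {0<..<1} \<and> integral {0<..<1} ?f = Beta b (1 - b)"
    by (auto intro!: nonnegative_absolutely_integrable_1 has_integral_integrable)
  hence "(\<lambda>y. \<bar>?h y\<bar> * ?f (?g y)) absolutely_integrable_on {0<..} \<and> integral {0<..} (\<lambda>y. \<bar>?h y\<bar> * ?f (?g y)) = Beta b (1 - b)"
    using has_absolute_integral_change_of_variables_1'[OF _ der inj, of ?f "Beta b (1 - b)"] unfolding img by auto
  hence hI: "((\<lambda>y. \<bar>?h y\<bar> * ?f (?g y)) has_integral Beta b (1 - b)) {0<..}"
    using absolutely_integrable_on_def has_integral_integrable_integral by blast
  have eq: "\<bar>?h y\<bar> * ?f (?g y) = y powr (-a) * (2 / (y\<^sup>2 + c\<^sup>2)) * c powr (1 + a)" if y: "y > 0" for y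
  proof -
    let ?D = "y\<^sup>2 + c\<^sup>2"
    have D0: "?D \<noteq> 0" using D[of y] by linarith
    hence 1: "1 - ?g y = c\<^sup>2 / ?D" by (simp add: divide_simps)
    have sq: "(x\<^sup>2) powr e = x powr (2 * e)" if "x > 0" for x e :: real
    proof -
      have "x\<^sup>2 = x powr 2" using that by (simp add: powr_numeral)
      thus ?thesis by (simp only: powr_powr)
    qed
    note y2 = sq[OF y] and c2 = sq[OF c]
    have "?f (?g y) = (y powr (2 * (b - 1)) / ?D powr (b - 1)) * (c powr (2 * (- b)) / ?D powr (- b))"
      unfolding 1 using y c D[of y] by (simp add: powr_divide y2 c2)
    also have "\<dots> = y powr (2 * (b - 1)) * c powr (2 * (- b)) / (?D powr (b - 1) * ?D powr (- b))" by simp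
    also have "?D powr (b - 1) * ?D powr (- b) = 1 / ?D"
    proof -
      have "?D powr (b - 1) * ?D powr (- b) = ?D powr ((b - 1) + (- b))" by (simp only: powr_add)
      also have "(b - 1) + (- b) = -1" by simp
      finally show ?thesis using D[of y] by (simp add: powr_minus_divide)
    qed
    also have "2 * (b - 1) = - a - 1" using b(3) by (simp only: right_diff_distrib)
    also have "2 * (- b) = (1 + a) - 2" using b(3) by (simp only: mult_minus_right)
    finally have "?f (?g y) = y powr (- a - 1) * c powr ((1 + a) - 2) * ?D" by simp
    moreover have "\<bar>?h y\<bar> = 2 * y * c\<^sup>2 / ?D\<^sup>2" using y by simp
    moreover have "y powr (- a - 1) = y powr (-a) / y" using y by (simp add: powr_diff)
    moreover have "c powr ((1 + a) - 2) = c powr (1 + a) / c\<^sup>2"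
      unfolding powr_diff using c by (simp add: powr_numeral)
    ultimately have "\<bar>?h y\<bar> * ?f (?g y) = 2 * y * c\<^sup>2 / ?D\<^sup>2 * (y powr (-a) / y * (c powr (1 + a) / c\<^sup>2) * ?D)"
      by (simp only:)
    also have "\<dots> = y powr (-a) * (2 / ?D) * c powr (1 + a)"
    proof -
      have "2 * y * C / D\<^sup>2 * (P / y * (R / C) * D) = P * (2 / D) * R" if "C \<noteq> 0" "D \<noteq> 0" for C D P R :: real
        using that y by (simp add: field_simps power2_eq_square)
      thus ?thesis using D0 c by simp
    qed
    finally show ?thesis .
  qed
  have "((\<lambda>y. y powr (-a) * (2 / (y\<^sup>2 + c\<^sup>2)) * c powr (1 + a)) has_integral Beta b (1 - b)) {0<..}"
    using hI by (rule has_integral_eq[rotated]) (use eq in auto)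
  from has_integral_mult_left[OF this, of "c powr (-(1 + a))"]
  have "((\<lambda>y. y powr (-a) * (2 / (y\<^sup>2 + c\<^sup>2))) has_integral Beta b (1 - b) * c powr (-(1 + a))) {0<..}"
    using c by (simp add: mult.assoc flip: powr_add)
  hence "(\<integral>\<^sup>+y. ennreal (indicator {0<..} y * (y powr (-a) * (2 / (y\<^sup>2 + c\<^sup>2)))) \<partial>lborel) = ennreal (Beta b (1 - b) * c powr (-(1 + a)))"
    by (intro nn_integral_has_integral_lebesgue) auto
  thus ?thesis unfolding Beta .
qed

text \<open>
  The functional equation at \<open>s = -a\<close> in disguise: the left-hand side is a multiple of \<open>\<zeta>(-a)\<close>, and the
  partial fractions of the kernel, integrated one by one, give \<open>\<zeta>(1+a)\<close> on the right.
\<close>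

lemma suminf_powr_trapezoid_error:
  assumes a: "0 < a" "a < 1"
  shows "ennreal (Gamma (2 - a)) * (\<Sum>n. ennreal (powr_trapezoid_error n a)) =
    ennreal (pi / cos (pi * a / 2) * (2 * pi) powr (-(1 + a))) * (\<Sum>m. ennreal (real (Suc m) powr (-(1 + a))))"
proof -
  have "ennreal (Gamma (2 - a)) * (\<Sum>n. ennreal (powr_trapezoid_error n a)) = (\<Sum>n. ennreal (Gamma (2 - a)) * ennreal (powr_trapezoid_error n a))"
    by (rule ennreal_suminf_cmult[symmetric])
  also have "\<dots> = (\<Sum>n. \<integral>\<^sup>+y. ennreal (indicator {0<..} y * y powr (1 - a)) * ennreal (exp_trapezoid_error n y) \<partial>lborel)"
    by (simp only: Gamma_powr_trapezoid_error[OF a])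
  also have "\<dots> = (\<integral>\<^sup>+y. (\<Sum>n. ennreal (indicator {0<..} y * y powr (1 - a)) * ennreal (exp_trapezoid_error n y)) \<partial>lborel)"
    by (rule nn_integral_suminf[symmetric]) (simp add: exp_trapezoid_error_def)
  also have "\<dots> = (\<integral>\<^sup>+y. (\<Sum>m. ennreal (indicator {0<..} y * (y powr (-a) * (2 / (y\<^sup>2 + (2 * pi * Suc m)\<^sup>2))))) \<partial>lborel)"
  proof (intro nn_integral_cong)
    fix y :: real
    show "(\<Sum>n. ennreal (indicator {0<..} y * y powr (1 - a)) * ennreal (exp_trapezoid_error n y)) =
          (\<Sum>m. ennreal (indicator {0<..} y * (y powr (-a) * (2 / (y\<^sup>2 + (2 * pi * Suc m)\<^sup>2)))))"
    proof (cases "y > 0")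
      case True
      let ?T = "1 / (exp y - 1) + 1 / 2 - 1 / y"
      have "(\<Sum>n. ennreal (indicator {0<..} y * y powr (1 - a)) * ennreal (exp_trapezoid_error n y)) = ennreal (y powr (1 - a)) * (\<Sum>n. ennreal (exp_trapezoid_error n y))"
        using True by (simp add: ennreal_suminf_cmult)
      also have "(\<Sum>n. ennreal (exp_trapezoid_error n y)) = ennreal (?T / y\<^sup>2)"
        by (rule suminf_ennreal_eq[OF exp_trapezoid_error_nonneg[OF True] exp_trapezoid_error_sums[OF True]])
      also have "ennreal (y powr (1 - a)) * ennreal (?T / y\<^sup>2) = ennreal (y powr (1 - a) * (?T / y\<^sup>2))"
        by (rule ennreal_mult'[symmetric]) simp
      also have "y powr (1 - a) * (?T / y\<^sup>2) = y powr (-a) * (?T / y)"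
        using True by (simp add: powr_diff powr_minus power2_eq_square field_simps)
      also have "ennreal (y powr (-a) * (?T / y)) = (\<Sum>m. ennreal (y powr (-a) * (2 / (y\<^sup>2 + (2 * pi * Suc m)\<^sup>2))))"
        by (rule suminf_ennreal_eq[symmetric, OF _ sums_mult[OF coth_partial_fractions[OF True]]]) auto
      finally show ?thesis using True by simp
    qed simp
  qed
  also have "\<dots> = (\<Sum>m. \<integral>\<^sup>+y. ennreal (indicator {0<..} y * (y powr (-a) * (2 / (y\<^sup>2 + (2 * pi * Suc m)\<^sup>2)))) \<partial>lborel)"
    by (rule nn_integral_suminf) simp
  also have "\<dots> = (\<Sum>m. ennreal (pi / cos (pi * a / 2) * (2 * pi) powr (-(1 + a))) * ennreal (real (Suc m) powr (-(1 + a))))"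
  proof (rule suminf_cong)
    fix m :: nat
    have "cos (pi * a / 2) > 0" using a by (intro cos_gt_zero) (auto simp: field_simps)
    have "(\<integral>\<^sup>+y. ennreal (indicator {0<..} y * (y powr (-a) * (2 / (y\<^sup>2 + (2 * pi * Suc m)\<^sup>2)))) \<partial>lborel) =
        ennreal (pi / cos (pi * a / 2) * (2 * pi * Suc m) powr (-(1 + a)))"
      by (rule nn_integral_powr_over_quadratic) (use a in auto)
    also have "(2 * pi * Suc m) powr (-(1 + a)) = (2 * pi) powr (-(1 + a)) * real (Suc m) powr (-(1 + a))"
      by (rule powr_mult)
    also have "ennreal (pi / cos (pi * a / 2) * ((2 * pi) powr (-(1 + a)) * real (Suc m) powr (-(1 + a)))) =
       ennreal (pi / cos (pi * a / 2) * (2 * pi) powr (-(1 + a))) * ennreal (real (Suc m) powr (-(1 + a)))"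
      unfolding mult.assoc[symmetric] by (rule ennreal_mult'') simp
    finally show "(\<integral>\<^sup>+y. ennreal (indicator {0<..} y * (y powr (-a) * (2 / (y\<^sup>2 + (2 * pi * Suc m)\<^sup>2)))) \<partial>lborel) =
        ennreal (pi / cos (pi * a / 2) * (2 * pi) powr (-(1 + a))) * ennreal (real (Suc m) powr (-(1 + a)))" .
  qed
  also have "\<dots> = ennreal (pi / cos (pi * a / 2) * (2 * pi) powr (-(1 + a))) * (\<Sum>m. ennreal (real (Suc m) powr (-(1 + a))))"
    by (rule ennreal_suminf_cmult)
  finally show ?thesis .
qed

lemma trapezoid_error_neg_real:
  assumes a: "0 < a" "a < 1"
  shows "trapezoid_error n (- of_real a) = of_real (- (a * (1 - a)) * powr_trapezoid_error n a)"
proof -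
  have p: "of_nat n powr complex_of_real b = of_real (real n powr b)" for n b
    by (metis of_nat_0_le_iff of_real_of_nat_eq powr_of_real)
  have "trapezoid_error n (- of_real a) = 
     (of_nat n powr of_real a + of_nat (Suc n) powr of_real a) / 2
     - (of_nat (Suc n) powr of_real (1 + a) - of_nat n powr of_real (1 + a)) / of_real (1 + a)"
    by (simp add: trapezoid_error_def)
  also have "\<dots> = of_real ((real n powr a + real (Suc n) powr a) / 2 - (real (Suc n) powr (1 + a) - real n powr (1 + a)) / (1 + a))"
    unfolding p by simp
  also have "(real n powr a + real (Suc n) powr a) / 2 - (real (Suc n) powr (1 + a) - real n powr (1 + a)) / (1 + a) = - (a * (1 - a)) * powr_trapezoid_error n a"
  proof -
    define A where "A = real n powr a" define B where "B = real (Suc n) powr a"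
    define C where "C = real n powr (1 + a)" define D where "D = real (Suc n) powr (1 + a)"
    define e where "e = 1 + a"
    have e: "e \<noteq> 0" using a by (simp add: e_def)
    have "(A + B) / 2 - (D - C) / e = - (a * (1 - a)) * (((D - C) / e - (A + B) / 2) / (a * (1 - a)))"
      using a by simp
    thus ?thesis unfolding powr_trapezoid_error_def add.commute[of a 1] A_def B_def C_def D_def e_def .
  qed
  finally show ?thesis .
qed

lemma zeta_cont_reflection_real:
  assumes a: "0 < a" "a < 1"
  shows "zeta_cont (- of_real a) = 2 * (2 * of_real pi) powr (- of_real a - 1) * sin (of_real pi * (- of_real a) / 2)
           * Gamma (1 - (- of_real a)) * zeta_cont (1 - (- of_real a))"
proof -
  define s where "s = - complex_of_real a"
  have s: "Re s > -1" "s \<noteq> 1" using a by (auto simp: s_def complex_eq_iff)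
  have a1: "a * (1 - a) \<noteq> 0" using a by simp
  \<comment> \<open>for \<open>Re s < 0\<close> the elementary terms of the continuation are the error on \<open>[0,1]\<close>\<close>
  have T0: "trapezoid_error 0 s = 1 / (s - 1) + 1 / 2"
    using s(2) by (simp add: trapezoid_error_def divide_simps) (simp add: algebra_simps)
  have sm1: "summable (\<lambda>n. trapezoid_error (Suc n) s)" by (rule summable_trapezoid_error) (use s in auto)
  hence smT: "summable (\<lambda>n. trapezoid_error n s)" using summable_Suc_iff[of "\<lambda>n. trapezoid_error n s"] by blast
  from this have "summable (\<lambda>n. complex_of_real (- (a * (1 - a)) * powr_trapezoid_error n a))"
    by (simp only: s_def trapezoid_error_neg_real[OF a])
  hence "summable (\<lambda>n. - (a * (1 - a)) * powr_trapezoid_error n a)" by (simp only: summable_of_real_iff)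
  hence sm: "summable (\<lambda>n. powr_trapezoid_error n a)" using a1 by (subst (asm) summable_cmult_iff) auto
  define S where "S = (\<Sum>n. powr_trapezoid_error n a)"
  have S0: "S \<ge> 0" unfolding S_def by (intro suminf_nonneg sm powr_trapezoid_error_nonneg a)
  have "zeta_cont s = trapezoid_error 0 s + (\<Sum>n. trapezoid_error (Suc n) s)" by (simp add: zeta_cont_def T0)
  also have "\<dots> = (\<Sum>n. trapezoid_error n s)"
    using suminf_split_head[OF smT] by simp
  also have "\<dots> = (\<Sum>n. complex_of_real (- (a * (1 - a)) * powr_trapezoid_error n a))"
    by (simp only: s_def trapezoid_error_neg_real[OF a])
  also have "\<dots> = of_real (- (a * (1 - a)) * S)"
    unfolding S_def by (subst suminf_mult[OF sm, symmetric], rule suminf_of_real[symmetric]) (intro summable_mult sm)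
  finally have Z1: "zeta_cont s = of_real (- (a * (1 - a)) * S)" .
  define Z where "Z = (\<Sum>m. real (Suc m) powr (-(1 + a)))"
  have smZ: "summable (\<lambda>m. real (Suc m) powr (-(1 + a)))" by (rule summable_Suc_powr) (use a in auto)
  have Z0: "Z \<ge> 0" unfolding Z_def by (intro suminf_nonneg smZ) simp
  have "(\<lambda>m. complex_of_real (real (Suc m) powr (-(1 + a)))) sums of_real Z"
    unfolding Z_def by (intro sums_of_real summable_sums smZ)
  also have "(\<lambda>m. complex_of_real (real (Suc m) powr (-(1 + a)))) = (\<lambda>m. 1 / of_nat (Suc m) powr (1 - s))"
  proof
    fix m
    have "complex_of_real (real (Suc m) powr (-(1 + a))) = complex_of_real (real (Suc m)) powr complex_of_real (-(1 + a))"
      by (rule powr_of_real[symmetric]) simp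
    thus "complex_of_real (real (Suc m) powr (-(1 + a))) = 1 / of_nat (Suc m) powr (1 - s)"
      by (simp only: of_real_of_nat_eq s_def powr_minus_divide of_real_minus of_real_add of_real_1) simp
  qed
  finally have Z2: "zeta_cont (1 - s) = of_real Z"
    using zeta_cont_sums[of "1 - s"] a sums_unique2 by (force simp: s_def)
  define c where "c = cos (pi * a / 2)"
  define A where "A = (2 * pi) powr (-(1 + a))"
  have c: "c > 0" unfolding c_def using a by (intro cos_gt_zero) (auto simp: field_simps)
  have e1: "(\<Sum>n. ennreal (powr_trapezoid_error n a)) = ennreal S"
    unfolding S_def by (rule suminf_ennreal2[OF powr_trapezoid_error_nonneg[OF a] sm])
  have e2: "(\<Sum>m. ennreal (real (Suc m) powr (-(1 + a)))) = ennreal Z"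
    unfolding Z_def by (rule suminf_ennreal2[OF _ smZ]) simp
  have G: "Gamma (2 - a) > 0" using a by auto
  have pcA: "pi / c * A \<ge> 0" using c by (simp add: A_def)
  have "ennreal (Gamma (2 - a)) * ennreal S = ennreal (pi / c * A) * ennreal Z"
    using suminf_powr_trapezoid_error[OF a] unfolding e1 e2 A_def c_def .
  hence "ennreal (Gamma (2 - a) * S) = ennreal (pi / c * A * Z)"
    using S0 Z0 G pcA by (simp only: ennreal_mult less_imp_le)
  hence main: "Gamma (2 - a) * S = pi / c * A * Z"
    by (rule ennreal_inj[THEN iffD1, rotated 2]) (intro mult_nonneg_nonneg S0 Z0 pcA less_imp_le[OF G])+
  have refl: "sin (pi * a) * (Gamma (1 + a) * Gamma (2 - a)) = a * (1 - a) * pi"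
  proof -
    have "complex_of_real (Gamma a * Gamma (1 - a)) = of_real (pi / sin (pi * a))"
      using Gamma_reflection_complex[of "of_real a"]
      using Gamma_complex_of_real[of "1 - a"] by (simp add: Gamma_complex_of_real sin_of_real flip: of_real_mult)
    hence "Gamma a * Gamma (1 - a) = pi / sin (pi * a)" by (simp only: of_real_eq_iff)
    moreover have "sin (pi * a) > 0" using a by (intro sin_gt_zero) auto
    moreover have "Gamma (a + 1) = a * Gamma a" by (rule Gamma_plus1) (use a in \<open>auto elim!: nonpos_Ints_cases\<close>)
    moreover have "Gamma ((1 - a) + 1) = (1 - a) * Gamma (1 - a)" by (rule Gamma_plus1) (use a in \<open>auto elim!: nonpos_Ints_cases\<close>)
    moreover have "(1 - a) + 1 = 2 - a" by simp
    ultimately show ?thesis by (simp add: add.commute)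
  qed
  have s2: "sin (pi * a) = 2 * sin (pi * a / 2) * c" using sin_double[of "pi * a / 2"] by (simp add: c_def)
  have "a * (1 - a) * S * (Gamma (2 - a) * c) = a * (1 - a) * (Gamma (2 - a) * S) * c" by simp
  also have "\<dots> = a * (1 - a) * pi * A * Z" using main c by simp
  also have "\<dots> = (2 * sin (pi * a / 2) * A * Gamma (1 + a) * Z) * (Gamma (2 - a) * c)"
    unfolding refl[symmetric] s2 by simp
  finally have "a * (1 - a) * S = 2 * sin (pi * a / 2) * A * Gamma (1 + a) * Z" using c G by simp
  hence "zeta_cont s = of_real (- (2 * sin (pi * a / 2) * A * Gamma (1 + a) * Z))" by (simp only: Z1 minus_mult_left[symmetric])
  also have "\<dots> = 2 * of_real A * sin (of_real pi * s / 2) * Gamma (1 - s) * zeta_cont (1 - s)"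
  proof -
    have "sin (of_real pi * s / 2) = - complex_of_real (sin (pi * a / 2))" using sin_of_real[of "pi * a / 2", where ?'a = complex] by (simp add: s_def)
    moreover have "Gamma (1 - s) = of_real (Gamma (1 + a))" using Gamma_complex_of_real[of "1 + a"] by (simp add: s_def)
    ultimately show ?thesis unfolding Z2 by simp
  qed
  also have "complex_of_real A = (2 * of_real pi) powr (s - 1)"
  proof -
    have "complex_of_real A = complex_of_real (2 * pi) powr complex_of_real (-(1 + a))"
      unfolding A_def by (rule powr_of_real[symmetric]) simp
    moreover have "s - 1 = complex_of_real (-(1 + a))" by (simp add: s_def)
    ultimately show ?thesis by (simp only: of_real_mult of_real_numeral)
  qed
  finally show ?thesis unfolding s_def .
qed

text \<open>
  The functional equation solved for the value in the left half-plane. The form with the sine is free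
  of the removable singularities that \<open>1 / (cos(\<pi>s/2) \<Gamma>(s))\<close> has at negative odd integers.
\<close>

definition zeta_reflected :: "complex \<Rightarrow> complex" where
  "zeta_reflected s = 2 * (2 * of_real pi) powr (s - 1) * sin (of_real pi * s / 2) * Gamma (1 - s) * zeta_cont (1 - s)"

lemma nonpos_Ints_Re_le: "z \<in> \<int>\<^sub>\<le>\<^sub>0 \<Longrightarrow> Re z \<le> 0"
  by (auto elim!: nonpos_Ints_cases)

lemma holomorphic_zeta_reflected: "zeta_reflected holomorphic_on {s. Re s < 0}"
proof -
  have "(zeta_cont \<circ> (\<lambda>s. 1 - s)) holomorphic_on {s. Re s < 0}"
    by (rule holomorphic_on_compose_gen[OF _ holomorphic_zeta_cont]) (auto intro!: holomorphic_intros)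
  moreover have "(Gamma \<circ> (\<lambda>s. 1 - s)) holomorphic_on {s. Re s < 0}"
    by (rule holomorphic_on_compose_gen[of _ _ _ "{s. Re s > 0}"])
       (auto intro!: holomorphic_intros elim!: nonpos_Ints_cases)
  ultimately show ?thesis unfolding zeta_reflected_def o_def
    by (intro holomorphic_intros) (auto dest: nonpos_Ints_Re_le)
qed

lemma zeta_cont_eq_zeta_reflected:
  assumes "-1 < Re s" "Re s < 0"
  shows "zeta_cont s = zeta_reflected s"
proof -
  let ?S = "{s. -1 < Re s \<and> Re s < 0}"
  let ?U = "complex_of_real ` {-1<..<0}"
  have "?S = {s. Re s > -1} \<inter> {s. Re s < 0}" by auto
  hence S: "open ?S" "connected ?S"
    by (simp_all add: open_Int open_halfspace_Re_gt open_halfspace_Re_lt convex_connected convex_Int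
          convex_halfspace_Re_gt convex_halfspace_Re_lt)
  have "zeta_cont s - zeta_reflected s = 0"
  proof (rule analytic_continuation[where f = "\<lambda>s. zeta_cont s - zeta_reflected s", OF _ S])
    show "(\<lambda>s. zeta_cont s - zeta_reflected s) holomorphic_on ?S"
      by (intro holomorphic_intros holomorphic_on_subset[OF holomorphic_zeta_cont] holomorphic_on_subset[OF holomorphic_zeta_reflected]) auto
    show "?U \<subseteq> ?S" by auto
    show "of_real (-1/2) \<in> ?S" by simp
    have "(-1/2 :: real) islimpt {-1<..<0}" by (rule open_imp_islimpt) auto
    moreover have "complex_of_real x islimpt complex_of_real ` A" if "x islimpt A" for x A
      using that by (rule islimpt_isCont_image) (auto simp: eventually_at_filter)
    ultimately show "complex_of_real (-1/2) islimpt ?U" by blast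
    show "zeta_cont z - zeta_reflected z = 0" if "z \<in> ?U" for z
    proof -
      from that obtain x where x: "z = of_real x" "-1 < x" "x < 0" by auto
      thus ?thesis using zeta_cont_reflection_real[of "-x"] by (simp add: zeta_reflected_def)
    qed
  qed (use assms in auto)
  thus ?thesis by simp
qed

text \<open>
  The half-planes \<open>Re s > -1\<close> and \<open>Re s < 0\<close> cover the plane, and the two candidate functions agree on the
  strip where these overlap.
\<close>

lemma zeta_continuation_exists: "\<exists>f. f holomorphic_on (- {1}) \<and> (\<forall>s. Re s > 1 \<longrightarrow> (\<lambda>n. 1 / of_nat (Suc n) powr s) sums f s)"
proof (intro exI conjI allI impI)
  define f where "f = (\<lambda>s. if s \<in> {s. Re s > -1} - {1} then zeta_cont s else zeta_reflected s)"
  have "f holomorphic_on (({s. Re s > -1} - {1}) \<union> {s. Re s < 0})"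
    unfolding f_def
  proof (rule holomorphic_on_If_Un)
    show "open ({s. Re s > -1} - {1 :: complex})" by (intro open_Diff open_halfspace_Re_gt) auto
  qed (auto intro: holomorphic_zeta_cont holomorphic_zeta_reflected open_halfspace_Re_lt zeta_cont_eq_zeta_reflected)
  moreover have "({s. Re s > -1} - {1}) \<union> {s. Re s < 0} = - {1 :: complex}" by auto
  ultimately show "f holomorphic_on - {1}" by simp
  fix s assume s: "Re s > 1"
  hence "f s = zeta_cont s" by (auto simp: f_def)
  thus "(\<lambda>n. 1 / of_nat (Suc n) powr s) sums f s" using zeta_cont_sums[OF s] by simp
qed

lemma holomorphic_zeta: "zeta holomorphic_on (- {1})"
  and zeta_sums: "Re s > 1 \<Longrightarrow> (\<lambda>n. 1 / of_nat (Suc n) powr s) sums zeta s"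
  using someI_ex[OF zeta_continuation_exists] unfolding zeta_def[symmetric] by blast+

lemma zeta_eq_zeta_cont:
  assumes "Re s > -1" "s \<noteq> 1"
  shows "zeta s = zeta_cont s"
proof (rule analytic_continuation_open[of "{s. Re s > 1}" "{s. Re s > -1} - {1}" zeta zeta_cont])
  show "{s. Re s > 1} \<noteq> {}" by (auto intro!: exI[of _ 2])
  show "connected ({s. Re s > -1} - {1 :: complex})"
    by (intro connected_open_delete open_halfspace_Re_gt convex_connected convex_halfspace_Re_gt) auto
  show "zeta z = zeta_cont z" if "z \<in> {s. Re s > 1}" for z
    using zeta_sums[of z] zeta_cont_sums[of z] that sums_unique2 by blast
qed (use assms in \<open>auto intro!: open_Diff open_halfspace_Re_gt holomorphic_on_subset[OF holomorphic_zeta] holomorphic_zeta_cont\<close>)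

lemma zeta_eq_zeta_reflected:
  assumes "Re s < 0"
  shows "zeta s = zeta_reflected s"
proof (rule analytic_continuation_open[of "{s. Re s > -1} \<inter> {s. Re s < 0}" "{s. Re s < 0}" zeta zeta_reflected])
  have "- 1 / 2 \<in> {s. Re s > -1} \<inter> {s. Re s < 0}" by simp
  thus "{s. Re s > -1} \<inter> {s. Re s < 0} \<noteq> {}" by blast
  show "zeta z = zeta_reflected z" if "z \<in> {s. Re s > -1} \<inter> {s. Re s < 0}" for z
    using that zeta_eq_zeta_cont[of z] zeta_cont_eq_zeta_reflected[of z] by (cases "z = 1") auto
  show "open ({s. Re s > -1} \<inter> {s. Re s < 0})" by (intro open_Int open_halfspace_Re_gt open_halfspace_Re_lt)
  show "connected {s. Re s < 0}" by (intro convex_connected convex_halfspace_Re_lt)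
qed (use assms in \<open>auto intro!: open_halfspace_Re_lt holomorphic_on_subset[OF holomorphic_zeta] holomorphic_zeta_reflected\<close>)

text \<open>
  Known for \<open>Re s > 1\<close> by construction; both sides are holomorphic on the connected complement of the
  poles.
\<close>

lemma zeta_functional_equation:
  assumes s: "s \<notin> \<int>\<^sub>\<le>\<^sub>0" "s \<noteq> 1"
  shows "zeta (1 - s) = 2 * (2 * of_real pi) powr (-s) * cos (of_real pi * s / 2) * Gamma s * zeta s"
proof (rule analytic_continuation_open[of "{s. Re s > 1}" "- (insert 1 \<int>\<^sub>\<le>\<^sub>0)" "\<lambda>s. zeta (1 - s)"
      "\<lambda>s. 2 * (2 * of_real pi) powr (-s) * cos (of_real pi * s / 2) * Gamma s * zeta s"])
  show "{s. Re s > 1} \<noteq> {}" by (auto intro!: exI[of _ 2])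
  have "closed (insert (1 :: complex) \<int>\<^sub>\<le>\<^sub>0)" by (intro closed_insert closed_nonpos_Ints)
  thus "open (- (insert (1 :: complex) \<int>\<^sub>\<le>\<^sub>0))" by (rule open_Compl)
  have "countable (insert (1 :: complex) \<int>\<^sub>\<le>\<^sub>0)"
    by (auto intro!: countable_subset[OF _ countable_int] dest: nonpos_Ints_Int)
  thus "connected (- (insert (1 :: complex) \<int>\<^sub>\<le>\<^sub>0))"
    using connected_open_diff_countable[OF _ open_UNIV connected_UNIV, of "insert (1 :: complex) \<int>\<^sub>\<le>\<^sub>0"] by (simp add: Compl_eq_Diff_UNIV)
  show "{s. Re s > 1} \<subseteq> - (insert (1 :: complex) \<int>\<^sub>\<le>\<^sub>0)" by (auto elim!: nonpos_Ints_cases)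
  have "(zeta \<circ> (\<lambda>s. 1 - s)) holomorphic_on - (insert 1 \<int>\<^sub>\<le>\<^sub>0)"
    by (rule holomorphic_on_compose_gen[OF _ holomorphic_zeta]) (auto intro!: holomorphic_intros)
  thus "(\<lambda>s. zeta (1 - s)) holomorphic_on - (insert 1 \<int>\<^sub>\<le>\<^sub>0)" by (simp add: o_def)
  show "(\<lambda>s. 2 * (2 * of_real pi) powr (-s) * cos (of_real pi * s / 2) * Gamma s * zeta s) holomorphic_on - (insert 1 \<int>\<^sub>\<le>\<^sub>0)"
    by (intro holomorphic_intros holomorphic_on_subset[OF holomorphic_zeta]) auto
  show "zeta (1 - z) = 2 * (2 * of_real pi) powr (-z) * cos (of_real pi * z / 2) * Gamma z * zeta z" if "z \<in> {s. Re s > 1}" for z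
  proof -
    have "sin (of_real pi * (1 - z) / 2) = sin (of_real pi / 2 - of_real pi * z / 2)"
      by (simp add: right_diff_distrib diff_divide_distrib)
    also have "\<dots> = cos (of_real pi * z / 2)" by (simp add: sin_diff)
    finally have "sin (of_real pi * (1 - z) / 2) = cos (of_real pi * z / 2)" .
    moreover have "zeta z = zeta_cont z" using that by (intro zeta_eq_zeta_cont) auto
    ultimately show ?thesis using zeta_eq_zeta_reflected[of "1 - z"] that by (simp add: zeta_reflected_def)
  qed
qed (use s in \<open>auto intro!: open_halfspace_Re_gt\<close>)

lemma zeta_0: "zeta 0 = - 1 / 2"
  using zeta_eq_zeta_cont[of 0] zeta_cont_0 by simp

lemma zeta_2: "zeta 2 = of_real (pi\<^sup>2 / 6)"
proof -
  have "(\<lambda>n. complex_of_real (1 / (real n + 1)\<^sup>2)) sums of_real (pi\<^sup>2 / 6)"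
    by (rule sums_of_real) (use inverse_squares_sums in \<open>simp add: add.commute\<close>)
  also have "(\<lambda>n. complex_of_real (1 / (real n + 1)\<^sup>2)) = (\<lambda>n. 1 / of_nat (Suc n) powr 2)"
  proof
    fix n :: nat
    have "complex_of_nat (Suc n) \<noteq> 0" by (simp only: of_nat_eq_0_iff)
    hence "complex_of_nat (Suc n) powr 2 = of_nat (Suc n) ^ 2" 
      using powr_complexpow[of "complex_of_nat (Suc n)" 2] by (simp del: of_nat_Suc)
    thus "complex_of_real (1 / (real n + 1)\<^sup>2) = 1 / of_nat (Suc n) powr 2" by (simp add: add.commute)
  qed
  finally show ?thesis using zeta_sums[of 2] sums_unique2 by force
qed

lemma zeta_growth:
  "\<exists>C\<ge>0. \<forall>s. Re s \<ge> -1/2 \<and> Re s \<le> 5/2 \<and> \<bar>Im s\<bar> \<ge> 1 \<longrightarrow> norm (zeta s) \<le> C * (1 + \<bar>Im s\<bar>) ^ 2"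
proof -
  obtain C where C: "\<And>s. Re s \<ge> -(1/2) \<Longrightarrow> s \<noteq> 1 \<Longrightarrow> norm (zeta_cont s - 1 / (s - 1)) \<le> 1 / 2 + C * norm (s * (s + 1))"
    using zeta_cont_bound[of "1/2"] by auto
  show ?thesis
  proof (rule exI[of _ "2 + 20 * \<bar>C\<bar>"], intro conjI allI impI)
    fix s assume s: "Re s \<ge> -1/2 \<and> Re s \<le> 5/2 \<and> \<bar>Im s\<bar> \<ge> 1"
    define t where "t = 1 + \<bar>Im s\<bar>"
    have t: "t \<ge> 2" using s by (simp add: t_def)
    have s1: "s \<noteq> 1" using s by auto
    have re: "\<bar>Re s\<bar> \<le> 5 / 2" "\<bar>Re s + 1\<bar> \<le> 7 / 2" using s by (auto simp: abs_le_iff)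
    have n1: "norm s \<le> 4 * t" using cmod_le[of s] re t by (simp add: t_def) 
    have n2: "norm (s + 1) \<le> 5 * t" using cmod_le[of "s + 1"] re t by (simp add: t_def)
    have "1 \<le> norm (s - 1)" using abs_Im_le_cmod[of "s - 1"] s by simp
    hence n3: "norm (1 / (s - 1)) \<le> 1" by (simp add: norm_divide divide_le_eq_1)
    have "norm (zeta s) = norm ((zeta_cont s - 1 / (s - 1)) + 1 / (s - 1))"
      using s s1 by (simp add: zeta_eq_zeta_cont)
    also have "\<dots> \<le> norm (zeta_cont s - 1 / (s - 1)) + norm (1 / (s - 1))" by (rule norm_triangle_ineq)
    also have "\<dots> \<le> (1 / 2 + C * norm (s * (s + 1))) + 1" using C[of s] s s1 n3 by (intro add_mono) auto
    also have "C * norm (s * (s + 1)) \<le> \<bar>C\<bar> * ((4 * t) * (5 * t))"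
      unfolding norm_mult using n1 n2 t by (intro mult_mono) auto
    also have "1 / 2 + \<bar>C\<bar> * ((4 * t) * (5 * t)) + 1 \<le> (2 + 20 * \<bar>C\<bar>) * t ^ 2"
    proof -
      have "1 \<le> t * t" using mult_mono[of 1 t 1 t] t by simp
      thus ?thesis by (simp add: power2_eq_square algebra_simps)
    qed
    finally show "norm (zeta s) \<le> (2 + 20 * \<bar>C\<bar>) * (1 + \<bar>Im s\<bar>) ^ 2" by (simp add: t_def)
  qed auto
qed

section \<open>Decay of the Gamma function on vertical strips\<close>

text \<open>
  One term of the exponential series already dominates the power.
\<close>

lemma power_times_exp_bounded:
  fixes a :: real assumes a: "a > 0"
  shows "\<exists>C>0. \<forall>t\<ge>0. (1 + t) ^ N * exp (- (a * t)) \<le> C"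
proof (intro exI conjI allI impI)
  fix t :: real assume t: "t \<ge> 0"
  have "(a * (1 + t)) ^ N / fact N \<le> exp (a * (1 + t))"
  proof -
    have "(\<lambda>n. (a * (1 + t)) ^ n / fact n) sums exp (a * (1 + t))"
      using exp_converges[of "a * (1 + t)"] by (simp add: scaleR_conv_of_real field_simps)
    hence "(\<Sum>n\<in>{N}. (a * (1 + t)) ^ n / fact n) \<le> exp (a * (1 + t))"
      using a t by (intro sum_le_suminf[THEN order_trans, OF _ _ _ eq_refl[OF sums_unique[symmetric]]]) (auto simp: sums_iff)
    thus ?thesis by simp
  qed
  hence "a ^ N * (1 + t) ^ N / fact N \<le> exp (a * (1 + t))" by (simp only: power_mult_distrib)
  hence "(1 + t) ^ N \<le> fact N / a ^ N * exp (a * (1 + t))"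
    using a by (simp add: field_simps)
  hence "(1 + t) ^ N * exp (- (a * t)) \<le> fact N / a ^ N * exp (a * (1 + t)) * exp (- (a * t))"
    by (intro mult_right_mono) auto
  also have "\<dots> = fact N / a ^ N * (exp (a * (1 + t)) * exp (- (a * t)))" by simp
  also have "exp (a * (1 + t)) * exp (- (a * t)) = exp a" by (simp add: algebra_simps flip: exp_add)
  finally show "(1 + t) ^ N * exp (- (a * t)) \<le> fact N / a ^ N * exp a" .
qed (use a in auto)

text \<open>
  By Gauss's product the quotient is \<open>\<Prod>\<^sub>j (a+j) / |a+j+it|\<close>, and every factor increases with \<open>a\<close>. This
  moves a bound from one vertical line to all lines to the left of it.
\<close>

lemma norm_Gamma_quotient_mono:
  fixes a b t :: real
  assumes ab: "0 < a" "a \<le> b"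
  shows "norm (Gamma (Complex a t)) / Gamma a \<le> norm (Gamma (Complex b t)) / Gamma b"
proof (rule LIMSEQ_le)
  have lim: "(\<lambda>n. norm (Gamma_series (Complex c t) n) / Gamma_series c n) \<longlonglongrightarrow> norm (Gamma (Complex c t)) / Gamma c"
    if "c > 0" for c
    by (intro tendsto_intros) (use Gamma_real_pos[OF that] in auto)
  show "(\<lambda>n. norm (Gamma_series (Complex a t) n) / Gamma_series a n) \<longlonglongrightarrow> norm (Gamma (Complex a t)) / Gamma a"
    using lim ab by simp
  show "(\<lambda>n. norm (Gamma_series (Complex b t) n) / Gamma_series b n) \<longlonglongrightarrow> norm (Gamma (Complex b t)) / Gamma b"
    using lim ab by simp
  have q: "norm (Gamma_series (Complex c t) n) / Gamma_series c n = (\<Prod>j=0..n. (c + real j) / norm (Complex (c + real j) t))"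
    if c: "c > 0" for c n
  proof -
    have 1: "norm (exp (Complex c t * of_real (ln (real n)))) = exp (c * ln (real n))"
      by (simp add: norm_exp_eq_Re)
    have p: "norm (pochhammer (Complex c t) (n + 1)) = (\<Prod>j=0..n. norm (Complex (c + real j) t))"
      unfolding pochhammer_Suc_prod add_Suc_right add_0_right One_nat_def prod_norm[symmetric]
      by (intro prod.cong) (auto simp: complex_eq_iff intro!: arg_cong[of _ _ norm])
    have p': "pochhammer c (n + 1) = (\<Prod>j=0..n. c + real j)"
      by (simp add: pochhammer_Suc_prod)
    have "norm (Gamma_series (Complex c t) n) / Gamma_series c n = pochhammer c (n + 1) / norm (pochhammer (Complex c t) (n + 1))"
      unfolding Gamma_series_def norm_divide norm_mult 1 by simp
    also have "\<dots> = (\<Prod>j=0..n. (c + real j) / norm (Complex (c + real j) t))"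
      unfolding p p' by (rule prod_dividef[symmetric])
    finally show ?thesis .
  qed
  have le: "x / norm (Complex x t) \<le> y / norm (Complex y t)" if "0 < x" "x \<le> y" for x y
  proof -
    have "x * norm (Complex y t) \<le> y * norm (Complex x t)"
    proof (rule power2_le_imp_le)
      have "x\<^sup>2 * t\<^sup>2 \<le> y\<^sup>2 * t\<^sup>2" using that by (intro mult_right_mono power_mono) auto
      thus "(x * norm (Complex y t))\<^sup>2 \<le> (y * norm (Complex x t))\<^sup>2"
        by (simp add: power_mult_distrib cmod_power2 algebra_simps)
    qed (use that in auto)
    moreover have "norm (Complex x t) > 0" "norm (Complex y t) > 0" using that by (auto simp: complex_eq_iff)
    ultimately show ?thesis by (simp add: field_simps)
  qed
  show "\<exists>N. \<forall>n\<ge>N. norm (Gamma_series (Complex a t) n) / Gamma_series a n \<le> norm (Gamma_series (Complex b t) n) / Gamma_series b n"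
  proof (intro exI[of _ 0] allI impI)
    fix n :: nat
    show "norm (Gamma_series (Complex a t) n) / Gamma_series a n \<le> norm (Gamma_series (Complex b t) n) / Gamma_series b n"
      unfolding q[OF ab(1)] q[OF less_le_trans[OF ab]] using ab
      by (intro prod_mono conjI le divide_nonneg_nonneg) auto
  qed
qed

text \<open>
  On this line \<open>1-z\<close> is the conjugate of \<open>z\<close>, so the reflection formula gives
  \<open>|\<Gamma>(1/2+it)|\<^sup>2 = \<pi> / cosh(\<pi>t)\<close> exactly.
\<close>

lemma norm_Gamma_half_line:
  "norm (Gamma (Complex (1/2) t)) \<le> sqrt (2 * pi) * exp (- (pi * \<bar>t\<bar> / 2))"
proof -
  define z where "z = Complex (1/2) t"
  have cz: "1 - z = cnj z" by (simp add: z_def complex_eq_iff)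
  have "norm (Gamma z) ^ 2 = norm (Gamma z * Gamma (1 - z))"
    by (simp add: cz norm_mult power2_eq_square flip: cnj_Gamma)
  also have "\<dots> = pi / norm (sin (of_real pi * z))" by (simp add: Gamma_reflection_complex norm_divide)
  also have "sin (of_real pi * z) = cos (of_real pi * (\<i> * of_real t))"
  proof -
    have "of_real pi * z = of_real pi / 2 + of_real pi * (\<i> * of_real t)" by (simp add: z_def complex_eq_iff)
    thus ?thesis by (simp add: sin_add)
  qed
  also have "norm (cos (of_real pi * (\<i> * of_real t))) = cosh (pi * t)"
  proof -
    have "\<i> * (of_real pi * (\<i> * of_real t)) = complex_of_real (- (pi * t))" by (simp add: complex_eq_iff)
    hence "cos (of_real pi * (\<i> * of_real t)) = (exp (complex_of_real (- (pi * t))) + exp (- complex_of_real (- (pi * t)))) / 2"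
      by (simp only: cos_exp_eq)
    also have "\<dots> = complex_of_real (cosh (pi * t))"
      by (simp add: cosh_field_def flip: exp_of_real)
    finally show ?thesis by (simp only: norm_of_real abs_of_nonneg cosh_real_nonneg)
  qed
  finally have eq: "norm (Gamma z) ^ 2 = pi / cosh (pi * t)" .
  have "exp (pi * \<bar>t\<bar>) / 2 \<le> cosh (pi * t)" by (cases "t \<ge> 0") (auto simp: cosh_def field_simps)
  hence "pi / cosh (pi * t) \<le> pi / (exp (pi * \<bar>t\<bar>) / 2)" by (intro divide_left_mono) (auto simp: cosh_real_pos)
  also have "\<dots> = (sqrt (2 * pi) * exp (- (pi * \<bar>t\<bar> / 2))) ^ 2"
  proof -
    have "exp (- (pi * \<bar>t\<bar> / 2)) ^ 2 = exp (- (pi * \<bar>t\<bar>))" by (simp add: exp_double[symmetric])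
    thus ?thesis by (simp add: power_mult_distrib exp_minus field_simps)
  qed
  finally have "norm (Gamma z) ^ 2 \<le> (sqrt (2 * pi) * exp (- (pi * \<bar>t\<bar> / 2))) ^ 2" unfolding eq .
  thus ?thesis unfolding z_def by (rule power2_le_imp_le) simp
qed

lemma norm_Gamma_half_integer_line:
  "norm (Gamma (Complex (real M + 1/2) t)) \<le> (real M + 1/2 + \<bar>t\<bar>) ^ M * (sqrt (2 * pi) * exp (- (pi * \<bar>t\<bar> / 2)))"
proof (induction M)
  case 0 show ?case using norm_Gamma_half_line by simp
next
  case (Suc M)
  let ?z = "Complex (real M + 1/2) t"
  have z: "?z \<notin> \<int>\<^sub>\<le>\<^sub>0" by (auto elim!: nonpos_Ints_cases simp: complex_eq_iff)
  have "Complex (real (Suc M) + 1/2) t = ?z + 1" by (simp add: complex_eq_iff)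
  hence "norm (Gamma (Complex (real (Suc M) + 1/2) t)) = norm ?z * norm (Gamma ?z)"
    using Gamma_plus1[OF z] by (simp add: norm_mult)
  also have "\<dots> \<le> (real (Suc M) + 1/2 + \<bar>t\<bar>) * ((real (Suc M) + 1/2 + \<bar>t\<bar>) ^ M * (sqrt (2 * pi) * exp (- (pi * \<bar>t\<bar> / 2))))"
  proof (intro mult_mono)
    show "norm ?z \<le> real (Suc M) + 1/2 + \<bar>t\<bar>" using cmod_le[of ?z] by simp
    have "norm (Gamma ?z) \<le> (real M + 1/2 + \<bar>t\<bar>) ^ M * (sqrt (2 * pi) * exp (- (pi * \<bar>t\<bar> / 2)))" by (rule Suc.IH)
    also have "\<dots> \<le> (real (Suc M) + 1/2 + \<bar>t\<bar>) ^ M * (sqrt (2 * pi) * exp (- (pi * \<bar>t\<bar> / 2)))"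
      by (intro mult_right_mono power_mono) auto
    finally show "norm (Gamma ?z) \<le> (real (Suc M) + 1/2 + \<bar>t\<bar>) ^ M * (sqrt (2 * pi) * exp (- (pi * \<bar>t\<bar> / 2)))" .
  qed auto
  finally show ?case by (simp add: mult.assoc)
qed

text \<open>
  Compare with a half-integer line \<open>Re z = M + 1/2\<close> to the right of the strip.
\<close>

lemma norm_Gamma_vertical_strip:
  fixes a b :: real assumes a: "a > 0"
  shows "\<exists>C>0. \<exists>M. \<forall>z. a \<le> Re z \<and> Re z \<le> b \<longrightarrow> norm (Gamma z) \<le> C * (1 + \<bar>Im z\<bar>) ^ M * exp (- (pi * \<bar>Im z\<bar> / 2))"
proof -
  \<comment> \<open>any half-integer line to the right of the strip will do\<close>
  define M where "M = nat \<lceil>b\<rceil>"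
  have M: "b \<le> real M + 1/2" unfolding M_def by linarith
  let ?m = "real M + 1/2"
  have "continuous_on {a..b} (Gamma :: real \<Rightarrow> real)"
    using a by (intro continuous_on_Gamma) (auto elim!: nonpos_Ints_cases)
  hence "bounded (Gamma ` {a..b} :: real set)" by (intro compact_imp_bounded compact_continuous_image) auto
  then obtain B where B: "B > 0" "\<And>x. x \<in> {a..b} \<Longrightarrow> norm (Gamma x :: real) \<le> B"
    unfolding bounded_pos by auto
  have Gm: "Gamma ?m > 0" by simp
  define C where "C = B / Gamma ?m * (?m + 1) ^ M * sqrt (2 * pi)"
  show ?thesis
  proof (intro exI[of _ C] exI[of _ M] conjI allI impI)
    show "C > 0" unfolding C_def using B Gm by (intro mult_pos_pos divide_pos_pos zero_less_power) auto
    fix z assume z: "a \<le> Re z \<and> Re z \<le> b"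
    define t where "t = Im z"
    have ze: "z = Complex (Re z) t" by (simp add: t_def)
    have Gz: "Gamma (Re z) > 0" using z a by simp
    have "norm (Gamma z) / Gamma (Re z) \<le> norm (Gamma (Complex ?m t)) / Gamma ?m"
      using norm_Gamma_quotient_mono[of "Re z" ?m t] z a M ze by simp
    hence "norm (Gamma z) \<le> Gamma (Re z) * (norm (Gamma (Complex ?m t)) / Gamma ?m)"
      using Gz by (simp add: field_simps)
    also have "\<dots> \<le> B * ((?m + \<bar>t\<bar>) ^ M * (sqrt (2 * pi) * exp (- (pi * \<bar>t\<bar> / 2))) / Gamma ?m)"
      using B(2)[of "Re z"] z Gm Gz B(1)
      by (intro mult_mono divide_right_mono norm_Gamma_half_integer_line) auto
    also have "\<dots> \<le> B * (((?m + 1) * (1 + \<bar>t\<bar>)) ^ M * (sqrt (2 * pi) * exp (- (pi * \<bar>t\<bar> / 2))) / Gamma ?m)"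
    proof -
      have "(?m + 1) * (1 + \<bar>t\<bar>) = ?m + \<bar>t\<bar> + (1 + \<bar>t\<bar> * ?m)" by (simp add: field_simps)
      moreover have "\<bar>t\<bar> * ?m \<ge> 0" by (intro mult_nonneg_nonneg) auto
      ultimately have "?m + \<bar>t\<bar> \<le> (?m + 1) * (1 + \<bar>t\<bar>)" by linarith
      thus ?thesis using B Gm by (intro mult_left_mono divide_right_mono mult_right_mono power_mono) auto
    qed
    also have "\<dots> = C * (1 + \<bar>t\<bar>) ^ M * exp (- (pi * \<bar>t\<bar> / 2))" by (simp add: C_def power_mult_distrib)
    finally show "norm (Gamma z) \<le> C * (1 + \<bar>Im z\<bar>) ^ M * exp (- (pi * \<bar>Im z\<bar> / 2))" by (simp add: t_def)
  qed
qed

lemma norm_cos_le_exp: "norm (cos z) \<le> exp \<bar>Im z\<bar>" for z :: complex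
proof -
  have "norm (cos z) = norm (exp (\<i> * z) + exp (- (\<i> * z))) / 2" by (simp add: cos_exp_eq norm_divide)
  also have "\<dots> \<le> (norm (exp (\<i> * z)) + norm (exp (- (\<i> * z)))) / 2" by (intro divide_right_mono norm_triangle_ineq) auto
  also have "\<dots> = (exp (- Im z) + exp (Im z)) / 2" by (simp add: norm_exp_eq_Re)
  also have "\<dots> \<le> (exp \<bar>Im z\<bar> + exp \<bar>Im z\<bar>) / 2" by (intro divide_right_mono add_mono) auto
  finally show ?thesis by simp
qed

lemma norm_cos_ge_exp: "norm (cos z) \<ge> (exp \<bar>Im z\<bar> - exp (- \<bar>Im z\<bar>)) / 2" for z :: complex
proof -
  have "exp \<bar>Im z\<bar> - exp (- \<bar>Im z\<bar>) = \<bar>exp (- Im z) - exp (Im z)\<bar>"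
    by (cases "Im z \<ge> 0") auto
  also have "\<dots> = \<bar>norm (exp (\<i> * z)) - norm (exp (- (\<i> * z)))\<bar>" by (simp add: norm_exp_eq_Re)
  also have "\<dots> \<le> norm (exp (\<i> * z) + exp (- (\<i> * z)))"
    using norm_triangle_ineq3[of "exp (\<i> * z)" "- exp (- (\<i> * z))"] by simp
  also have "\<dots> = 2 * norm (cos z)" by (simp add: cos_exp_eq norm_divide)
  finally show ?thesis by simp
qed

section \<open>Shifting a vertical line of integration\<close>

lemma integrable_inverse_1_plus_square_lborel: "integrable lborel (\<lambda>t::real. 1 / (1 + t\<^sup>2))"
  using integrable_inverse_1_plus_square by (simp add: set_integrable_def inverse_eq_divide)

lemma integrable_quadratic_decay:
  fixes g :: "real \<Rightarrow> complex"
  assumes cont: "continuous_on UNIV g" and decay: "\<And>t. \<bar>t\<bar> \<ge> 1 \<Longrightarrow> norm (g t) \<le> C / (1 + t\<^sup>2)"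
  shows "integrable lborel g"
proof -
  have "bounded (g ` {-1..1})"
    by (intro compact_imp_bounded compact_continuous_image continuous_on_subset[OF cont]) auto
  then obtain B where B: "B > 0" "\<And>t. t \<in> {-1..1} \<Longrightarrow> norm (g t) \<le> B" unfolding bounded_pos by auto
  have pos: "1 + t\<^sup>2 > 0" for t :: real by (intro add_pos_nonneg) auto
  show ?thesis
  proof (rule Bochner_Integration.integrable_bound)
    show "integrable lborel (\<lambda>t::real. (2 * B + \<bar>C\<bar>) * (1 / (1 + t\<^sup>2)))"
      by (intro integrable_mult_right integrable_inverse_1_plus_square_lborel)
    show "g \<in> borel_measurable lborel" using borel_measurable_continuous_onI[OF cont] by simp
    show "AE t in lborel. norm (g t) \<le> norm ((2 * B + \<bar>C\<bar>) * (1 / (1 + t\<^sup>2)))"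
    proof (intro always_eventually allI)
      fix t :: real
      have "norm (g t) * (1 + t\<^sup>2) \<le> 2 * B + \<bar>C\<bar>"
      proof (cases "\<bar>t\<bar> \<ge> 1")
        case True
        have "norm (g t) * (1 + t\<^sup>2) \<le> C" using decay[OF True] pos[of t] by (simp add: field_simps)
        thus ?thesis using B by linarith
      next
        case False
        hence "t\<^sup>2 \<le> 1" by (simp add: abs_square_le_1)
        moreover have "t \<in> {-1..1}" unfolding atLeastAtMost_iff using False by linarith
        ultimately have "norm (g t) * (1 + t\<^sup>2) \<le> B * 2" using B by (intro mult_mono) auto
        thus ?thesis by linarith
      qed
      hence "norm (g t) \<le> (2 * B + \<bar>C\<bar>) * (1 / (1 + t\<^sup>2))" using pos[of t] by (simp add: field_simps)
      also have "\<dots> \<le> norm ((2 * B + \<bar>C\<bar>) * (1 / (1 + t\<^sup>2)))" by (simp only: real_norm_def abs_ge_self)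
      finally show "norm (g t) \<le> norm ((2 * B + \<bar>C\<bar>) * (1 / (1 + t\<^sup>2)))" .
    qed
  qed
qed

lemma LINT_limit_symmetric_intervals:
  fixes g :: "real \<Rightarrow> complex"
  assumes "integrable lborel g"
  shows "(\<lambda>n. integral {-real n..real n} g) \<longlonglongrightarrow> (LINT t|lborel. g t)"
proof -
  have "(\<lambda>n. LINT t|lborel. indicator {-real n..real n} t *\<^sub>R g t) \<longlonglongrightarrow> (LINT t|lborel. g t)"
  proof (rule integral_dominated_convergence[where w = "\<lambda>t. norm (g t)"])
    show "AE t in lborel. (\<lambda>n. indicator {-real n..real n} t *\<^sub>R g t) \<longlonglongrightarrow> g t"
    proof (intro AE_I2 tendsto_eventually)
      fix t :: real
      obtain N :: nat where N: "\<bar>t\<bar> \<le> real N" using real_arch_simple by blast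
      show "eventually (\<lambda>n. indicator {-real n..real n} t *\<^sub>R g t = g t) sequentially"
        using eventually_ge_at_top[of N] by eventually_elim (use N in \<open>auto simp: indicator_def\<close>)
    qed
  qed (use assms in \<open>auto simp: indicator_def intro!: borel_measurable_scaleR\<close>)
  also have "(\<lambda>n. LINT t|lborel. indicator {-real n..real n} t *\<^sub>R g t) = (\<lambda>n. integral {-real n..real n} g)"
  proof
    fix n
    have "set_integrable lborel {-real n..real n} g"
      unfolding set_integrable_def using assms by (intro integrable_mult_indicator) auto
    from set_borel_integral_eq_integral(2)[OF this]
    show "(LINT t|lborel. indicator {-real n..real n} t *\<^sub>R g t) = integral {-real n..real n} g"
      by (simp add: set_lebesgue_integral_def)
  qed
  finally show ?thesis .
qed

text \<open>
  The residue theorem for rectangles whose height tends to infinity: quadratic decay makes the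
  integrals along the two lines converge and those over the horizontal sides vanish.
\<close>

lemma vertical_line_shift:
  fixes f :: "complex \<Rightarrow> complex" and a b C :: real
  assumes ab: "a < b" and S: "open S" "connected S" "{w. a \<le> Re w \<and> Re w \<le> b} \<subseteq> S"
    and pts: "finite pts" "\<And>p. p \<in> pts \<Longrightarrow> a < Re p \<and> Re p < b \<and> \<bar>Im p\<bar> < 1"
    and hol: "f holomorphic_on S - pts"
    and decay: "\<And>w. a \<le> Re w \<Longrightarrow> Re w \<le> b \<Longrightarrow> \<bar>Im w\<bar> \<ge> 1 \<Longrightarrow> norm (f w) \<le> C / (1 + (Im w)\<^sup>2)"
  shows "integrable lborel (\<lambda>t. f (Complex a t))" (is ?A)
    and "integrable lborel (\<lambda>t. f (Complex b t))" (is ?B)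
    and "(LINT t|lborel. f (Complex b t)) - (LINT t|lborel. f (Complex a t)) =
           2 * of_real pi * (\<Sum>p\<in>pts. residue f p)" (is ?C)
proof -
  have cont: "continuous_on (S - pts) f" using hol by (rule holomorphic_on_imp_continuous_on)
  have line: "integrable lborel (\<lambda>t. f (Complex c t))" if c: "c = a \<or> c = b" for c
  proof (rule integrable_quadratic_decay)
    have "continuous_on (Complex c ` UNIV) f"
      by (rule continuous_on_subset[OF cont]) (use c S ab pts(2) in force)
    moreover have "continuous_on UNIV (Complex c)" unfolding Complex_eq by (intro continuous_intros)
    ultimately show "continuous_on UNIV (\<lambda>t. f (Complex c t))"
      using continuous_on_compose[of UNIV "Complex c" f] by (simp add: o_def)
    show "norm (f (Complex c t)) \<le> C / (1 + t\<^sup>2)" if "\<bar>t\<bar> \<ge> 1" for t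
      using decay[of "Complex c t"] that c ab by auto
  qed
  show A: ?A and B: ?B using line by auto
  define V where "V = (\<lambda>c T. integral {-T..T} (\<lambda>t. f (Complex c t)))"
  define R where "R = 2 * of_real pi * (\<Sum>p\<in>pts. residue f p)"
  have est: "norm (V b T - V a T - R) \<le> 2 * (\<bar>C\<bar> / (1 + T\<^sup>2) * (b - a))" if T: "T \<ge> 1" for T
  proof -
    define w1 w2 w3 w4 where "w1 = Complex a (-T)" and "w2 = Complex b (-T)" and "w3 = Complex b T" and "w4 = Complex a T"
    have rp: "rectpath w1 w3 = linepath w1 w2 +++ linepath w2 w3 +++ linepath w3 w4 +++ linepath w4 w1"
      by (simp add: rectpath_def Let_def w1_def w2_def w3_def w4_def)
    have pi: "path_image (rectpath w1 w3) \<subseteq> S - pts"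
    proof -
      have "path_image (rectpath w1 w3) = cbox w1 w3 - box w1 w3"
        by (rule path_image_rectpath_cbox_minus_box) (use ab T in \<open>auto simp: w1_def w3_def\<close>)
      also have "\<dots> \<subseteq> S - pts"
        using S(3) pts(2) T by (force simp: in_cbox_complex_iff in_box_complex_iff w1_def w3_def)
      finally show ?thesis .
    qed
    have seg: "closed_segment w1 w2 \<subseteq> S - pts" "closed_segment w2 w3 \<subseteq> S - pts" "closed_segment w3 w4 \<subseteq> S - pts" "closed_segment w4 w1 \<subseteq> S - pts"
      using pi unfolding rp by (auto simp: path_image_join)
    have int: "f contour_integrable_on linepath w1 w2" "f contour_integrable_on linepath w2 w3"
        "f contour_integrable_on linepath w3 w4" "f contour_integrable_on linepath w4 w1"
      by (intro contour_integrable_continuous_linepath continuous_on_subset[OF cont] seg)+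
    have "contour_integral (rectpath w1 w3) f = 2 * pi * \<i> * (\<Sum>p\<in>pts. winding_number (rectpath w1 w3) p * residue f p)"
    proof (rule Residue_theorem[OF S(1,2) pts(1) hol])
      show "\<forall>z. z \<notin> S \<longrightarrow> winding_number (rectpath w1 w3) z = 0"
      proof (intro allI impI winding_number_rectpath_outside)
        fix z assume "z \<notin> S"
        thus "z \<notin> cbox w1 w3" using S(3) by (auto simp: in_cbox_complex_iff w1_def w3_def)
      qed (use ab T in \<open>auto simp: w1_def w3_def\<close>)
    qed (use pi in auto)
    also have "(\<Sum>p\<in>pts. winding_number (rectpath w1 w3) p * residue f p) = (\<Sum>p\<in>pts. residue f p)"
    proof (intro sum.cong refl)
      fix p assume "p \<in> pts"
      hence "p \<in> box w1 w3" using pts(2)[of p] T by (auto simp: in_box_complex_iff w1_def w3_def)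
      thus "winding_number (rectpath w1 w3) p * residue f p = residue f p" by (simp add: winding_number_rectpath)
    qed
    finally have main: "contour_integral (rectpath w1 w3) f = \<i> * R" by (simp add: R_def)
    have right: "contour_integral (linepath w2 w3) f = \<i> * V b T" unfolding V_def
      by (rule contour_integral_linepath_same_Re) (use T in \<open>auto simp: w2_def w3_def\<close>)
    have left: "contour_integral (linepath w4 w1) f = - (\<i> * V a T)"
    proof -
      have "contour_integral (linepath w1 w4) f = \<i> * V a T" unfolding V_def
        by (rule contour_integral_linepath_same_Re) (use T in \<open>auto simp: w1_def w4_def\<close>)
      moreover have "contour_integral (linepath w4 w1) f = - contour_integral (linepath w1 w4) f"
        using contour_integral_reversepath[of "linepath w1 w4" f] by simp
      ultimately show ?thesis by simp
    qed
    have horiz: "norm (contour_integral (linepath u v) f) \<le> \<bar>C\<bar> / (1 + T\<^sup>2) * (b - a)"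
      if uv: "f contour_integrable_on linepath u v" "norm (v - u) = b - a" "\<bar>Im u\<bar> = T" "Im u = Im v"
         "a \<le> Re u" "a \<le> Re v" "Re u \<le> b" "Re v \<le> b" for u v
    proof -
      have "norm (contour_integral (linepath u v) f) \<le> \<bar>C\<bar> / (1 + T\<^sup>2) * norm (v - u)"
      proof (rule has_contour_integral_bound_linepath[OF has_contour_integral_integral[OF uv(1)]])
        show "0 \<le> \<bar>C\<bar> / (1 + T\<^sup>2)" by simp
        fix x assume "x \<in> closed_segment u v"
        hence x: "Im x = Im u" "Re x \<in> closed_segment (Re u) (Re v)"
          using closed_segment_same_Im[of u v] uv(4) by auto
        hence "a \<le> Re x" "Re x \<le> b" using uv by (auto simp: closed_segment_eq_real_ivl split: if_splits)
        hence "norm (f x) \<le> C / (1 + (Im x)\<^sup>2)" by (intro decay) (use x uv T in auto)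
        also have "(Im x)\<^sup>2 = T\<^sup>2" using x uv(3) by (metis power2_abs)
        also have "C / (1 + T\<^sup>2) \<le> \<bar>C\<bar> / (1 + T\<^sup>2)" by (intro divide_right_mono) auto
        finally show "norm (f x) \<le> \<bar>C\<bar> / (1 + T\<^sup>2)" .
      qed
      thus ?thesis using uv(2) by simp
    qed
    let ?h = "contour_integral (linepath w1 w2) f" and ?k = "contour_integral (linepath w3 w4) f"
    have d: "norm (w2 - w1) = b - a" "norm (w4 - w3) = b - a"
      using ab by (simp_all add: w1_def w2_def w3_def w4_def cmod_def)
    have h: "norm ?h \<le> \<bar>C\<bar> / (1 + T\<^sup>2) * (b - a)"
      by (rule horiz[OF int(1) d(1)]) (use ab T in \<open>auto simp: w1_def w2_def\<close>)
    have k: "norm ?k \<le> \<bar>C\<bar> / (1 + T\<^sup>2) * (b - a)"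
      by (rule horiz[OF int(3) d(2)]) (use ab T in \<open>auto simp: w3_def w4_def\<close>)
    have "contour_integral (rectpath w1 w3) f = ?h + (\<i> * V b T + (?k + - (\<i> * V a T)))"
      unfolding rp using int right left by (simp add: contour_integrable_joinI valid_path_join)
    hence "\<i> * (V b T - V a T - R) = - (?h + ?k)" using main by (simp add: algebra_simps add_eq_0_iff)
    hence "norm (\<i> * (V b T - V a T - R)) = norm (?h + ?k)" by (simp only: norm_minus_cancel)
    also have "\<dots> \<le> norm ?h + norm ?k" by (rule norm_triangle_ineq)
    finally show ?thesis using h k by (simp add: norm_mult)
  qed
  have "(\<lambda>n. V b (real n) - V a (real n)) \<longlonglongrightarrow> (LINT t|lborel. f (Complex b t)) - (LINT t|lborel. f (Complex a t))"
    unfolding V_def by (intro tendsto_diff LINT_limit_symmetric_intervals A B)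
  moreover have "(\<lambda>n. V b (real n) - V a (real n) - R) \<longlonglongrightarrow> 0"
  proof (rule Lim_null_comparison)
    show "eventually (\<lambda>n. norm (V b (real n) - V a (real n) - R) \<le> 2 * (\<bar>C\<bar> / (1 + (real n)\<^sup>2) * (b - a))) sequentially"
      using eventually_ge_at_top[of 1] by eventually_elim (rule est, simp)
    have "LIM n sequentially. 1 + (real n)\<^sup>2 :> at_top"
      by (intro filterlim_tendsto_add_at_top[OF tendsto_const] filterlim_pow_at_top filterlim_real_sequentially) auto
    hence "(\<lambda>n. \<bar>C\<bar> / (1 + (real n)\<^sup>2)) \<longlonglongrightarrow> 0"
      by (rule tendsto_divide_0[OF tendsto_const filterlim_at_top_imp_at_infinity])
    from tendsto_mult_left[OF tendsto_mult_right[OF this, of "b - a"], of 2]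
    show "(\<lambda>n. 2 * (\<bar>C\<bar> / (1 + (real n)\<^sup>2) * (b - a))) \<longlonglongrightarrow> 0" by simp
  qed
  hence "(\<lambda>n. V b (real n) - V a (real n)) \<longlonglongrightarrow> R"
    by (simp add: LIM_zero_iff)
  ultimately show ?C unfolding R_def using LIMSEQ_unique by blast
qed

section \<open>The Dirichlet series of the Piltz divisor function\<close>

definition factorizations :: "nat \<Rightarrow> nat list set" where
  "factorizations k = {xs. length xs = k \<and> (\<forall>x\<in>set xs. x > 0)}"

lemma factorizations_0: "factorizations 0 = {[]}"
  by (auto simp: factorizations_def)

lemma bij_betw_factorizations_Suc:
  "bij_betw (\<lambda>(x, xs). x # xs) ({0<..} \<times> factorizations k) (factorizations (Suc k))"
  by (rule bij_betwI[where g = "\<lambda>xs. (hd xs, tl xs)"])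
     (auto simp: factorizations_def length_Suc_conv)

lemma finite_factorizations_of:
  assumes "n > 0"
  shows "finite {xs. length xs = k \<and> (\<forall>x\<in>set xs. x > 0) \<and> prod_list xs = (n :: nat)}"
proof (rule finite_subset)
  show "{xs. length xs = k \<and> (\<forall>x\<in>set xs. x > 0) \<and> prod_list xs = n} \<subseteq> {xs. set xs \<subseteq> {..n} \<and> length xs = k}"
    using assms by (auto dest!: prod_list_dvd dvd_imp_le intro: dvd_imp_le)
  show "finite {xs. set xs \<subseteq> {..n} \<and> length xs = k}" by (rule finite_lists_length_eq) simp
qed

lemma of_nat_mult_powr: "complex_of_nat (m * n) powr s = of_nat m powr s * of_nat n powr s"
  using powr_times_real[of "of_nat m" "of_nat n" s] by simp

lemma has_sum_factorizations_real:
  fixes f :: "nat \<Rightarrow> real"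
  assumes f: "(f has_sum Z) {0<..}" "\<And>n. f n \<ge> 0" "f 1 = 1" "\<And>m n. f (m * n) = f m * f n"
  shows "((\<lambda>xs. f (prod_list xs)) has_sum Z ^ k) (factorizations k)"
proof (induction k)
  case 0
  show ?case using f(3) by (simp add: factorizations_0 has_sum_finite_iff)
next
  case (Suc k)
  have "((\<lambda>(x, xs). f x * f (prod_list xs)) has_sum Z * Z ^ k) ({0<..} \<times> factorizations k)"
  proof (rule has_sum_SigmaI)
    show "((\<lambda>y. case (x, y) of (x, xs) \<Rightarrow> f x * f (prod_list xs)) has_sum f x * Z ^ k) (factorizations k)" for x
      using has_sum_cmult_right[OF Suc.IH, of "f x"] by simp
    show "((\<lambda>x. f x * Z ^ k) has_sum Z * Z ^ k) {0<..}" by (rule has_sum_cmult_left[OF f(1)])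
    show "(\<lambda>(x, xs). f x * f (prod_list xs)) summable_on {0<..} \<times> factorizations k"
      by (rule summable_on_SigmaI[OF _ has_sum_imp_summable[OF has_sum_cmult_left[OF f(1), of "Z ^ k"]]])
         (use has_sum_cmult_right[OF Suc.IH] f(2) in auto)
  qed
  hence "((\<lambda>p. f (prod_list ((\<lambda>(x, xs). x # xs) p))) has_sum Z ^ Suc k) ({0<..} \<times> factorizations k)"
    by (simp add: case_prod_unfold f(4))
  thus ?case using has_sum_reindex_bij_betw[OF bij_betw_factorizations_Suc] by blast
qed

text \<open>
  A completely multiplicative function turns the sum over lists into a product of \<open>k\<close> equal sums; the
  nonnegative case, applied to the norms, justifies the rearrangement.
\<close>

lemma has_sum_factorizations_complex:
  fixes f :: "nat \<Rightarrow> complex"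
  assumes f: "(f has_sum Z) {0<..}" "(\<lambda>n. norm (f n)) summable_on {0<..}" "f 1 = 1" "\<And>m n. f (m * n) = f m * f n"
  shows "((\<lambda>xs. f (prod_list xs)) has_sum Z ^ k) (factorizations k)"
proof (induction k)
  case 0
  show ?case using f(3) by (simp add: factorizations_0 has_sum_finite_iff)
next
  case (Suc k)
  have "((\<lambda>(x, xs). f x * f (prod_list xs)) has_sum Z * Z ^ k) ({0<..} \<times> factorizations k)"
  proof (rule has_sum_SigmaI)
    show "((\<lambda>y. case (x, y) of (x, xs) \<Rightarrow> f x * f (prod_list xs)) has_sum f x * Z ^ k) (factorizations k)" for x
      using has_sum_cmult_right[OF Suc.IH, of "f x"] by simp
    show "((\<lambda>x. f x * Z ^ k) has_sum Z * Z ^ k) {0<..}" by (rule has_sum_cmult_left[OF f(1)])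
    have "((\<lambda>xs. norm (f (prod_list xs))) has_sum (infsum (\<lambda>n. norm (f n)) {0<..}) ^ Suc k) (factorizations (Suc k))"
      by (rule has_sum_factorizations_real) (use f in \<open>auto simp: norm_mult has_sum_infsum\<close>)
    hence "(\<lambda>xs. norm (f (prod_list xs))) summable_on (factorizations (Suc k))" by (rule has_sum_imp_summable)
    hence "(\<lambda>p. norm (f (prod_list ((\<lambda>(x, xs). x # xs) p)))) summable_on {0<..} \<times> factorizations k"
      using summable_on_reindex_bij_betw[OF bij_betw_factorizations_Suc, of "\<lambda>xs. norm (f (prod_list xs))"] by blast
    hence "(\<lambda>p. norm ((\<lambda>(x, xs). f x * f (prod_list xs)) p)) summable_on {0<..} \<times> factorizations k"
      by (simp add: case_prod_unfold f(4))
    thus "(\<lambda>(x, xs). f x * f (prod_list xs)) summable_on {0<..} \<times> factorizations k"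
      by (rule abs_summable_summable)
  qed
  hence "((\<lambda>p. f (prod_list ((\<lambda>(x, xs). x # xs) p))) has_sum Z ^ Suc k) ({0<..} \<times> factorizations k)"
    by (simp add: case_prod_unfold f(4))
  thus ?case using has_sum_reindex_bij_betw[OF bij_betw_factorizations_Suc] by blast
qed

text \<open>
  Group the lists by their product: the fibre over \<open>n\<close> is what the divisor function counts.
\<close>

lemma has_sum_piltz_d:
  fixes f :: "nat \<Rightarrow> 'a :: {real_normed_algebra_1, banach}"
  assumes "((\<lambda>xs. f (prod_list xs)) has_sum S) (factorizations k)"
  shows "((\<lambda>n. of_nat (piltz_d k n) * f n) has_sum S) {0<..}"
proof -
  let ?B = "\<lambda>n. {xs. length xs = k \<and> (\<forall>x\<in>set xs. x > 0) \<and> prod_list xs = (n :: nat)}"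
  have pos: "(\<forall>x\<in>set xs. x > 0) \<Longrightarrow> prod_list xs > 0" for xs :: "nat list"
    by (induction xs) auto
  have bij: "bij_betw (\<lambda>xs. (prod_list xs, xs)) (factorizations k) (Sigma {0<..} ?B)"
    by (rule bij_betwI[where g = snd]) (auto simp: factorizations_def intro: pos)
  have "((\<lambda>(n, xs). f n) has_sum S) (Sigma {0<..} ?B)"
    using assms has_sum_reindex_bij_betw[OF bij, of "\<lambda>(n, xs). f n"] by simp
  thus ?thesis
  proof (rule has_sum_SigmaD)
    fix n :: nat assume n: "n \<in> {0<..}"
    have "((\<lambda>xs. f n) has_sum (\<Sum>xs\<in>?B n. f n)) (?B n)"
      by (rule has_sum_finite) (use n finite_factorizations_of in auto)
    thus "((\<lambda>y. case (n, y) of (n, xs) \<Rightarrow> f n) has_sum of_nat (piltz_d k n) * f n) (?B n)"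
      by (simp add: piltz_d_def)
  qed
qed

lemma bij_betw_Suc_pos: "bij_betw Suc UNIV {0<..}"
  by (rule bij_betwI[where g = "\<lambda>n. n - 1"]) auto

lemma piltz_d_summable:
  assumes "\<sigma> > 1"
  shows "summable (\<lambda>n. real (piltz_d k (Suc n)) * real (Suc n) powr (-\<sigma>))"
proof -
  have "(\<lambda>n. real (Suc n) powr (-\<sigma>)) summable_on UNIV"
    using summable_Suc_powr[OF assms] by (intro summable_nonneg_imp_summable_on) auto
  hence "(\<lambda>n. real n powr (-\<sigma>)) summable_on {0<..}"
    using summable_on_reindex_bij_betw[OF bij_betw_Suc_pos, of "\<lambda>n. real n powr (-\<sigma>)"] by simp
  then obtain Z where "((\<lambda>n. real n powr (-\<sigma>)) has_sum Z) {0<..}" by (auto simp: summable_on_def)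
  from has_sum_piltz_d[OF has_sum_factorizations_real[OF this]]
  have "((\<lambda>n. of_nat (piltz_d k n) * real n powr (-\<sigma>)) has_sum Z ^ k) {0<..}"
    by (simp add: powr_mult)
  hence "((\<lambda>n. of_nat (piltz_d k (Suc n)) * real (Suc n) powr (-\<sigma>)) has_sum Z ^ k) UNIV"
    using has_sum_reindex_bij_betw[OF bij_betw_Suc_pos, of "\<lambda>n. of_nat (piltz_d k n) * real n powr (-\<sigma>)"] by simp
  thus ?thesis by (intro sums_summable[OF has_sum_imp_sums])
qed

lemma piltz_d_sums:
  assumes s: "Re s > 1"
  shows "(\<lambda>n. of_nat (piltz_d k (Suc n)) * of_nat (Suc n) powr (-s)) sums (zeta s ^ k)"
proof -
  let ?f = "\<lambda>n. complex_of_nat n powr (-s)"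
  have nrm: "norm (?f (Suc n)) = real (Suc n) powr (- Re s)" for n
    by (simp add: norm_powr_real_powr del: of_nat_Suc)
  have sm: "summable (\<lambda>n. norm (?f (Suc n)))" unfolding nrm by (rule summable_Suc_powr[OF s])
  have "(\<lambda>n. norm (?f (Suc n))) summable_on UNIV"
    by (rule summable_nonneg_imp_summable_on[OF sm]) auto
  hence 1: "(\<lambda>n. norm (?f n)) summable_on {0<..}"
    using summable_on_reindex_bij_betw[OF bij_betw_Suc_pos, of "\<lambda>n. norm (?f n)"] by simp
  have "(\<lambda>n. ?f (Suc n)) sums zeta s" using zeta_sums[OF s] by (simp only: powr_minus_divide)
  hence "((\<lambda>n. ?f (Suc n)) has_sum zeta s) UNIV" by (rule norm_summable_imp_has_sum[OF sm])
  hence 2: "(?f has_sum zeta s) {0<..}"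
    using has_sum_reindex_bij_betw[OF bij_betw_Suc_pos, of ?f] by simp
  from has_sum_piltz_d[OF has_sum_factorizations_complex[OF 2 1 _ of_nat_mult_powr]]
  have "((\<lambda>n. of_nat (piltz_d k n) * ?f n) has_sum zeta s ^ k) {0<..}" by simp
  hence "((\<lambda>n. of_nat (piltz_d k (Suc n)) * ?f (Suc n)) has_sum zeta s ^ k) UNIV"
    using has_sum_reindex_bij_betw[OF bij_betw_Suc_pos, of "\<lambda>n. of_nat (piltz_d k n) * ?f n"] by simp
  thus ?thesis by (rule has_sum_imp_sums)
qed

section \<open>The even kernel and its residues\<close>

lemma powr_strip_bound:
  fixes y :: real assumes "y > 0" "a \<le> x" "x \<le> b"
  shows "y powr x \<le> y powr a + y powr b"
proof (cases "y \<ge> 1")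
  case True
  hence "y powr x \<le> y powr b" using assms by (intro powr_mono) auto
  thus ?thesis by (simp add: add_increasing)
next
  case False
  hence "y powr x \<le> y powr a" using assms by (intro powr_mono') auto
  thus ?thesis by (simp add: add_increasing2)
qed

text \<open>
  This is \<open>2\<^sup>k\<close> times the Mellin transform of the double series, up to the power of \<open>2\<pi>\<close> that is absorbed
  into the parameter, rewritten with the functional equation so that the symmetry \<open>w \<mapsto> -w\<close> is visible.
\<close>

definition even_kernel :: "nat \<Rightarrow> complex \<Rightarrow> complex" where
  "even_kernel k w = (zeta (1 - w) * zeta (1 + w)) ^ k / cos (of_real pi * w / 2)"

lemma even_kernel_minus: "even_kernel k (- w) = even_kernel k w"
  by (simp add: even_kernel_def mult.commute)

lemma cos_half_pi_eq_0D:
  assumes "cos (of_real pi * w / 2) = (0 :: complex)"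
  obtains n :: int where "w = of_int (2 * n + 1)"
proof -
  from assms obtain m :: int where "of_real pi * w / 2 = complex_of_real (of_int m * pi) + of_real pi / 2"
    unfolding cos_eq_0 by (auto elim!: Ints_cases)
  hence "of_real pi * w = of_real pi * (2 * of_int m + 1)" by (simp add: field_simps)
  hence "w = 2 * of_int m + 1" by simp
  thus ?thesis using that[of m] by simp
qed

lemma of_real_powr_exp:
  "z > 0 \<Longrightarrow> of_real z powr w = exp (w * complex_of_real (ln z))"
  by (simp add: powr_def Ln_of_real)

text \<open>
  The functional equation supplies one cosine for each of the \<open>k\<close> zeta factors, one more than the
  Mellin kernel has; hence the cosine in the denominator. It does not vanish on the line
  \<open>Re w = 3/2\<close>.
\<close>

lemma mellin_integrand_eq_even_kernel:
  assumes k: "k \<ge> 1" and w: "Re w = 3 / 2" and \<alpha>: "\<alpha> > 0"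
  shows "Gamma w ^ k * cos (of_real pi * w / 2) ^ (k - 1) * of_real ((2 * \<alpha>) ^ k) powr (- w) * zeta w ^ k * zeta (1 + w) ^ k =
    1 / 2 ^ k * (even_kernel k w * of_real ((pi / \<alpha>) ^ k) powr w)"
proof -
  obtain m where m: "k = Suc m" using k by (cases k) auto
  define c where "c = cos (of_real pi * w / 2)"
  have c0: "c \<noteq> 0"
  proof
    assume "c = 0"
    then obtain n :: int where "w = of_int (2 * n + 1)" unfolding c_def by (rule cos_half_pi_eq_0D)
    hence "real_of_int (2 * n + 1) = 3 / 2" using w by simp
    hence "real_of_int (2 * (2 * n + 1)) = real_of_int 3" by simp
    hence "2 * (2 * n + 1) = 3" by (simp only: of_int_eq_iff)
    thus False by presburger
  qed
  define P where "P = (2 * of_real pi) powr (- w)"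
  have fe: "zeta (1 - w) = 2 * P * c * Gamma w * zeta w"
    unfolding P_def c_def by (rule zeta_functional_equation) (use w in \<open>auto dest: nonpos_Ints_Re_le\<close>)
  have pw: "P ^ k * of_real ((pi / \<alpha>) ^ k) powr w = of_real ((2 * \<alpha>) ^ k) powr (- w)"
  proof -
    have P: "P = exp (- w * complex_of_real (ln (2 * pi)))"
      using of_real_powr_exp[of "2 * pi" "- w"] by (simp add: P_def)
    have "of_real ((pi / \<alpha>) ^ k) powr w = exp (w * complex_of_real (ln ((pi / \<alpha>) ^ k)))"
      by (rule of_real_powr_exp) (use \<alpha> in simp)
    also have "ln ((pi / \<alpha>) ^ k) = real k * (ln pi - ln \<alpha>)" using \<alpha> by (simp add: ln_realpow ln_div)
    finally have 1: "of_real ((pi / \<alpha>) ^ k) powr w = exp (w * complex_of_real (real k * (ln pi - ln \<alpha>)))" .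
    have "of_real ((2 * \<alpha>) ^ k) powr (- w) = exp (- w * complex_of_real (ln ((2 * \<alpha>) ^ k)))"
      by (rule of_real_powr_exp) (use \<alpha> in simp)
    also have "ln ((2 * \<alpha>) ^ k) = real k * (ln 2 + ln \<alpha>)" using \<alpha> by (simp add: ln_realpow ln_mult distrib_left)
    finally have 2: "of_real ((2 * \<alpha>) ^ k) powr (- w) = exp (- w * complex_of_real (real k * (ln 2 + ln \<alpha>)))" .
    have "P ^ k * of_real ((pi / \<alpha>) ^ k) powr w = exp (of_nat k * (- w * complex_of_real (ln (2 * pi))) + w * complex_of_real (real k * (ln pi - ln \<alpha>)))"
      unfolding 1 by (simp only: P exp_add exp_of_nat_mult)
    also have "ln (2 * pi) = ln 2 + ln pi" by (simp add: ln_mult)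
    also have "of_nat k * (- w * complex_of_real (ln 2 + ln pi)) + w * complex_of_real (real k * (ln pi - ln \<alpha>))
       = - w * complex_of_real (real k * (ln 2 + ln \<alpha>))" by (simp add: algebra_simps)
    finally show ?thesis unfolding 2 .
  qed
  have "1 / 2 ^ k * (even_kernel k w * of_real ((pi / \<alpha>) ^ k) powr w)
     = 1 / 2 ^ k * ((2 * P * c * Gamma w * zeta w * zeta (1 + w)) ^ k / c * of_real ((pi / \<alpha>) ^ k) powr w)"
    by (simp add: even_kernel_def fe c_def)
  also have "\<dots> = c ^ k / c * Gamma w ^ k * zeta w ^ k * zeta (1 + w) ^ k * (P ^ k * of_real ((pi / \<alpha>) ^ k) powr w)"
    by (simp add: power_mult_distrib)
  also have "c ^ k / c = c ^ (k - 1)" using c0 by (simp add: m)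
  finally show ?thesis unfolding pw c_def by (simp add: mult_ac)
qed

text \<open>
  The zeta factors grow polynomially, and the cosine in the denominator exponentially. On
  \<open>|Re w| \<le> 3/2\<close> the arguments \<open>1 \<plusminus> w\<close> stay in the half-plane \<open>Re s \<ge> -1/2\<close>, where the growth of zeta
  is known from the trapezoidal rule.
\<close>

lemma even_kernel_decay:
  "\<exists>C\<ge>0. \<forall>w. \<bar>Re w\<bar> \<le> 3 / 2 \<and> \<bar>Im w\<bar> \<ge> 1 \<longrightarrow> norm (even_kernel k w) \<le> C / (1 + (Im w)\<^sup>2)"
proof -
  obtain Z where Z: "Z \<ge> 0" "\<And>s. Re s \<ge> -1/2 \<Longrightarrow> Re s \<le> 5/2 \<Longrightarrow> \<bar>Im s\<bar> \<ge> 1 \<Longrightarrow> norm (zeta s) \<le> Z * (1 + \<bar>Im s\<bar>) ^ 2"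
    using zeta_growth by metis
  obtain D where D: "D > 0" "\<And>t. t \<ge> 0 \<Longrightarrow> (1 + t) ^ (4 * k + 2) * exp (- (pi / 2 * t)) \<le> D"
    using power_times_exp_bounded[of "pi / 2" "4 * k + 2"] by auto
  show ?thesis
  proof (rule exI[of _ "4 * (Z * Z) ^ k * D"], intro conjI allI impI)
    show "0 \<le> 4 * (Z * Z) ^ k * D" using Z D by simp
    fix w :: complex assume w: "\<bar>Re w\<bar> \<le> 3 / 2 \<and> \<bar>Im w\<bar> \<ge> 1"
    define t where "t = \<bar>Im w\<bar>"
    have t: "t \<ge> 1" using w by (simp add: t_def)
    \<comment> \<open>the arguments \<open>1 \<plusminus> w\<close> lie in the strip of the growth bound\<close>
    have rw: "-3/2 \<le> Re w" "Re w \<le> 3/2" "1 \<le> \<bar>Im w\<bar>" using w[THEN conjunct1] w[THEN conjunct2] by linarith+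
    have z1: "norm (zeta (1 - w)) \<le> Z * (1 + t) ^ 2"
      by (rule order_trans[OF Z(2)]) (use rw in \<open>auto simp: t_def\<close>)
    have z2: "norm (zeta (1 + w)) \<le> Z * (1 + t) ^ 2"
      by (rule order_trans[OF Z(2)]) (use rw in \<open>auto simp: t_def\<close>)
    define e where "e = exp (pi / 2 * t)"
    \<comment> \<open>this keeps the cosine away from zero for \<open>|Im w| \<ge> 1\<close>\<close>
    have e2: "e \<ge> 2"
    proof -
      have "1 * 1 \<le> pi / 2 * t" using pi_ge_two t by (intro mult_mono) auto
      hence "1 + 1 \<le> 1 + pi / 2 * t" by simp
      also have "\<dots> \<le> e" unfolding e_def by (rule exp_ge_add_one_self)
      finally show ?thesis by simp
    qed
    have cosb: "norm (cos (of_real pi * w / 2)) \<ge> e / 4"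
    proof -
      have "(exp \<bar>Im (of_real pi * w / 2)\<bar> - exp (- \<bar>Im (of_real pi * w / 2)\<bar>)) / 2 \<le> norm (cos (of_real pi * w / 2))"
        by (rule norm_cos_ge_exp)
      moreover have "\<bar>Im (of_real pi * w / 2)\<bar> = pi / 2 * t" by (simp add: t_def abs_mult)
      moreover have "exp (- (pi / 2 * t)) \<le> e / 2"
      proof -
        have "exp (- (pi / 2 * t)) = 1 / e" by (simp add: e_def exp_minus inverse_eq_divide)
        also have "\<dots> \<le> 1" using e2 by simp
        finally show ?thesis using e2 by linarith
      qed
      ultimately show ?thesis by (simp add: e_def)
    qed
    have "norm (even_kernel k w) = (norm (zeta (1 - w)) * norm (zeta (1 + w))) ^ k / norm (cos (of_real pi * w / 2))"
      by (simp add: even_kernel_def norm_divide norm_mult norm_power)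
    also have "\<dots> \<le> ((Z * (1 + t) ^ 2) * (Z * (1 + t) ^ 2)) ^ k / (e / 4)"
      using e2 t Z(1) by (intro frac_le power_mono mult_mono z1 z2 cosb) auto
    also have "\<dots> = 4 * (Z * Z) ^ k * ((1 + t) ^ (4 * k) * exp (- (pi / 2 * t)))"
    proof -
      have "(Z * (1 + t) ^ 2) * (Z * (1 + t) ^ 2) = (Z * Z) * (1 + t) ^ 4" by (simp add: power2_eq_square power4_eq_xxxx)
      hence "((Z * (1 + t) ^ 2) * (Z * (1 + t) ^ 2)) ^ k = (Z * Z) ^ k * (1 + t) ^ (4 * k)"
        by (simp only: power_mult_distrib power_mult)
      moreover have "exp (- (pi / 2 * t)) = 1 / e" by (simp add: e_def exp_minus inverse_eq_divide)
      ultimately show ?thesis by simp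
    qed
    also have "\<dots> \<le> 4 * (Z * Z) ^ k * (D / (1 + (Im w)\<^sup>2))"
    proof (intro mult_left_mono)
      have "1 + (Im w)\<^sup>2 \<le> (1 + t) ^ 2" using t by (simp add: t_def power2_eq_square algebra_simps)
      hence "(1 + t) ^ (4 * k) * exp (- (pi / 2 * t)) * (1 + (Im w)\<^sup>2) \<le> (1 + t) ^ (4 * k) * exp (- (pi / 2 * t)) * (1 + t) ^ 2"
        using t by (intro mult_left_mono) auto
      also have "\<dots> = (1 + t) ^ (4 * k + 2) * exp (- (pi / 2 * t))" by (simp add: power_add power2_eq_square)
      also have "\<dots> \<le> D" by (rule D(2)) (use t in simp)
      finally show "(1 + t) ^ (4 * k) * exp (- (pi / 2 * t)) \<le> D / (1 + (Im w)\<^sup>2)"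
        by (simp add: pos_le_divide_eq add_pos_nonneg)
    qed (use Z in auto)
    finally show "norm (even_kernel k w) \<le> 4 * (Z * Z) ^ k * D / (1 + (Im w)\<^sup>2)" by simp
  qed
qed

lemma even_kernel_numerator_holomorphic:
  assumes X: "X > 0" and A: "0 \<notin> A"
  shows "(\<lambda>w. (zeta (1 - w) * zeta (1 + w)) ^ k * of_real X powr w) holomorphic_on A"
proof -
  have "(zeta \<circ> (\<lambda>w. 1 - w)) holomorphic_on A"
    by (rule holomorphic_on_compose_gen[OF _ holomorphic_zeta]) (use A in \<open>auto intro!: holomorphic_intros\<close>)
  moreover have "(zeta \<circ> (\<lambda>w. 1 + w)) holomorphic_on A"
    by (rule holomorphic_on_compose_gen[OF _ holomorphic_zeta]) (use A in \<open>auto intro!: holomorphic_intros\<close>)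
  ultimately show ?thesis unfolding o_def using X by (intro holomorphic_intros) auto
qed

lemma residue_even_kernel_at_pm1:
  assumes X: "X > 0" and p: "p = 1 \<or> p = -1"
  shows "residue (\<lambda>w. even_kernel k w * of_real X powr w) p = - (2 * p / of_real pi) * of_real (- (pi\<^sup>2 / 12)) ^ k * of_real X powr p"
proof -
  let ?N = "\<lambda>w. (zeta (1 - w) * zeta (1 + w)) ^ k * of_real X powr w"
  have "zeta (1 - p) * zeta (1 + p) = of_real (- (pi\<^sup>2 / 12))"
    using p by (auto simp: zeta_0 zeta_2)
  hence N: "?N p = of_real (- (pi\<^sup>2 / 12)) ^ k * of_real X powr p" by simp
  have cp: "cos (of_real pi * p / 2) = 0" and sp: "sin (of_real pi * p / 2) = p" using p by auto
  have p2: "p * p = 1" "p \<noteq> 0" using p by auto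
  have "residue (\<lambda>w. ?N w / cos (of_real pi * w / 2)) p = ?N p / (- (of_real pi / 2 * p))"
  proof (rule residue_simple_pole_deriv)
    show "?N holomorphic_on - {0}" by (rule even_kernel_numerator_holomorphic[OF X]) simp
    show "(\<lambda>w. cos (of_real pi * w / 2)) holomorphic_on - {0}" by (intro holomorphic_intros) auto
    show "((\<lambda>w. cos (of_real pi * w / 2)) has_field_derivative - (of_real pi / 2 * p)) (at p)"
      by (auto intro!: derivative_eq_intros simp: sp)
    show "connected (- {0 :: complex})" by (rule connected_punctured_universe) simp
    show "?N p \<noteq> 0" unfolding N using X by simp
  qed (use p2 cp in auto)
  also have "?N p / (- (of_real pi / 2 * p)) = - (2 * p / of_real pi) * ?N p"
    using p by (auto simp: field_simps)
  finally show ?thesis unfolding N even_kernel_def by (simp add: mult_ac)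
qed

text \<open>
  The functional equation at \<open>w\<close> and at \<open>-w\<close> gives
  \<open>\<zeta>(1-w) \<zeta>(1+w) = 4 cos\<^sup>2(\<pi>w/2) \<Gamma>(w) \<Gamma>(-w) \<zeta>(w) \<zeta>(-w)\<close>, where each Gamma factor has a simple pole at
  \<open>0\<close>. Splitting these poles off leaves a function that is holomorphic near \<open>0\<close>, over \<open>w\<^bsup>2k\<^esup>\<close>.
\<close>

lemma even_kernel_near_0:
  assumes w: "w \<noteq> 0" "norm w < 1" and k: "k \<ge> 1"
  shows "even_kernel k w = (-4) ^ k * (Gamma (1 + w) ^ k * Gamma (1 - w) ^ k * zeta w ^ k * zeta (- w) ^ k *
           cos (of_real pi * w / 2) ^ (2 * k - 1)) / w ^ (2 * k)"
proof -
  have nI: "w \<notin> \<int>" 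
  proof
    assume "w \<in> \<int>"
    then obtain n :: int where n: "w = of_int n" by (auto elim: Ints_cases)
    hence "\<bar>real_of_int n\<bar> < 1" using w(2) by simp
    hence "n = 0" by linarith
    thus False using w n by simp
  qed
  define c where "c = cos (of_real pi * w / 2)"
  have c0: "c \<noteq> 0"
  proof
    assume "c = 0"
    then obtain n :: int where "w = of_int (2 * n + 1)" unfolding c_def by (rule cos_half_pi_eq_0D)
    thus False using nI by simp
  qed
  define P where "P = (2 * complex_of_real pi) powr w"
  have P0: "P \<noteq> 0" by (simp add: P_def)
  have f1: "zeta (1 - w) = 2 * inverse P * c * Gamma w * zeta w"
    unfolding P_def c_def powr_minus[symmetric]
    by (rule zeta_functional_equation) (use nI nonpos_Ints_Int in auto)
  have "- w \<notin> \<int>" using nI by (metis Ints_minus minus_minus)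
  hence np: "w \<notin> \<int>\<^sub>\<le>\<^sub>0" "- w \<notin> \<int>\<^sub>\<le>\<^sub>0"
    using nI nonpos_Ints_Int[of w] nonpos_Ints_Int[of "- w"] by auto
  have w1: "- w \<noteq> 1" using \<open>- w \<notin> \<int>\<close> by (metis Ints_1)
  have f2: "zeta (1 + w) = 2 * P * c * Gamma (- w) * zeta (- w)"
    using zeta_functional_equation[OF np(2) w1] by (simp add: P_def c_def)
  have G1: "Gamma (1 + w) = w * Gamma w" using Gamma_plus1[OF np(1)] by (simp add: add.commute)
  have G2: "Gamma (1 - w) = - w * Gamma (- w)" using Gamma_plus1[OF np(2)] by simp
  have prod: "zeta (1 - w) * zeta (1 + w) = - 4 * (Gamma (1 + w) * Gamma (1 - w) * zeta w * zeta (- w)) * c\<^sup>2 / w\<^sup>2"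
    unfolding f1 f2 G1 G2 using P0 w(1) by (simp add: field_simps power2_eq_square)
  have "even_kernel k w = (- 4 * (Gamma (1 + w) * Gamma (1 - w) * zeta w * zeta (- w)) * c\<^sup>2 / w\<^sup>2) ^ k / c"
    by (simp only: even_kernel_def prod c_def)
  also have "\<dots> = (- 4) ^ k * (Gamma (1 + w) ^ k * Gamma (1 - w) ^ k * zeta w ^ k * zeta (- w) ^ k * (c ^ (2 * k) / c)) / w ^ (2 * k)"
    unfolding power_mult[of _ 2 k]
    by (simp only: power_mult_distrib power_divide times_divide_eq_left times_divide_eq_right divide_divide_eq_left mult_ac)
  also have "c ^ (2 * k) / c = c ^ (2 * k - 1)"
  proof -
    have "2 * k = Suc (2 * k - 1)" using k by simp
    hence "c ^ (2 * k) = c * c ^ (2 * k - 1)" by (metis power_Suc)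
    thus ?thesis using c0 by simp
  qed
  finally show ?thesis by (simp add: c_def)
qed

lemma residue_even_kernel_at_0:
  assumes X: "X > 0" and k: "k \<ge> 1"
  shows "residue (\<lambda>w. even_kernel k w * of_real X powr w) 0 = (-4) ^ k / fact (2 * k - 1) *
     (deriv ^^ (2 * k - 1)) (\<lambda>s. Gamma (1 + s) ^ k * Gamma (1 - s) ^ k * zeta s ^ k * zeta (- s) ^ k *
        cos (of_real pi * s / 2) ^ (2 * k - 1) * of_real X powr s) 0"
proof -
  let ?g = "\<lambda>s. Gamma (1 + s) ^ k * Gamma (1 - s) ^ k * zeta s ^ k * zeta (- s) ^ k * cos (of_real pi * s / 2) ^ (2 * k - 1) * of_real X powr s"
  let ?B = "ball 0 1 :: complex set"
  have z1: "1 \<notin> ?B" "-1 \<notin> ?B" by auto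
  have re: "\<bar>Re s\<bar> < 1" if "s \<in> ?B" for s using that abs_Re_le_cmod[of s] by simp
  have "- s \<noteq> 1" if "s \<in> ?B" for s
  proof
    assume "- s = 1"
    hence "norm (- s) = norm (1 :: complex)" by (simp only:)
    thus False using that by simp
  qed
  hence "(zeta \<circ> uminus) holomorphic_on ?B"
    by (intro holomorphic_on_compose_gen[OF _ holomorphic_zeta] holomorphic_intros image_subsetI) blast
  moreover have "zeta holomorphic_on ?B" by (rule holomorphic_on_subset[OF holomorphic_zeta]) auto
  moreover have "1 + s \<notin> \<int>\<^sub>\<le>\<^sub>0" "1 - s \<notin> \<int>\<^sub>\<le>\<^sub>0" if "s \<in> ?B" for s
    using re[OF that] by (auto dest!: nonpos_Ints_Re_le)
  ultimately have hol: "?g holomorphic_on ?B" unfolding o_def using X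
    by (intro holomorphic_intros) auto
  have k2: "2 * k = Suc (2 * k - 1)" using k by simp
  have e: "even_kernel k w * of_real X powr w = ((-4) ^ k * ?g w) / w ^ Suc (2 * k - 1)" if "w \<noteq> 0" "norm w < 1" for w
    unfolding even_kernel_near_0[OF that k] by (simp only: k2[symmetric] times_divide_eq_left mult.assoc)
  have "eventually (\<lambda>w. w \<in> ?B - {0}) (at (0 :: complex))"
    by (rule eventually_at_in_open) auto
  hence "eventually (\<lambda>w. even_kernel k w * of_real X powr w = ((-4) ^ k * ?g w) / w ^ Suc (2 * k - 1)) (at 0)"
    by eventually_elim (use e in auto)
  hence "residue (\<lambda>w. even_kernel k w * of_real X powr w) 0 = residue (\<lambda>w. ((-4) ^ k * ?g w) / w ^ Suc (2 * k - 1)) 0"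
    by (rule residue_cong) simp
  also have "\<dots> = (deriv ^^ (2 * k - 1)) (\<lambda>w. (-4) ^ k * ?g w) 0 / fact (2 * k - 1)"
    by (rule residue_holomorphic_over_power'[OF open_ball _ holomorphic_on_mult[OF holomorphic_on_const hol]]) simp
  also have "(deriv ^^ (2 * k - 1)) (\<lambda>w. (-4) ^ k * ?g w) 0 = (-4) ^ k * (deriv ^^ (2 * k - 1)) ?g 0"
    by (rule higher_deriv_cmult[OF hol]) auto
  finally show ?thesis by simp
qed

text \<open>
  Reflecting the line \<open>Re w = -3/2\<close> to \<open>Re w = 3/2\<close> changes only the sign of the exponent, as the kernel is
  even.
\<close>

lemma even_kernel_line_shift:
  assumes X: "X > 0"
  shows "(LINT t|lborel. even_kernel k (Complex (3/2) t) * of_real X powr (Complex (3/2) t))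
       - (LINT t|lborel. even_kernel k (Complex (3/2) t) * of_real X powr (- Complex (3/2) t))
       = 2 * of_real pi * (residue (\<lambda>w. even_kernel k w * of_real X powr w) 0
          + residue (\<lambda>w. even_kernel k w * of_real X powr w) 1 + residue (\<lambda>w. even_kernel k w * of_real X powr w) (-1))"
proof -
  let ?f = "\<lambda>w. even_kernel k w * of_real X powr w"
  let ?S = "{w. Re w > -2} \<inter> {w. Re w < 2}"
  obtain C where C: "C \<ge> 0" "\<And>w. \<bar>Re w\<bar> \<le> 3 / 2 \<Longrightarrow> \<bar>Im w\<bar> \<ge> 1 \<Longrightarrow> norm (even_kernel k w) \<le> C / (1 + (Im w)\<^sup>2)"
    using even_kernel_decay by metis
  let ?Y = "X powr (-3/2) + X powr (3/2)"
  have "(LINT t|lborel. ?f (Complex (3/2) t)) - (LINT t|lborel. ?f (Complex (-3/2) t)) = 2 * of_real pi * (\<Sum>p\<in>{0,1,-1}. residue ?f p)"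
  proof (rule vertical_line_shift(3)[where C = "C * ?Y"])
    show "open ?S" by (intro open_Int open_halfspace_Re_gt open_halfspace_Re_lt)
    show "connected ?S" by (intro convex_connected convex_Int convex_halfspace_Re_gt convex_halfspace_Re_lt)
    have "(\<lambda>w. ((zeta (1 - w) * zeta (1 + w)) ^ k * of_real X powr w) / cos (of_real pi * w / 2)) holomorphic_on ?S - {0,1,-1}"
    proof (rule holomorphic_on_divide[OF even_kernel_numerator_holomorphic[OF X]])
      show "cos (of_real pi * w / 2) \<noteq> 0" if w: "w \<in> ?S - {0,1,-1}" for w
      proof
        assume "cos (of_real pi * w / 2) = 0"
        then obtain n :: int where n: "w = of_int (2 * n + 1)" by (rule cos_half_pi_eq_0D)
        hence "Re w = real_of_int (2 * n + 1)" by simp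
        moreover have "-2 < Re w" "Re w < 2" using w by simp_all
        ultimately have "-2 < real_of_int (2 * n + 1)" "real_of_int (2 * n + 1) < 2" by simp_all
        hence "-2 < 2 * n + 1" "2 * n + 1 < 2" by linarith+
        hence "n = 0 \<or> n = -1" by linarith
        hence "w = 1 \<or> w = -1"
        proof
          assume "n = 0" thus ?thesis using n by simp
        next
          assume "n = -1" thus ?thesis using n by simp
        qed
        thus False using w by blast
      qed
    qed (auto intro!: holomorphic_intros)
    thus "?f holomorphic_on ?S - {0,1,-1}" by (simp add: even_kernel_def)
    show "norm (?f w) \<le> C * ?Y / (1 + (Im w)\<^sup>2)" if w: "-3/2 \<le> Re w" "Re w \<le> 3/2" "1 \<le> \<bar>Im w\<bar>" for w
    proof -
      have "norm (?f w) = norm (even_kernel k w) * X powr (Re w)" using X by (simp add: norm_mult norm_powr_real_powr)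
      also have "\<dots> \<le> C / (1 + (Im w)\<^sup>2) * ?Y"
        using w X C(1) by (intro mult_mono C(2) powr_strip_bound) (auto simp: abs_le_iff)
      finally show ?thesis by simp
    qed
  qed auto
  also have "(LINT t|lborel. ?f (Complex (-3/2) t)) = (LINT t|lborel. ?f (Complex (-3/2) (0 + (-1) * t)))"
    using lborel_integral_real_affine[of "-1" "\<lambda>t. ?f (Complex (-3/2) t)" 0] by simp
  also have "(\<lambda>t. ?f (Complex (-3/2) (0 + (-1) * t))) = (\<lambda>t. even_kernel k (Complex (3/2) t) * of_real X powr (- Complex (3/2) t))"
  proof
    fix t
    have "Complex (-3/2) (0 + (-1) * t) = - Complex (3/2) t" by (simp add: complex_eq_iff)
    thus "?f (Complex (-3/2) (0 + (-1) * t)) = even_kernel k (Complex (3/2) t) * of_real X powr (- Complex (3/2) t)"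
      by (simp only: even_kernel_minus)
  qed
  finally show ?thesis by (simp add: add.assoc)
qed

section \<open>The Psi series as a line integral\<close>

definition mellin_kernel :: "nat \<Rightarrow> complex \<Rightarrow> complex" where
  "mellin_kernel k w = Gamma w ^ k * cos (of_real pi * w / 2) ^ (k - 1)"

definition mellin_inverse :: "nat \<Rightarrow> real \<Rightarrow> real \<Rightarrow> complex" where
  "mellin_inverse k c y =
     1 / (2 * of_real pi) * (LINT t|lborel. mellin_kernel k (Complex c t) * of_real y powr (- Complex c t))"

text \<open>
  Reflection removes the Gamma factors from the denominator at the cost of \<open>k-1\<close> cosines, and
  duplication merges \<open>\<Gamma>(-s) \<Gamma>(1/2-s)\<close> into \<open>\<Gamma>(-2s)\<close>. The power \<open>4\<^bsup>ks\<^esup>\<close> from the duplication formula cancels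
  against the denominator \<open>2\<^bsup>2k\<^esup>\<close> of the argument.
\<close>

lemma meijer_G_integrand_eq:
  assumes k: "k \<ge> 1" and Y: "Y > 0" and s: "Re s < 0"
  shows "meijer_G_integrand k (Y\<^sup>2 / 2 ^ (2 * k)) s =
    of_real (2 ^ k * pi powr (1 - real k / 2)) * (mellin_kernel k (- 2 * s) * of_real Y powr (2 * s))"
proof -
  obtain m where m: "k = Suc m" using k by (cases k) auto
  have refl: "1 / Gamma (1 / 2 + s) = Gamma (1 / 2 - s) * cos (of_real pi * s) / of_real pi"
  proof -
    define p q where "p = rGamma (1 / 2 + s)" and "q = rGamma (1 / 2 - s)"
    have "rGamma (1 / 2 + s) * rGamma (1 - (1 / 2 + s)) = sin (of_real pi * (1 / 2 + s)) / of_real pi"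
      by (rule rGamma_reflection_complex)
    moreover have "1 - (1 / 2 + s) = 1 / 2 - s" by simp
    moreover have "sin (of_real pi * (1 / 2 + s)) = cos (of_real pi * s)"
      by (simp add: distrib_left sin_add)
    ultimately have pq: "p * q = cos (of_real pi * s) / of_real pi" by (simp only: p_def q_def)
    have q0: "q \<noteq> 0" unfolding q_def using s by (auto simp: rGamma_eq_zero_iff dest: nonpos_Ints_Re_le)
    have "Gamma (1 / 2 - s) = inverse q" "1 / Gamma (1 / 2 + s) = p"
      by (simp_all add: p_def q_def rGamma_inverse_Gamma inverse_eq_divide)
    moreover have "p = inverse q * (p * q)" using q0 by simp
    ultimately show ?thesis unfolding pq by simp
  qed
  \<comment> \<open>\<open>E = 4\<^sup>s\<close>\<close>
  define E where "E = exp (2 * s * of_real (ln 2))"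
  have dup: "Gamma (- s) * Gamma (1 / 2 - s) = 2 * E * of_real (sqrt pi) * Gamma (- 2 * s)"
  proof -
    have "Gamma (- s) * Gamma (- s + 1 / 2) = exp ((1 - 2 * (- s)) * of_real (ln 2)) * of_real (sqrt pi) * Gamma (2 * (- s))"
      by (rule Gamma_legendre_duplication) (use s in \<open>auto dest: nonpos_Ints_Re_le\<close>)
    moreover have "exp ((1 - 2 * (- s)) * of_real (ln 2)) = 2 * E"
    proof -
      have "exp ((1 - 2 * (- s)) * of_real (ln 2)) = exp (complex_of_real (ln 2)) * E"
        unfolding E_def by (simp add: distrib_right flip: exp_add)
      also have "exp (complex_of_real (ln 2)) = of_real (exp (ln 2))" by (rule exp_of_real)
      finally show ?thesis by simp
    qed
    ultimately show ?thesis by simp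
  qed
  have zp: "of_real (Y\<^sup>2 / 2 ^ (2 * k)) powr s = of_real Y powr (2 * s) * inverse E ^ k"
  proof -
    have pow: "of_real z powr w = exp (w * of_real (ln z))" if "z > 0" for z :: real and w :: complex
      using that by (simp add: powr_def Ln_of_real)
    have "of_real (Y\<^sup>2 / 2 ^ (2 * k)) powr s = exp (s * of_real (ln (Y\<^sup>2 / 2 ^ (2 * k))))"
      by (rule pow) (use Y in simp)
    also have "ln (Y\<^sup>2 / 2 ^ (2 * k)) = 2 * ln Y - real k * (2 * ln 2)"
      using Y by (simp add: ln_div ln_realpow)
    also have "s * of_real (2 * ln Y - real k * (2 * ln 2)) = 2 * s * of_real (ln Y) + of_nat k * (- (2 * s * of_real (ln 2)))"
      by (simp add: algebra_simps)
    also have "exp \<dots> = exp (2 * s * of_real (ln Y)) * inverse E ^ k"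
      by (simp only: exp_add exp_of_nat_mult exp_minus E_def)
    also have "exp (2 * s * of_real (ln Y)) = of_real Y powr (2 * s)"
      using Y by (simp add: powr_def Ln_of_real)
    finally show ?thesis .
  qed
  have E0: "E \<noteq> 0" by (simp add: E_def)
  have pi: "pi powr (1 - real k / 2) = sqrt pi ^ k / pi ^ m"
  proof -
    have "pi powr (1 - real k / 2) = pi powr (real k / 2 - real m)" by (simp add: m field_simps)
    also have "\<dots> = pi powr (real k / 2) / pi powr real m" by (rule powr_diff)
    also have "pi powr real m = pi ^ m" by (simp add: powr_realpow)
    also have "pi powr (real k / 2) = (pi powr (1 / 2)) powr real k" by (simp add: powr_powr)
    also have "\<dots> = sqrt pi ^ k" by (simp add: powr_half_sqrt powr_realpow)
    finally show ?thesis .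
  qed
  have "meijer_G_integrand k (Y\<^sup>2 / 2 ^ (2 * k)) s =
     Gamma (- s) ^ k * Gamma (1 / 2 - s) * (1 / Gamma (1 / 2 + s)) ^ m * of_real (Y\<^sup>2 / 2 ^ (2 * k)) powr s"
    by (simp add: meijer_G_integrand_def m power_divide)
  also have "\<dots> = (Gamma (- s) * Gamma (1 / 2 - s)) ^ k * cos (of_real pi * s) ^ m / of_real pi ^ m * (of_real Y powr (2 * s) * inverse E ^ k)"
    unfolding refl zp by (simp add: m power_mult_distrib power_divide)
  also have "\<dots> = 2 ^ k * (E * inverse E) ^ k * (of_real (sqrt pi) ^ k / of_real pi ^ m) * Gamma (- 2 * s) ^ k * cos (of_real pi * s) ^ m * of_real Y powr (2 * s)"
    unfolding dup by (simp add: power_mult_distrib)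
  also have "E * inverse E = 1" using E0 by simp
  also have "of_real (sqrt pi) ^ k / of_real pi ^ m = complex_of_real (pi powr (1 - real k / 2))" by (simp add: pi)
  also have "cos (of_real pi * s) = cos (of_real pi * (- 2 * s) / 2)" by simp
  finally show ?thesis by (simp add: mellin_kernel_def m)
qed

lemma meijer_G_eq_mellin_inverse:
  assumes k: "k \<ge> 1" and Y: "Y > 0" and mu: "\<mu> < 0"
  shows "of_real (pi powr (real k / 2 - 1) / 2 ^ (k - 1)) * meijer_G \<mu> k (Y\<^sup>2 / 2 ^ (2 * k)) = mellin_inverse k (-2 * \<mu>) Y"
proof -
  let ?h = "\<lambda>u. mellin_kernel k (Complex (-2 * \<mu>) u) * of_real Y powr (- Complex (-2 * \<mu>) u)"
  let ?P = "complex_of_real (2 ^ k * pi powr (1 - real k / 2))"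
  have "meijer_G_integrand k (Y\<^sup>2 / 2 ^ (2 * k)) (Complex \<mu> t) * \<i> = (?P * \<i>) * ?h (0 + (-2) * t)" for t
  proof -
    have "- 2 * Complex \<mu> t = Complex (-2 * \<mu>) (0 + (-2) * t)" by (simp add: complex_eq_iff)
    moreover have "2 * Complex \<mu> t = - Complex (-2 * \<mu>) (0 + (-2) * t)" by (simp add: complex_eq_iff)
    ultimately show ?thesis using meijer_G_integrand_eq[OF k Y, of "Complex \<mu> t"] mu by simp
  qed
  hence "meijer_G \<mu> k (Y\<^sup>2 / 2 ^ (2 * k)) = 1 / (2 * of_real pi * \<i>) * (?P * \<i> * (LINT t|lborel. ?h (0 + (-2) * t)))"
    unfolding meijer_G_def by simp
  also have "(LINT t|lborel. ?h (0 + (-2) * t)) = (LINT u|lborel. ?h u) / 2"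
    using lborel_integral_real_affine[of "-2" ?h 0] by (simp add: scaleR_conv_of_real)
  finally have G: "meijer_G \<mu> k (Y\<^sup>2 / 2 ^ (2 * k)) = ?P / 2 * mellin_inverse k (-2 * \<mu>) Y"
    by (simp add: mellin_inverse_def)
  have "pi powr (real k / 2 - 1) * pi powr (1 - real k / 2) = 1" by (simp flip: powr_add)
  moreover have "(2 :: real) ^ k = 2 * 2 ^ (k - 1)" using k by (cases k) auto
  ultimately have one: "pi powr (real k / 2 - 1) / 2 ^ (k - 1) * (2 ^ k * pi powr (1 - real k / 2) / 2) = 1"
    by simp
  have "of_real A * (of_real B / 2 * M) = of_real (A * (B / 2)) * M" for A B :: real and M :: complex by simp
  thus ?thesis unfolding G by (simp only: one of_real_1 mult_1)
qed

text \<open>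
  Each of the \<open>k\<close> Gamma factors decays like \<open>e\<^bsup>-\<pi>|t|/2\<^esup>\<close> and each of the \<open>k-1\<close> cosines grows at most like
  \<open>e\<^bsup>\<pi>|t|/2\<^esup>\<close>, so one exponential is left.
\<close>

lemma mellin_kernel_decay:
  assumes a: "a > 0" and k: "k \<ge> 1"
  shows "\<exists>C\<ge>0. \<forall>w. a \<le> Re w \<and> Re w \<le> b \<longrightarrow> norm (mellin_kernel k w) \<le> C / (1 + (Im w)\<^sup>2)"
proof -
  obtain m where m: "k = Suc m" using k by (cases k) auto
  obtain C M where C: "C > 0" "\<And>z. a \<le> Re z \<Longrightarrow> Re z \<le> b \<Longrightarrow> norm (Gamma z) \<le> C * (1 + \<bar>Im z\<bar>) ^ M * exp (- (pi * \<bar>Im z\<bar> / 2))"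
    using norm_Gamma_vertical_strip[OF a, of b] by metis
  obtain D where D: "D > 0" "\<And>t. t \<ge> 0 \<Longrightarrow> (1 + t) ^ (M * k + 2) * exp (- (pi / 2 * t)) \<le> D"
    using power_times_exp_bounded[of "pi / 2" "M * k + 2"] by auto
  show ?thesis
  proof (rule exI[of _ "C ^ k * D"], intro conjI allI impI)
    show "0 \<le> C ^ k * D" using C D by simp
    fix w assume w: "a \<le> Re w \<and> Re w \<le> b"
    define t where "t = \<bar>Im w\<bar>"
    have t: "t \<ge> 0" by (simp add: t_def)
    have "norm (mellin_kernel k w) = norm (Gamma w) ^ k * norm (cos (of_real pi * w / 2)) ^ m"
      by (simp add: mellin_kernel_def m norm_mult norm_power)
    also have "\<dots> \<le> (C * (1 + t) ^ M * exp (- (pi * t / 2))) ^ k * exp (pi * t / 2) ^ m"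
    proof (intro mult_mono power_mono)
      show "norm (Gamma w) \<le> C * (1 + t) ^ M * exp (- (pi * t / 2))" using C(2)[of w] w by (simp add: t_def)
      show "norm (cos (of_real pi * w / 2)) \<le> exp (pi * t / 2)"
        using norm_cos_le_exp[of "of_real pi * w / 2"] by (simp add: t_def abs_mult)
    qed (use C t in auto)
    also have "\<dots> = C ^ k * ((1 + t) ^ (M * k) * (exp (- (pi / 2 * t)) ^ k * exp (pi / 2 * t) ^ m))"
      by (simp add: power_mult_distrib power_mult)
    also have "exp (- (pi / 2 * t)) ^ k * exp (pi / 2 * t) ^ m = exp (- (pi / 2 * t))"
      by (simp add: m exp_minus power_inverse)
    also have "(1 + t) ^ (M * k) * exp (- (pi / 2 * t)) \<le> D / (1 + (Im w)\<^sup>2)"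
    proof -
      have "1 + (Im w)\<^sup>2 \<le> (1 + t) ^ 2" using t by (simp add: t_def power2_eq_square algebra_simps)
      hence "(1 + t) ^ (M * k) * exp (- (pi / 2 * t)) * (1 + (Im w)\<^sup>2) \<le> (1 + t) ^ (M * k) * exp (- (pi / 2 * t)) * (1 + t) ^ 2"
        using t by (intro mult_left_mono) auto
      also have "\<dots> = (1 + t) ^ (M * k + 2) * exp (- (pi / 2 * t))" by (simp add: power_add power2_eq_square)
      also have "\<dots> \<le> D" by (rule D(2)[OF t])
      finally show ?thesis by (simp add: pos_le_divide_eq add_pos_nonneg)
    qed
    hence "C ^ k * ((1 + t) ^ (M * k) * exp (- (pi / 2 * t))) \<le> C ^ k * (D / (1 + (Im w)\<^sup>2))"
      using C by (intro mult_left_mono) auto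
    finally show "norm (mellin_kernel k w) \<le> C ^ k * D / (1 + (Im w)\<^sup>2)" by simp
  qed
qed

lemma holomorphic_mellin_kernel: "mellin_kernel k holomorphic_on {w. Re w > 0}"
  unfolding mellin_kernel_def by (intro holomorphic_intros) (auto dest: nonpos_Ints_Re_le)

lemma mellin_inverse_shift:
  assumes k: "k \<ge> 1" and a: "0 < a" "a < b" and y: "y > 0"
  shows "integrable lborel (\<lambda>t. mellin_kernel k (Complex a t) * of_real y powr (- Complex a t))"
    and "integrable lborel (\<lambda>t. mellin_kernel k (Complex b t) * of_real y powr (- Complex b t))"
    and "mellin_inverse k a y = mellin_inverse k b y"
proof -
  obtain C where C: "C \<ge> 0" "\<And>w. a \<le> Re w \<Longrightarrow> Re w \<le> b \<Longrightarrow> norm (mellin_kernel k w) \<le> C / (1 + (Im w)\<^sup>2)"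
    using mellin_kernel_decay[OF a(1) k] by metis
  let ?f = "\<lambda>w. mellin_kernel k w * of_real y powr (- w)"
  let ?Y = "y powr (-b) + y powr (-a)"
  have hol: "?f holomorphic_on {w. Re w > 0} - {}"
    using y by (intro holomorphic_intros holomorphic_on_subset[OF holomorphic_mellin_kernel]) auto
  have decay: "norm (?f w) \<le> (C * ?Y) / (1 + (Im w)\<^sup>2)" if w: "a \<le> Re w" "Re w \<le> b" for w
  proof -
    have "norm (?f w) = norm (mellin_kernel k w) * y powr (- Re w)" using y by (simp add: norm_mult norm_powr_real_powr)
    also have "\<dots> \<le> C / (1 + (Im w)\<^sup>2) * ?Y"
      by (intro mult_mono C powr_strip_bound) (use w y C in auto)
    finally show ?thesis by simp
  qed
  note shift = vertical_line_shift[OF a(2) open_halfspace_Re_gt convex_connected[OF convex_halfspace_Re_gt] _ finite.emptyI _ hol decay]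
  show "integrable lborel (\<lambda>t. ?f (Complex a t))" by (rule shift(1)) (use a in auto)
  show "integrable lborel (\<lambda>t. ?f (Complex b t))" by (rule shift(2)) (use a in auto)
  have "(LINT t|lborel. ?f (Complex b t)) - (LINT t|lborel. ?f (Complex a t)) = 2 * of_real pi * (\<Sum>p\<in>{}. residue ?f p)"
    by (rule shift(3)) (use a in auto)
  thus "mellin_inverse k a y = mellin_inverse k b y" by (simp add: mellin_inverse_def)
qed

lemma mellin_inverse_abscissa_independent:
  assumes k: "k \<ge> 1" and c: "c > 0" "c' > 0" and y: "y > 0"
  shows "mellin_inverse k c y = mellin_inverse k c' y"
proof (cases c c' rule: linorder_cases)
  case less thus ?thesis by (rule mellin_inverse_shift(3)[OF k c(1) _ y])
next
  case greater thus ?thesis by (rule mellin_inverse_shift(3)[OF k c(2) _ y, symmetric])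
qed simp

text \<open>
  Interchange of an absolutely convergent Dirichlet series with an integral along a vertical line; it
  is applied twice, to the inner and to the outer sum over the divisor function.
\<close>

lemma dirichlet_series_integral:
  fixes F A :: "real \<Rightarrow> complex" and a :: "nat \<Rightarrow> real"
  assumes F: "integrable lborel F" and a: "\<And>n. a n \<ge> 0" "summable (\<lambda>n. a n * real (Suc n) powr (-c))"
    and A: "\<And>t. (\<lambda>n. of_real (a n) * of_nat (Suc n) powr (- Complex c t)) sums A t"
  shows "integrable lborel (\<lambda>t. F t * A t)"
    and "(\<lambda>n. of_real (a n) * (LINT t|lborel. F t * of_nat (Suc n) powr (- Complex c t))) sums (LINT t|lborel. F t * A t)"
proof -
  let ?f = "\<lambda>n t. F t * (of_real (a n) * of_nat (Suc n) powr (- Complex c t))"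
  have nrm: "norm (?f n t) = norm (F t) * (a n * real (Suc n) powr (-c))" for n t
    using a(1) by (simp add: norm_mult norm_powr_real_powr del: of_nat_Suc)
  have [measurable]: "F \<in> borel_measurable borel" using F borel_measurable_integrable by auto
  have meas: "(\<lambda>t. complex_of_nat (Suc n) powr (- Complex c t)) \<in> borel_measurable borel" for n
  proof (rule borel_measurable_continuous_onI)
    have "complex_of_nat (Suc n) \<noteq> 0" by (simp only: of_nat_eq_0_iff)
    thus "continuous_on UNIV (\<lambda>t. complex_of_nat (Suc n) powr (- Complex c t))"
      unfolding Complex_eq by (intro continuous_intros) (auto simp del: of_nat_Suc)
  qed
  have int: "integrable lborel (?f n)" for n
  proof (rule Bochner_Integration.integrable_bound)
    show "integrable lborel (\<lambda>t. norm (F t) * (a n * real (Suc n) powr (-c)))"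
      using F by (intro integrable_mult_left integrable_norm)
    show "?f n \<in> borel_measurable lborel" using meas[of n] by measurable
    show "AE t in lborel. norm (?f n t) \<le> norm (norm (F t) * (a n * real (Suc n) powr (-c)))"
      unfolding nrm by (intro AE_I2) simp
  qed
  have sm1: "AE t in lborel. summable (\<lambda>n. norm (?f n t))"
    unfolding nrm by (intro AE_I2 summable_mult a(2))
  have sm2: "summable (\<lambda>n. LINT t|lborel. norm (?f n t))"
    unfolding nrm using a(2) by (simp add: summable_mult)
  have eq: "(\<Sum>n. ?f n t) = F t * A t" for t
    using sums_mult[OF A[of t], of "F t"] by (simp add: sums_iff)
  show "integrable lborel (\<lambda>t. F t * A t)"
    using integrable_suminf[OF int sm1 sm2] unfolding eq .
  have "(\<lambda>n. LINT t|lborel. ?f n t) sums (LINT t|lborel. F t * A t)"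
    using sums_integral[OF int sm1 sm2] unfolding eq .
  also have "(\<lambda>n. LINT t|lborel. ?f n t) = (\<lambda>n. of_real (a n) * (LINT t|lborel. F t * of_nat (Suc n) powr (- Complex c t)))"
  proof
    fix n
    have "?f n = (\<lambda>t. of_real (a n) * (F t * of_nat (Suc n) powr (- Complex c t)))" by (simp add: fun_eq_iff)
    thus "(LINT t|lborel. ?f n t) = of_real (a n) * (LINT t|lborel. F t * of_nat (Suc n) powr (- Complex c t))" by simp
  qed
  finally show "(\<lambda>n. of_real (a n) * (LINT t|lborel. F t * of_nat (Suc n) powr (- Complex c t))) sums (LINT t|lborel. F t * A t)" .
qed

lemma of_real_mult_powr:
  "x > 0 \<Longrightarrow> y > 0 \<Longrightarrow> complex_of_real (x * y) powr w = of_real x powr w * of_real y powr w"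
  using powr_times_real[of "of_real x" "of_real y" w] by simp

text \<open>
  The Meijer integrals live on a line \<open>Re w = -2\<mu>\<close> where the Dirichlet series may diverge; each of them is
  moved to \<open>Re w = c > 1\<close> before summation.
\<close>

lemma Psi_line_integral:
  assumes k: "k \<ge> 1" and mu: "\<mu> < 0" and x: "x > 0" and r: "\<rho> > 0" and c: "c > 1"
  shows "integrable lborel (\<lambda>t. mellin_kernel k (Complex c t) * of_real (\<rho> * x) powr (- Complex c t) * zeta (Complex c t) ^ k)"
    and "Psi \<mu> \<rho> k x = 1 / (2 * of_real pi) *
      (LINT t|lborel. mellin_kernel k (Complex c t) * of_real (\<rho> * x) powr (- Complex c t) * zeta (Complex c t) ^ k)"
proof -
  let ?F = "\<lambda>t. mellin_kernel k (Complex c t) * of_real (\<rho> * x) powr (- Complex c t)"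
  have F: "integrable lborel ?F" by (rule mellin_inverse_shift(1)[OF k _ less_add_one]) (use c x r in auto)
  have A: "(\<lambda>n. of_real (real (piltz_d k (Suc n))) * of_nat (Suc n) powr (- Complex c t)) sums (zeta (Complex c t) ^ k)" for t
    using piltz_d_sums[of "Complex c t" k] c by simp
  have di: "integrable lborel (\<lambda>t. ?F t * zeta (Complex c t) ^ k)"
    "(\<lambda>n. of_real (real (piltz_d k (Suc n))) * (LINT t|lborel. ?F t * of_nat (Suc n) powr (- Complex c t))) sums
       (LINT t|lborel. ?F t * zeta (Complex c t) ^ k)"
    by (rule dirichlet_series_integral[OF F _ piltz_d_summable[OF c] A]; simp)+
  show "integrable lborel (\<lambda>t. ?F t * zeta (Complex c t) ^ k)" by fact
  define P where "P = complex_of_real (pi powr (real k / 2 - 1) / 2 ^ (k - 1))"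
  define G where "G = (\<lambda>j. meijer_G \<mu> k (\<rho>\<^sup>2 * (real (Suc j))\<^sup>2 * x\<^sup>2 / 2 ^ (2 * k)))"
  have P0: "P \<noteq> 0" by (simp add: P_def)
  have G: "P * G j = 1 / (2 * of_real pi) * (LINT t|lborel. ?F t * of_nat (Suc j) powr (- Complex c t))" for j
  proof -
    let ?Y = "(\<rho> * x) * real (Suc j)"
    have Y: "?Y > 0" using x r by simp
    have "G j = meijer_G \<mu> k (?Y\<^sup>2 / 2 ^ (2 * k))" by (simp add: G_def power_mult_distrib mult_ac)
    hence "P * G j = mellin_inverse k (-2 * \<mu>) ?Y"
      unfolding P_def by (simp only: meijer_G_eq_mellin_inverse[OF k Y mu])
    also have "\<dots> = mellin_inverse k c ?Y"
      by (rule mellin_inverse_abscissa_independent[OF k _ _ Y]) (use mu c in auto)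
    also have "\<dots> = 1 / (2 * of_real pi) * (LINT t|lborel. ?F t * of_nat (Suc j) powr (- Complex c t))"
      unfolding mellin_inverse_def using x r by (subst of_real_mult_powr) (simp_all add: mult.assoc)
    finally show ?thesis .
  qed
  have "(\<lambda>n. of_nat (piltz_d k (Suc n)) * (P * G n)) sums (1 / (2 * of_real pi) * (LINT t|lborel. ?F t * zeta (Complex c t) ^ k))"
    using sums_mult[OF di(2), of "1 / (2 * of_real pi)"] unfolding G by (simp add: mult_ac)
  hence s1: "(\<lambda>n. P * (of_nat (piltz_d k (Suc n)) * G n)) sums (1 / (2 * of_real pi) * (LINT t|lborel. ?F t * zeta (Complex c t) ^ k))"
    by (simp add: mult_ac)
  hence "summable (\<lambda>n. of_nat (piltz_d k (Suc n)) * G n)" using P0 by (intro summable_mult_D[OF sums_summable])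
  hence "P * (\<Sum>n. of_nat (piltz_d k (Suc n)) * G n) = (\<Sum>n. P * (of_nat (piltz_d k (Suc n)) * G n))"
    by (rule suminf_mult[symmetric])
  also have "\<dots> = 1 / (2 * of_real pi) * (LINT t|lborel. ?F t * zeta (Complex c t) ^ k)"
    using s1 by (simp only: sums_iff)
  finally show "Psi \<mu> \<rho> k x = 1 / (2 * of_real pi) * (LINT t|lborel. ?F t * zeta (Complex c t) ^ k)"
    unfolding Psi_def P_def G_def .
qed

lemma Psi_sums_line_integral:
  assumes k: "k \<ge> 1" and mu: "\<mu> < 0" and r: "\<rho> > 0" and c: "c > 1"
  shows "(\<lambda>n. of_nat (piltz_d k (Suc n)) / of_nat (Suc n) * Psi \<mu> \<rho> k (real (Suc n))) sums
    (1 / (2 * of_real pi) * (LINT t|lborel. mellin_kernel k (Complex c t) * of_real \<rho> powr (- Complex c t)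
        * zeta (Complex c t) ^ k * zeta (1 + Complex c t) ^ k))"
proof -
  let ?F = "\<lambda>t. mellin_kernel k (Complex c t) * of_real \<rho> powr (- Complex c t) * zeta (Complex c t) ^ k"
  let ?a = "\<lambda>n. real (piltz_d k (Suc n)) / real (Suc n)"
  have F: "integrable lborel ?F" 
    using Psi_line_integral(1)[OF k mu zero_less_one r c] unfolding mult_1_right .
  have sm: "summable (\<lambda>n. ?a n * real (Suc n) powr (-c))"
  proof -
    have "?a n * real (Suc n) powr (-c) = real (piltz_d k (Suc n)) * real (Suc n) powr (- (c + 1))" for n
    proof -
      have "- (c + 1) = - c - 1" by simp
      hence "real (Suc n) powr (- (c + 1)) = real (Suc n) powr (- c) / real (Suc n)"
        by (simp only: powr_diff) simp
      thus ?thesis by (simp del: of_nat_Suc)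
    qed
    thus ?thesis using piltz_d_summable[of "c + 1" k] c by (simp del: of_nat_Suc)
  qed
  have A: "(\<lambda>n. of_real (?a n) * of_nat (Suc n) powr (- Complex c t)) sums (zeta (1 + Complex c t) ^ k)" for t
  proof -
    have "(\<lambda>n. of_nat (piltz_d k (Suc n)) * of_nat (Suc n) powr (- (1 + Complex c t))) sums (zeta (1 + Complex c t) ^ k)"
      by (rule piltz_d_sums) (use c in simp)
    also have "(\<lambda>n. of_nat (piltz_d k (Suc n)) * of_nat (Suc n) powr (- (1 + Complex c t))) =
       (\<lambda>n. complex_of_real (?a n) * of_nat (Suc n) powr (- Complex c t))"
    proof
      fix n
      have "complex_of_nat (Suc n) \<noteq> 0" by (simp only: of_nat_eq_0_iff)
      hence p: "complex_of_nat (Suc n) powr (- Complex c t - 1) = of_nat (Suc n) powr (- Complex c t) / of_nat (Suc n)"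
        by (simp add: powr_diff del: of_nat_Suc)
      have e: "- (1 + Complex c t) = - Complex c t - 1" by simp
      show "of_nat (piltz_d k (Suc n)) * of_nat (Suc n) powr (- (1 + Complex c t)) =
         complex_of_real (?a n) * of_nat (Suc n) powr (- Complex c t)"
        unfolding e p by (simp del: of_nat_Suc)
    qed
    finally show ?thesis .
  qed
  have "(\<lambda>n. of_real (?a n) * (LINT t|lborel. ?F t * of_nat (Suc n) powr (- Complex c t))) sums (LINT t|lborel. ?F t * zeta (1 + Complex c t) ^ k)"
    by (rule dirichlet_series_integral(2)[OF F _ sm A]) simp
  from sums_mult[OF this, of "1 / (2 * of_real pi)"]
  have "(\<lambda>n. of_real (?a n) * (1 / (2 * of_real pi) * (LINT t|lborel. ?F t * of_nat (Suc n) powr (- Complex c t)))) sums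
     (1 / (2 * of_real pi) * (LINT t|lborel. ?F t * zeta (1 + Complex c t) ^ k))"
    by (simp only: mult_ac)
  also have "(\<lambda>n. of_real (?a n) * (1 / (2 * of_real pi) * (LINT t|lborel. ?F t * of_nat (Suc n) powr (- Complex c t)))) =
    (\<lambda>n. of_nat (piltz_d k (Suc n)) / of_nat (Suc n) * Psi \<mu> \<rho> k (real (Suc n)))"
  proof
    fix n
    have "Psi \<mu> \<rho> k (real (Suc n)) = 1 / (2 * of_real pi) *
      (LINT t|lborel. mellin_kernel k (Complex c t) * of_real (\<rho> * real (Suc n)) powr (- Complex c t) * zeta (Complex c t) ^ k)"
      by (rule Psi_line_integral(2)[OF k mu _ r c]) simp
    also have "(\<lambda>t. mellin_kernel k (Complex c t) * of_real (\<rho> * real (Suc n)) powr (- Complex c t) * zeta (Complex c t) ^ k) =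
       (\<lambda>t. ?F t * of_nat (Suc n) powr (- Complex c t))"
      using of_real_mult_powr[OF r, of "real (Suc n)"] by (simp add: fun_eq_iff del: of_nat_Suc)
    finally show "of_real (?a n) * (1 / (2 * of_real pi) * (LINT t|lborel. ?F t * of_nat (Suc n) powr (- Complex c t))) =
       of_nat (piltz_d k (Suc n)) / of_nat (Suc n) * Psi \<mu> \<rho> k (real (Suc n))"
      by (simp del: of_nat_Suc)
  qed
  finally show ?thesis .
qed

section \<open>The transformation formula\<close>

text \<open>
  The abscissa \<open>3/2\<close> lies to the right of \<open>1\<close>, where the Dirichlet series converge, and to the left of \<open>2\<close>,
  so that \<open>1-w\<close> stays in the half-plane \<open>Re s > -1\<close> of the trapezoidal rule.
\<close>

lemma Psi_series_sums_even_kernel: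
  assumes k: "k \<ge> 1" and mu: "\<mu> < 0" and \<alpha>: "\<alpha> > 0"
  shows "(\<lambda>n. of_nat (piltz_d k (Suc n)) / of_nat (Suc n) * Psi \<mu> ((2 * \<alpha>) ^ k) k (real (Suc n))) sums
    (1 / (2 * of_real pi) * (1 / 2 ^ k *
       (LINT t|lborel. even_kernel k (Complex (3/2) t) * of_real ((pi / \<alpha>) ^ k) powr Complex (3/2) t)))"
proof -
  have "(\<lambda>t. mellin_kernel k (Complex (3/2) t) * of_real ((2 * \<alpha>) ^ k) powr (- Complex (3/2) t)
          * zeta (Complex (3/2) t) ^ k * zeta (1 + Complex (3/2) t) ^ k)
      = (\<lambda>t. 1 / 2 ^ k * (even_kernel k (Complex (3/2) t) * of_real ((pi / \<alpha>) ^ k) powr Complex (3/2) t))"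
    unfolding mellin_kernel_def by (intro ext mellin_integrand_eq_even_kernel[OF k _ \<alpha>]) simp
  thus ?thesis
    using Psi_sums_line_integral[OF k mu, of "(2 * \<alpha>) ^ k" "3/2"] \<alpha> by simp
qed

text \<open>
  Turns the residues at \<open>\<plusminus>1\<close> into the form in which the theorem states them.
\<close>

lemma residue_power_term:
  fixes \<beta> :: real
  assumes "k \<ge> 1"
  shows "1 / 2 ^ k * (- (2 / pi) * (- (pi\<^sup>2 / 12)) ^ k * (\<beta> / pi) ^ k) = 2 * ((-1) ^ (k + 1) * pi ^ (k - 1) / 24 ^ k) * \<beta> ^ k"
proof -
  obtain m where m: "k = Suc m" using assms by (cases k) auto
  have "1 / 2 ^ k * (- (2 / pi) * (- (pi\<^sup>2 / 12)) ^ k * (\<beta> / pi) ^ k) = - (2 / pi) * (1 / 2 * (- (pi\<^sup>2 / 12)) * (\<beta> / pi)) ^ k"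
    by (simp only: power_mult_distrib power_one_over mult_ac)
  also have "1 / 2 * (- (pi\<^sup>2 / 12)) * (\<beta> / pi) = (- 1) * (pi * \<beta> / 24)" by (simp add: power2_eq_square)
  also have "((- 1) * (pi * \<beta> / 24)) ^ k = (- 1) ^ k * (pi * pi ^ m * \<beta> ^ k / 24 ^ k)"
    unfolding power_mult_distrib power_divide by (simp add: m)
  finally show ?thesis by (simp add: m)
qed

theorem theorem1p6:
  fixes k :: nat and \<alpha> \<beta> \<mu> :: real
  assumes "k \<ge> 1" and "\<alpha> > 0" and "\<beta> > 0" and "\<alpha> * \<beta> = pi\<^sup>2" and "\<mu> < 0"
  shows "summable (\<lambda>n. of_nat (piltz_d k (Suc n)) / of_nat (Suc n) *
                       Psi \<mu> ((2 * \<alpha>) ^ k) k (real (Suc n))) \<and>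
         summable (\<lambda>n. of_nat (piltz_d k (Suc n)) / of_nat (Suc n) *
                       Psi \<mu> ((2 * \<beta>) ^ k) k (real (Suc n))) \<and>
         (\<Sum>n. of_nat (piltz_d k (Suc n)) / of_nat (Suc n) *
                Psi \<mu> ((2 * \<alpha>) ^ k) k (real (Suc n)))
         - (\<Sum>n. of_nat (piltz_d k (Suc n)) / of_nat (Suc n) *
                Psi \<mu> ((2 * \<beta>) ^ k) k (real (Suc n)))
         = (-1) ^ k * 2 ^ k / fact (2 * k - 1) *
             (deriv ^^ (2 * k - 1))
               (\<lambda>s :: complex. Gamma (1 + s) ^ k * Gamma (1 - s) ^ k * zeta s ^ k * zeta (- s) ^ k *
                    cos (of_real pi * s / 2) ^ (2 * k - 1) *
                    of_real (\<alpha> / \<beta>) powr (- (of_nat k * s / 2))) 0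
           + of_real (2 * ((-1) ^ (k + 1) * pi ^ (k - 1) / 24 ^ k) * (\<beta> ^ k - \<alpha> ^ k))"
proof -
  note k = assms(1) and \<alpha> = assms(2) and \<beta> = assms(3) and mu = assms(5)
  define X where "X = (pi / \<alpha>) ^ k"
  have X: "X > 0" using \<alpha> by (simp add: X_def)
  have ab: "pi / \<alpha> = \<beta> / pi" "pi / \<beta> = \<alpha> / pi"
    using assms(4) \<alpha> \<beta> by (simp_all add: field_simps power2_eq_square)
  have Xb: "X = (\<beta> / pi) ^ k" by (simp add: X_def ab)
  have Xa: "1 / X = (\<alpha> / pi) ^ k" by (simp add: X_def power_divide)
  \<comment> \<open>\<open>\<alpha>\<beta> = \<pi>\<^sup>2\<close> makes the two bases reciprocal, so exchanging them is \<open>w \<mapsto> -w\<close>\<close>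
  have Xpm: "of_real ((pi / \<beta>) ^ k) powr w = of_real X powr (- w)" for w :: complex
  proof -
    have "(pi / \<beta>) ^ k = 1 / X" by (simp only: Xa ab)
    hence "of_real ((pi / \<beta>) ^ k) powr w = exp (w * complex_of_real (ln (1 / X)))"
      using of_real_powr_exp[of "1 / X" w] X by simp
    also have "ln (1 / X) = - ln X" using X by (simp add: ln_div)
    also have "exp (w * complex_of_real (- ln X)) = exp (- w * complex_of_real (ln X))" by simp
    also have "\<dots> = of_real X powr (- w)" by (rule of_real_powr_exp[OF X, symmetric])
    finally show ?thesis .
  qed
  let ?I = "LINT t|lborel. even_kernel k (Complex (3/2) t) * of_real X powr Complex (3/2) t"
  let ?J = "LINT t|lborel. even_kernel k (Complex (3/2) t) * of_real X powr (- Complex (3/2) t)"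
  let ?res = "\<lambda>p. residue (\<lambda>w. even_kernel k w * of_real X powr w) p"
  let ?S = "\<lambda>\<gamma>. (\<lambda>n. of_nat (piltz_d k (Suc n)) / of_nat (Suc n) * Psi \<mu> ((2 * \<gamma>) ^ k) k (real (Suc n)))"
  have sa: "?S \<alpha> sums (1 / (2 * of_real pi) * (1 / 2 ^ k * ?I))"
    using Psi_series_sums_even_kernel[OF k mu \<alpha>] unfolding X_def .
  have sb: "?S \<beta> sums (1 / (2 * of_real pi) * (1 / 2 ^ k * ?J))"
    using Psi_series_sums_even_kernel[OF k mu \<beta>] unfolding Xpm .
  have "(\<Sum>n. ?S \<alpha> n) - (\<Sum>n. ?S \<beta> n) = 1 / (2 * of_real pi) * (1 / 2 ^ k * ?I) - 1 / (2 * of_real pi) * (1 / 2 ^ k * ?J)"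
    using sa sb by (simp only: sums_iff)
  also have "\<dots> = 1 / (2 * of_real pi) * (1 / 2 ^ k * (?I - ?J))" by (simp only: right_diff_distrib)
  also have "?I - ?J = 2 * of_real pi * (?res 0 + ?res 1 + ?res (-1))" by (rule even_kernel_line_shift[OF X])
  also have "1 / (2 * of_real pi) * (1 / 2 ^ k * (2 * of_real pi * (?res 0 + ?res 1 + ?res (-1)))) =
      1 / 2 ^ k * ?res 0 + (1 / 2 ^ k * ?res 1 + 1 / 2 ^ k * ?res (-1))" by (simp add: field_simps)
  also have "1 / 2 ^ k * ?res 0 = (-1) ^ k * 2 ^ k / fact (2 * k - 1) *
             (deriv ^^ (2 * k - 1))
               (\<lambda>s :: complex. Gamma (1 + s) ^ k * Gamma (1 - s) ^ k * zeta s ^ k * zeta (- s) ^ k *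
                    cos (of_real pi * s / 2) ^ (2 * k - 1) *
                    of_real (\<alpha> / \<beta>) powr (- (of_nat k * s / 2))) 0"
  proof -
    have "of_real X powr s = of_real (\<alpha> / \<beta>) powr (- (of_nat k * s / 2))" for s :: complex
    proof -
      have "of_real X powr s = exp (s * complex_of_real (ln X))" by (rule of_real_powr_exp[OF X])
      also have "ln X = real k * ln (pi / \<alpha>)" using \<alpha> by (simp add: X_def ln_realpow)
      also have "ln (pi / \<alpha>) = - (ln (\<alpha> / \<beta>) / 2)"
      proof -
        have "\<alpha> / \<beta> = (\<alpha> / pi) ^ 2" using assms(4) \<alpha> \<beta> by (simp add: field_simps power2_eq_square)
        hence "ln (\<alpha> / \<beta>) = 2 * ln (\<alpha> / pi)" using \<alpha> by (simp add: ln_realpow)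
        moreover have "ln (pi / \<alpha>) = - ln (\<alpha> / pi)" using \<alpha> by (simp add: ln_div)
        ultimately show ?thesis by linarith
      qed
      also have "s * complex_of_real (real k * - (ln (\<alpha> / \<beta>) / 2)) = - (of_nat k * s / 2) * complex_of_real (ln (\<alpha> / \<beta>))"
        by simp
      also have "exp \<dots> = of_real (\<alpha> / \<beta>) powr (- (of_nat k * s / 2))"
        by (rule of_real_powr_exp[symmetric]) (use \<alpha> \<beta> in simp)
      finally show ?thesis .
    qed
    moreover have "1 / 2 ^ k * (-4 :: complex) ^ k = (-1) ^ k * 2 ^ k"
    proof -
      have "(-4 :: complex) = (-1) * 2 * 2" by simp
      hence "(-4 :: complex) ^ k = (-1) ^ k * 2 ^ k * 2 ^ k" by (simp only: power_mult_distrib)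
      thus ?thesis by simp
    qed
    ultimately show ?thesis unfolding residue_even_kernel_at_0[OF X k]
      by (simp only: times_divide_eq_right times_divide_eq_left mult.assoc[symmetric])
  qed
  also have "1 / 2 ^ k * ?res 1 = of_real (2 * ((-1) ^ (k + 1) * pi ^ (k - 1) / 24 ^ k) * \<beta> ^ k)"
  proof -
    have "complex_of_real X powr 1 = of_real ((\<beta> / pi) ^ k)"
      unfolding Xb[symmetric] using X by simp
    hence "1 / 2 ^ k * ?res 1 = of_real (1 / 2 ^ k * (- (2 / pi) * (- (pi\<^sup>2 / 12)) ^ k * (\<beta> / pi) ^ k))"
      unfolding residue_even_kernel_at_pm1[OF X disjI1[OF refl]] by (simp only:) simp
    thus ?thesis by (simp only: residue_power_term[OF k])
  qed
  also have "1 / 2 ^ k * ?res (-1) = - of_real (2 * ((-1) ^ (k + 1) * pi ^ (k - 1) / 24 ^ k) * \<alpha> ^ k)"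
  proof -
    have "complex_of_real X powr (-1) = of_real ((\<alpha> / pi) ^ k)"
      unfolding Xa[symmetric] using X by (simp add: powr_minus inverse_eq_divide)
    hence "1 / 2 ^ k * ?res (-1) = - of_real (1 / 2 ^ k * (- (2 / pi) * (- (pi\<^sup>2 / 12)) ^ k * (\<alpha> / pi) ^ k))"
      unfolding residue_even_kernel_at_pm1[OF X disjI2[OF refl]] by (simp only:) simp
    thus ?thesis by (simp only: residue_power_term[OF k])
  qed
  finally have "(\<Sum>n. ?S \<alpha> n) - (\<Sum>n. ?S \<beta> n) = (-1) ^ k * 2 ^ k / fact (2 * k - 1) *
             (deriv ^^ (2 * k - 1))
               (\<lambda>s :: complex. Gamma (1 + s) ^ k * Gamma (1 - s) ^ k * zeta s ^ k * zeta (- s) ^ k *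
                    cos (of_real pi * s / 2) ^ (2 * k - 1) *
                    of_real (\<alpha> / \<beta>) powr (- (of_nat k * s / 2))) 0
      + of_real (2 * ((-1) ^ (k + 1) * pi ^ (k - 1) / 24 ^ k) * (\<beta> ^ k - \<alpha> ^ k))"
    by (simp add: right_diff_distrib)
  thus ?thesis using sa sb by (auto simp: sums_iff)
qed

end
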